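(* For any nonnegative integer $d$ the Loewy length of $\mathbf V^{\otimes d}$, regarded as an $\mathfrak{so}_\infty$-module, equals $\left[\frac d2\right]+1$, and $$\operatorname{soc}^{(r)}\mathbf V^{\otimes d}=\bigcap_{I_1,\dots,I_r}\ker\Big(\Phi_{[I_1,\dots,I_r]}:\mathbf V^{\otimes d}\to\mathbf V^{\otimes(d-2r)}\Big),\qquad r=1,\dots,\left[\tfrac d2\right],$$ where the intersection is over all collections of $r$ pairwise disjoint index pairs.
   Context: $\Bbbk$ is an algebraically closed field of characteristic zero; everything is over $\Bbbk$. $[x]$ denotes the integer part of $x$. Let $\mathbf V$ be a countably infinite-dimensional vector space with a non-degenerate symmetric bilinear form $Q:\mathbf V\otimes\mathbf V\to\Bbbk$. $\mathfrak{gl}_\infty$ is the Lie algebra of operators on $\mathbf V$ spanned by $u\otimes w:\ v\mapsto Q(v,w)u$ ($u,w\in\mathbf V$), and $\mathfrak{so}_\infty=\{X\in\mathfrak{gl}_\infty:Q(Xu,v)+Q(u,Xv)=0\ \forall u,v\in\mathbf V\}$. Both act on $\mathbf V^{\otimes d}$ by the Leibniz rule. An index pair is $I=(i,j)$ with $1\le i<j\le d$. For pairwise disjoint index pairs $I_1=(i_1,j_1),\dots,I_r=(i_r,j_r)$ (all $2r$ indices distinct), $\Phi_{[I_1,\dots,I_r]}:\mathbf V^{\otimes d}\to\mathbf V^{\otimes(d-2r)}$ is the $r$-fold contraction sending $v_1\otimes\dots\otimes v_d$ to $\prod_kQ(v_{i_k},v_{j_k})$ times the tensor obtained by omitting all $v_{i_k},v_{j_k}$.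 For a finite length module $M$, $\operatorname{soc}M$ is the sum of all simple submodules; the socle filtration is defined by $\operatorname{soc}^{(0)}M=0$ and $\operatorname{soc}^{(i+1)}M/\operatorname{soc}^{(i)}M=\operatorname{soc}(M/\operatorname{soc}^{(i)}M)$. The Loewy length is the smallest positive integer $l$ with $\operatorname{soc}^{(l)}M=M$. *)

theory Defs
  imports
    Complex_Main
    "HOL-Library.Poly_Mapping"
    "HOL-Library.Function_Algebras"
    "HOL-Library.Countable_Set"
    "HOL-Computational_Algebra.Polynomial"
begin

section \<open>Modules, quotients and the socle filtration\<close>

text \<open>
  A vector space over \<open>'k\<close> with carrier in \<open>'m\<close> on which the elements of \<open>'g\<close> act by operators.
  An explicit carrier is needed because quotients are formed on sets of cosets.
\<close>

record ('k, 'g, 'm) rep =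
  carr :: "'m set"
  add :: "'m \<Rightarrow> 'm \<Rightarrow> 'm"
  zero :: "'m"
  smult :: "'k \<Rightarrow> 'm \<Rightarrow> 'm"
  act :: "'g \<Rightarrow> 'm \<Rightarrow> 'm"

text \<open>Stability is required only under the subset \<open>g\<close> of the operators.\<close>

definition submod :: "'g set \<Rightarrow> ('k, 'g, 'm) rep \<Rightarrow> 'm set \<Rightarrow> bool" where
  "submod g M N \<longleftrightarrow> N \<subseteq> carr M \<and> zero M \<in> N
     \<and> (\<forall>x\<in>N. \<forall>y\<in>N. add M x y \<in> N)
     \<and> (\<forall>c. \<forall>x\<in>N. smult M c x \<in> N)
     \<and> (\<forall>X\<in>g. \<forall>x\<in>N. act M X x \<in> N)"

definition simple_submod :: "'g set \<Rightarrow> ('k, 'g, 'm) rep \<Rightarrow> 'm set \<Rightarrow> bool" where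
  "simple_submod g M S \<longleftrightarrow> submod g M S \<and> S \<noteq> {zero M}
     \<and> (\<forall>N. submod g M N \<and> N \<subseteq> S \<longrightarrow> N = {zero M} \<or> N = S)"

inductive_set sum_of :: "('k, 'g, 'm) rep \<Rightarrow> 'm set set \<Rightarrow> 'm set"
  for M :: "('k, 'g, 'm) rep" and \<S> :: "'m set set" where
  "zero M \<in> sum_of M \<S>"
| "\<lbrakk>x \<in> sum_of M \<S>; S \<in> \<S>; y \<in> S\<rbrakk> \<Longrightarrow> add M x y \<in> sum_of M \<S>"

definition soc :: "'g set \<Rightarrow> ('k, 'g, 'm) rep \<Rightarrow> 'm set" where
  "soc g M = sum_of M {S. simple_submod g M S}"

definition coset :: "('k, 'g, 'm) rep \<Rightarrow> 'm set \<Rightarrow> 'm \<Rightarrow> 'm set" where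
  "coset M N m = add M m ` N"

text \<open>
  The unions below run over all representatives; they are single cosets whenever \<open>N\<close> is stable under
  the operation in question.
\<close>

definition quot :: "('k, 'g, 'm) rep \<Rightarrow> 'm set \<Rightarrow> ('k, 'g, 'm set) rep" where
  "quot M N =
    \<lparr> carr = coset M N ` carr M,
      add = (\<lambda>A B. \<Union>a\<in>A. \<Union>b\<in>B. coset M N (add M a b)),
      zero = N,
      smult = (\<lambda>c A. \<Union>a\<in>A. coset M N (smult M c a)),
      act = (\<lambda>X A. \<Union>a\<in>A. coset M N (act M X a)) \<rparr>"

text \<open>
  The submodule \<open>soc_filt g M (Suc i)\<close> is the preimage of the socle of the quotient of \<open>M\<close> by
  \<open>soc_filt g M i\<close> under the projection.
\<close>

primrec soc_filt :: "'g set \<Rightarrow> ('k, 'g, 'm) rep \<Rightarrow> nat \<Rightarrow> 'm set" where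
  "soc_filt g M 0 = {zero M}"
| "soc_filt g M (Suc i) =
     {m \<in> carr M. coset M (soc_filt g M i) m \<in> soc g (quot M (soc_filt g M i))}"

definition has_loewy_length :: "'g set \<Rightarrow> ('k, 'g, 'm) rep \<Rightarrow> nat \<Rightarrow> bool" where
  "has_loewy_length g M l \<longleftrightarrow> 0 < l \<and> soc_filt g M l = carr M
     \<and> (\<forall>l'. 0 < l' \<and> soc_filt g M l' = carr M \<longrightarrow> l \<le> l')"

section \<open>The space with its form, and the Lie algebras\<close>

locale countable_quadratic_space = vector_space scale
  for scale :: "'k::{alg_closed_field, field_char_0} \<Rightarrow> 'v::ab_group_add \<Rightarrow> 'v" +
  fixes Q :: "'v \<Rightarrow> 'v \<Rightarrow> 'k"
  assumes countable_basis: "\<exists>B. independent B \<and> span B = UNIV \<and> countable B \<and> infinite B"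
    and bilinear_left: "Vector_Spaces.linear scale (*) (\<lambda>v. Q v w)"
    and bilinear_right: "Vector_Spaces.linear scale (*) (\<lambda>w. Q v w)"
    and symmetric: "Q v w = Q w v"
    and nondegenerate: "(\<forall>w. Q v w = 0) \<Longrightarrow> v = 0"

definition gl_inf :: "('k::field \<Rightarrow> 'v::ab_group_add \<Rightarrow> 'v) \<Rightarrow> ('v \<Rightarrow> 'v \<Rightarrow> 'k) \<Rightarrow> ('v \<Rightarrow> 'v) set" where
  "gl_inf scale Q =
     module.span (\<lambda>c X v. scale c (X v)) {X. \<exists>u w. X = (\<lambda>v. scale (Q v w) u)}"

definition so_inf :: "('k::field \<Rightarrow> 'v::ab_group_add \<Rightarrow> 'v) \<Rightarrow> ('v \<Rightarrow> 'v \<Rightarrow> 'k) \<Rightarrow> ('v \<Rightarrow> 'v) set" where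
  "so_inf scale Q = {X \<in> gl_inf scale Q. \<forall>u v. Q (X u) v + Q u (X v) = 0}"

section \<open>Tensor powers\<close>

text \<open>
  \<open>'v list \<Rightarrow>\<^sub>0 'k\<close> is the free vector space on the lists of vectors; the \<open>d\<close>-th tensor power is the
  quotient of the span of the lists of length \<open>d\<close> by the usual multilinearity relations.
\<close>

definition fscale :: "'k::field \<Rightarrow> ('a \<Rightarrow>\<^sub>0 'k) \<Rightarrow> ('a \<Rightarrow>\<^sub>0 'k)" where
  "fscale c = Poly_Mapping.map ((*) c)"

definition lin_ext :: "('a \<Rightarrow> ('b \<Rightarrow>\<^sub>0 'k::field)) \<Rightarrow> ('a \<Rightarrow>\<^sub>0 'k) \<Rightarrow> ('b \<Rightarrow>\<^sub>0 'k)" where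
  "lin_ext f p = (\<Sum>a\<in>Poly_Mapping.keys p. fscale (Poly_Mapping.lookup p a) (f a))"

abbreviation gen :: "'a \<Rightarrow> ('a \<Rightarrow>\<^sub>0 'k::field)" where
  "gen a \<equiv> Poly_Mapping.single a 1"

text \<open>
  The Leibniz rule on generators. This does not respect brackets before passing to the tensor power.
\<close>

definition leibniz :: "('v \<Rightarrow> 'v) \<Rightarrow> ('v list \<Rightarrow>\<^sub>0 'k::field) \<Rightarrow> ('v list \<Rightarrow>\<^sub>0 'k)" where
  "leibniz X = lin_ext (\<lambda>vs. \<Sum>i<length vs. gen (vs[i := X (vs ! i)]))"

definition free_power :: "nat \<Rightarrow> ('k::field, 'v \<Rightarrow> 'v, 'v list \<Rightarrow>\<^sub>0 'k) rep" where
  "free_power d =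
    \<lparr> carr = {p. Poly_Mapping.keys p \<subseteq> {vs. length vs = d}},
      add = (+), zero = 0, smult = fscale, act = leibniz \<rparr>"

definition tensor_rels ::
    "('k::field \<Rightarrow> 'v::ab_group_add \<Rightarrow> 'v) \<Rightarrow> nat \<Rightarrow> ('v list \<Rightarrow>\<^sub>0 'k) set" where
  "tensor_rels scale d = module.span fscale
    ({gen (us @ (v + w) # ws) - gen (us @ v # ws) - gen (us @ w # ws) | us v w ws.
        length us + length ws + 1 = d} \<union>
     {gen (us @ scale c v # ws) - fscale c (gen (us @ v # ws)) | us c v ws.
        length us + length ws + 1 = d})"

definition tensor_power ::
    "('k::field \<Rightarrow> 'v::ab_group_add \<Rightarrow> 'v) \<Rightarrow> nat \<Rightarrow> ('k, 'v \<Rightarrow> 'v, ('v list \<Rightarrow>\<^sub>0 'k) set) rep" where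
  "tensor_power scale d = quot (free_power d) (tensor_rels scale d)"

section \<open>Contractions\<close>

text \<open>Indices are 1-based, as in the notation \<open>v\<^sub>1 \<otimes> \<dots> \<otimes> v\<^sub>d\<close>.\<close>

definition disjoint_pairs :: "nat \<Rightarrow> nat \<Rightarrow> (nat \<times> nat) list set" where
  "disjoint_pairs d r = {Is. length Is = r \<and> (\<forall>(i, j)\<in>set Is. 1 \<le> i \<and> i < j \<and> j \<le> d)
     \<and> distinct (map fst Is @ map snd Is)}"

definition free_contraction ::
    "('v \<Rightarrow> 'v \<Rightarrow> 'k::field) \<Rightarrow> (nat \<times> nat) list \<Rightarrow> ('v list \<Rightarrow>\<^sub>0 'k) \<Rightarrow> ('v list \<Rightarrow>\<^sub>0 'k)" where
  "free_contraction Q Is = lin_ext (\<lambda>vs.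
     fscale (\<Prod>(i, j)\<leftarrow>Is. Q (vs ! (i - 1)) (vs ! (j - 1)))
       (gen (nths vs {k. k + 1 \<notin> fst ` set Is \<union> snd ` set Is})))"

definition contraction ::
    "('k::field \<Rightarrow> 'v::ab_group_add \<Rightarrow> 'v) \<Rightarrow> ('v \<Rightarrow> 'v \<Rightarrow> 'k) \<Rightarrow> nat \<Rightarrow> (nat \<times> nat) list
       \<Rightarrow> ('v list \<Rightarrow>\<^sub>0 'k) set \<Rightarrow> ('v list \<Rightarrow>\<^sub>0 'k) set" where
  "contraction scale Q d Is A =
     (let e = d - 2 * length Is
      in \<Union>a\<in>A. coset (free_power e) (tensor_rels scale e) (free_contraction Q Is a))"

definition contraction_kernel ::
    "('k::field \<Rightarrow> 'v::ab_group_add \<Rightarrow> 'v) \<Rightarrow> ('v \<Rightarrow> 'v \<Rightarrow> 'k) \<Rightarrow> nat \<Rightarrow> (nat \<times> nat) list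
       \<Rightarrow> ('v list \<Rightarrow>\<^sub>0 'k) set set" where
  "contraction_kernel scale Q d Is =
     {A \<in> carr (tensor_power scale d).
        contraction scale Q d Is A = zero (tensor_power scale (d - 2 * length Is))}"

end

theory Submission
  imports Defs "HOL-Combinatorics.Permutations"
begin

text \<open>
  A tensor is tested by pairing it with vectors: the contractions of \<open>p\<close> along \<open>r\<close> disjoint pairs become
  multilinear functions of the remaining slots, and \<open>V\<^sup>d\<close> modulo the common kernel of these contractions
  is identified with a module of families of such functions. It then suffices to see that the socle of this
  module consists of the families all of whose further contractions vanish.

  Two constructions do this. Let \<open>u\<^sub>1, \<dots>, u\<^sub>e\<close> be isotropic, mutually orthogonal and orthogonal to everything
  in sight. Substituting the \<open>u\<^sub>a\<close> for all \<open>e\<close> slots, by the elements \<open>u\<^sub>a \<and> w\<^sub>a\<close> of the Lie algebra, sends a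
  nonzero family to a nonzero traceless family, so every nonzero submodule meets the traceless families.
  Conversely, if \<open>v\<close> is dual to \<open>u\<close>, the operator \<open>\<Sum>\<^sub>x (x \<and> v) (u \<and> x\<^sup>*)\<close> multiplies a traceless family by its
  number of unsubstituted slots, because all correction terms are traces. In characteristic zero a traceless family is
  therefore generated by its substitutions. Their coefficients form a representation of the symmetric group,
  and semisimplicity of the traceless families follows from Maschke's theorem.
\<close>

section \<open>Quotients and socles of linear representations\<close>

text \<open>Elements of the successive quotients are sets of sets, so no computation takes place
  there. Every quotient is presented as an image of \<open>free_power d\<close>, and a socle depends
  only on the kernel of such a presentation; it remains to compare the kernels
  \<open>theta_ker d r\<close> for consecutive \<open>r\<close>. The quotient by
  \<open>theta_ker d r\<close> embeds only into the sum over all collections of \<open>r\<close>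
  pairs, and a submodule may sit diagonally in that sum. This is why whole families are treated at
  once, with one coefficient space for all members, and why complements come from averaging and not
  from splitting member by member. The constructions rest on the fact that a tensor involves
  finitely many vectors, while every finite set leaves isotropic vectors orthogonal to it; producing
  these takes square roots, hence an algebraically closed field. The operator built from
  \<open>u\<close> and \<open>v\<close> can be iterated: after j substitutions its eigenvalue on a
  traceless family with e slots is e - j, so undoing all of them divides by 1, 2, ..., e.\<close>

locale lin_rep =
  fixes g :: "'g set" and P :: "('k::field, 'g, 'p::ab_group_add) rep"
  assumes add_eq: "add P = (+)" and zero_eq: "zero P = 0"
    and zero_in: "0 \<in> carr P"
    and add_in: "x \<in> carr P \<Longrightarrow> y \<in> carr P \<Longrightarrow> x + y \<in> carr P"
    and smult_in: "x \<in> carr P \<Longrightarrow> smult P c x \<in> carr P"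
    and act_in: "X \<in> g \<Longrightarrow> x \<in> carr P \<Longrightarrow> act P X x \<in> carr P"
    and smult_add: "x \<in> carr P \<Longrightarrow> y \<in> carr P \<Longrightarrow> smult P c (x + y) = smult P c x + smult P c y"
    and act_add: "X \<in> g \<Longrightarrow> x \<in> carr P \<Longrightarrow> y \<in> carr P \<Longrightarrow> act P X (x + y) = act P X x + act P X y"
    and smult_minus_one: "x \<in> carr P \<Longrightarrow> smult P (- 1) x = - x"
begin

text \<open>A presentation of \<open>M\<close> by the fixed \<open>P\<close>. Two modules are
  compared by presenting both, which avoids maps between types of cosets. Only the laws listed in
  \<open>lin_rep\<close> are at hand, and these hold for the Leibniz operators already on the free
  space.\<close>

definition epi :: "('p \<Rightarrow> 'm) \<Rightarrow> ('k, 'g, 'm) rep \<Rightarrow> bool" where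
  "epi \<phi> M \<longleftrightarrow> carr M = \<phi> ` carr P \<and> zero M = \<phi> 0
     \<and> (\<forall>x\<in>carr P. \<forall>y\<in>carr P. add M (\<phi> x) (\<phi> y) = \<phi> (x + y))
     \<and> (\<forall>c. \<forall>x\<in>carr P. smult M c (\<phi> x) = \<phi> (smult P c x))
     \<and> (\<forall>X\<in>g. \<forall>x\<in>carr P. act M X (\<phi> x) = \<phi> (act P X x))"

lemma uminus_in: "x \<in> carr P \<Longrightarrow> - x \<in> carr P"
  using smult_in[of x "- 1"] smult_minus_one by simp

lemma diff_in: "x \<in> carr P \<Longrightarrow> y \<in> carr P \<Longrightarrow> x - y \<in> carr P"
  using add_in[of x "- y"] uminus_in by simp

lemma act_diff: "X \<in> g \<Longrightarrow> x \<in> carr P \<Longrightarrow> y \<in> carr P \<Longrightarrow> act P X (x - y) = act P X x - act P X y"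
  using act_add[of X "x - y" y] diff_in by simp

lemma smult_diff: "x \<in> carr P \<Longrightarrow> y \<in> carr P \<Longrightarrow> smult P c (x - y) = smult P c x - smult P c y"
  using smult_add[of "x - y" y c] diff_in by simp

lemma epi_eqD:
  assumes "epi \<phi> M" and "epi \<psi> M'"
    and ker: "\<And>p. p \<in> carr P \<Longrightarrow> \<phi> p = zero M \<Longrightarrow> \<psi> p = zero M'"
    and xy: "x \<in> carr P" "y \<in> carr P" "\<phi> x = \<phi> y"
  shows "\<psi> x = \<psi> y"
proof -
  have "\<phi> (x + - y) = add M (\<phi> x) (\<phi> (- y))"
    using assms(1) xy uminus_in unfolding epi_def by metis
  also have "\<dots> = \<phi> (y + - y)"
    using assms(1) xy uminus_in unfolding epi_def by metis
  finally have "\<phi> (x - y) = zero M"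
    using assms(1) unfolding epi_def by simp
  then have "\<psi> (x - y) = \<psi> 0"
    using ker diff_in xy assms(2) unfolding epi_def by metis
  have "\<psi> x = \<psi> ((x - y) + y)" by simp
  also have "\<dots> = add M' (\<psi> (x - y)) (\<psi> y)"
    using assms(2) xy diff_in unfolding epi_def by metis
  also have "\<dots> = add M' (\<psi> 0) (\<psi> y)" using \<open>\<psi> (x - y) = \<psi> 0\<close> by simp
  also have "\<dots> = \<psi> (0 + y)"
    using assms(2) xy zero_in unfolding epi_def by metis
  finally show ?thesis by simp
qed

section \<open>Submodules and cosets seen through a presentation\<close>

lemma submod_preimage:
  assumes "epi \<phi> M" and "submod g M N"
  shows "submod g P {p \<in> carr P. \<phi> p \<in> N}"
  using assms unfolding submod_def epi_def
  by (auto simp: add_eq zero_eq zero_in add_in smult_in act_in) metis+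

lemma submod_image:
  assumes "epi \<phi> M" and "submod g P K"
  shows "submod g M (\<phi> ` K)"
  unfolding submod_def
proof (intro conjI allI ballI)
  have K: "K \<subseteq> carr P" "0 \<in> K" "\<And>x y. x \<in> K \<Longrightarrow> y \<in> K \<Longrightarrow> x + y \<in> K"
    "\<And>c x. x \<in> K \<Longrightarrow> smult P c x \<in> K" "\<And>X x. X \<in> g \<Longrightarrow> x \<in> K \<Longrightarrow> act P X x \<in> K"
    using assms(2) unfolding submod_def by (auto simp: add_eq zero_eq)
  show "\<phi> ` K \<subseteq> carr M" "zero M \<in> \<phi> ` K"
    using assms(1) K unfolding epi_def by auto
  show "add M x y \<in> \<phi> ` K" if xy: "x \<in> \<phi> ` K" "y \<in> \<phi> ` K" for x y
  proof -
    obtain a b where ab: "x = \<phi> a" "y = \<phi> b" "a \<in> K" "b \<in> K" using xy by blast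
    then have "add M x y = \<phi> (a + b)" using assms(1) K(1) unfolding epi_def by blast
    then show ?thesis using ab K(3) by blast
  qed
  show "smult M c x \<in> \<phi> ` K" if x: "x \<in> \<phi> ` K" for c x
  proof -
    obtain a where a: "x = \<phi> a" "a \<in> K" using x by blast
    then have "smult M c x = \<phi> (smult P c a)" using assms(1) K(1) unfolding epi_def by blast
    then show ?thesis using a K(4) by blast
  qed
  show "act M X x \<in> \<phi> ` K" if x: "X \<in> g" "x \<in> \<phi> ` K" for X x
  proof -
    obtain a where a: "x = \<phi> a" "a \<in> K" using x by blast
    then have "act M X x = \<phi> (act P X a)" using assms(1) K(1) x(1) unfolding epi_def by blast
    then show ?thesis using a K(5) x(1) by blast
  qed
qed

text \<open>\<open>add M\<close> is known only on values of \<open>\<phi>\<close>, so the coset is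
  described by representatives in \<open>P\<close>, where differences can be formed.\<close>

lemma coset_epi:
  assumes "epi \<phi> M" and "submod g M N" and p: "p \<in> carr P"
  shows "coset M N (\<phi> p) = \<phi> ` {q \<in> carr P. \<phi> (q - p) \<in> N}"
proof
  show "coset M N (\<phi> p) \<subseteq> \<phi> ` {q \<in> carr P. \<phi> (q - p) \<in> N}"
  proof
    fix x assume "x \<in> coset M N (\<phi> p)"
    then obtain n where n: "n \<in> N" "x = add M (\<phi> p) n" unfolding coset_def by blast
    then have "n \<in> \<phi> ` carr P" using assms unfolding submod_def epi_def by blast
    then obtain k where k: "k \<in> carr P" "n = \<phi> k" by blast
    have "x = \<phi> (p + k)" using n k p assms(1) unfolding epi_def by blast
    moreover have "\<phi> (p + k - p) \<in> N" using n k by simp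
    ultimately show "x \<in> \<phi> ` {q \<in> carr P. \<phi> (q - p) \<in> N}" using add_in p k by blast
  qed
  show "\<phi> ` {q \<in> carr P. \<phi> (q - p) \<in> N} \<subseteq> coset M N (\<phi> p)"
  proof clarify
    fix q assume q: "q \<in> carr P" "\<phi> (q - p) \<in> N"
    have "add M (\<phi> p) (\<phi> (q - p)) = \<phi> (p + (q - p))"
      using assms(1) p q diff_in unfolding epi_def by blast
    then show "\<phi> q \<in> coset M N (\<phi> p)" unfolding coset_def using q by force
  qed
qed

lemma coset_epi_eq:
  assumes "epi \<phi> M" and "submod g M N" and p: "p \<in> carr P" "q \<in> carr P" and N: "\<phi> (q - p) \<in> N"
  shows "coset M N (\<phi> q) = coset M N (\<phi> p)"
proof -
  have pre: "submod g P {p \<in> carr P. \<phi> p \<in> N}" by (rule submod_preimage) fact+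
  have *: "\<phi> (a + b) \<in> N" if "a \<in> carr P" "b \<in> carr P" "\<phi> a \<in> N" "\<phi> b \<in> N" for a b
    using pre that unfolding submod_def by (auto simp: add_eq)
  have m: "\<phi> (- a) \<in> N" if "a \<in> carr P" "\<phi> a \<in> N" for a
  proof -
    have "a \<in> {p \<in> carr P. \<phi> p \<in> N}" using that by simp
    then have "smult P (- 1) a \<in> {p \<in> carr P. \<phi> p \<in> N}" using pre unfolding submod_def by blast
    then show ?thesis using smult_minus_one[OF that(1)] by simp
  qed
  have "\<phi> (x - q) \<in> N \<longleftrightarrow> \<phi> (x - p) \<in> N" if x: "x \<in> carr P" for x
    using *[of "x - q" "q - p"] *[of "x - p" "- (q - p)"] m[of "q - p"] x p N diff_in uminus_in by auto
  then show ?thesis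
    unfolding coset_epi[OF assms(1,2) p(1)] coset_epi[OF assms(1,2) p(2)] by (metis (lifting))
qed

lemma epi_quot:
  assumes e: "epi \<phi> M" and N: "submod g M N"
  shows "epi (\<lambda>p. coset M N (\<phi> p)) (quot M N)"
    and "p \<in> carr P \<Longrightarrow> coset M N (\<phi> p) = zero (quot M N) \<longleftrightarrow> \<phi> p \<in> N"
proof -
  note pre = submod_preimage[OF e N]
  have z: "\<phi> 0 \<in> N" using e N unfolding submod_def epi_def by metis
  have N0: "coset M N (\<phi> 0) = N"
    using coset_epi[OF e N zero_in] e N unfolding submod_def epi_def by auto
  \<comment> \<open>The operations of \<open>quot\<close> are unions over all representatives. Such
    a union collapses to one coset once every representative is sent into the same coset; the
    operations below reduce to this.\<close>
  have U1: "(\<Union>a\<in>coset M N (\<phi> p). coset M N (F a)) = coset M N (\<phi> q)"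
    if "p \<in> carr P" "q \<in> carr P"
      and *: "\<And>p'. p' \<in> carr P \<Longrightarrow> \<phi> (p' - p) \<in> N \<Longrightarrow> \<exists>q'\<in>carr P. F (\<phi> p') = \<phi> q' \<and> \<phi> (q' - q) \<in> N"
    for F p q
  proof -
    have "coset M N (F a) = coset M N (\<phi> q)" if aa: "a \<in> coset M N (\<phi> p)" for a
    proof -
      obtain p' where p': "p' \<in> carr P" "a = \<phi> p'" "\<phi> (p' - p) \<in> N"
        using aa coset_epi[OF e N \<open>p \<in> carr P\<close>] by auto
      then obtain q' where "q' \<in> carr P" "F a = \<phi> q'" "\<phi> (q' - q) \<in> N" using * by blast
      then show ?thesis using coset_epi_eq[OF e N \<open>q \<in> carr P\<close>] by metis
    qed
    moreover have "\<phi> p \<in> coset M N (\<phi> p)" using coset_epi[OF e N \<open>p \<in> carr P\<close>] that z by auto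
    ultimately show ?thesis by blast
  qed
  have add_pre: "\<phi> (a + b) \<in> N" if "a \<in> carr P" "b \<in> carr P" "\<phi> a \<in> N" "\<phi> b \<in> N" for a b
    using pre that unfolding submod_def by (auto simp: add_eq)
  show "epi (\<lambda>p. coset M N (\<phi> p)) (quot M N)"
    unfolding epi_def
  proof (intro conjI allI ballI)
    show "carr (quot M N) = (\<lambda>p. coset M N (\<phi> p)) ` carr P"
      using e unfolding quot_def epi_def by auto
    show "zero (quot M N) = coset M N (\<phi> 0)" using N0 unfolding quot_def by simp
    show "smult (quot M N) c (coset M N (\<phi> p)) = coset M N (\<phi> (smult P c p))" if p: "p \<in> carr P" for c p
    proof -
      have "(\<Union>a\<in>coset M N (\<phi> p). coset M N (smult M c a)) = coset M N (\<phi> (smult P c p))"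
      proof (rule U1)
        fix p' assume p': "p' \<in> carr P" "\<phi> (p' - p) \<in> N"
        have "smult M c (\<phi> p') = \<phi> (smult P c p')" using e p' unfolding epi_def by blast
        moreover have "\<phi> (smult P c (p' - p)) \<in> N"
          using pre p' p diff_in unfolding submod_def by blast
        ultimately show "\<exists>q'\<in>carr P. smult M c (\<phi> p') = \<phi> q' \<and> \<phi> (q' - smult P c p) \<in> N"
          using p' p smult_diff smult_in by metis
      qed (use p smult_in in auto)
      then show ?thesis unfolding quot_def by simp
    qed
    show "act (quot M N) X (coset M N (\<phi> p)) = coset M N (\<phi> (act P X p))"
      if p: "X \<in> g" "p \<in> carr P" for X p
    proof -
      have "(\<Union>a\<in>coset M N (\<phi> p). coset M N (act M X a)) = coset M N (\<phi> (act P X p))"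
      proof (rule U1)
        fix p' assume p': "p' \<in> carr P" "\<phi> (p' - p) \<in> N"
        have "act M X (\<phi> p') = \<phi> (act P X p')" using e p p' unfolding epi_def by blast
        moreover have "\<phi> (act P X (p' - p)) \<in> N"
          using pre p' p diff_in unfolding submod_def by blast
        ultimately show "\<exists>q'\<in>carr P. act M X (\<phi> p') = \<phi> q' \<and> \<phi> (q' - act P X p) \<in> N"
          using p' p act_diff act_in by metis
      qed (use p act_in in auto)
      then show ?thesis unfolding quot_def by simp
    qed
    show "add (quot M N) (coset M N (\<phi> p)) (coset M N (\<phi> q)) = coset M N (\<phi> (p + q))"
      if p: "p \<in> carr P" and q: "q \<in> carr P" for p q
    proof -
      have inner: "(\<Union>b\<in>coset M N (\<phi> q). coset M N (add M (\<phi> p') b)) = coset M N (\<phi> (p' + q))"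
        if p': "p' \<in> carr P" for p'
      proof (rule U1)
        fix q' assume q': "q' \<in> carr P" "\<phi> (q' - q) \<in> N"
        have "add M (\<phi> p') (\<phi> q') = \<phi> (p' + q')" using e q' p' unfolding epi_def by blast
        moreover have "p' + q' - (p' + q) = q' - q" by simp
        ultimately show "\<exists>r\<in>carr P. add M (\<phi> p') (\<phi> q') = \<phi> r \<and> \<phi> (r - (p' + q)) \<in> N"
          using q' p' add_in by metis
      qed (use p' q add_in in auto)
      have "(\<Union>b\<in>coset M N (\<phi> q). coset M N (add M a b)) = coset M N (\<phi> (p + q))"
        if a: "a \<in> coset M N (\<phi> p)" for a
      proof -
        obtain p' where p': "p' \<in> carr P" "a = \<phi> p'" "\<phi> (p' - p) \<in> N"
          using a coset_epi[OF e N p] by auto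
        have "p' + q - (p + q) = p' - p" by simp
        then show ?thesis
          using inner[OF p'(1)] coset_epi_eq[OF e N, of "p + q" "p' + q"] p' p q add_in by simp
      qed
      moreover have "\<phi> p \<in> coset M N (\<phi> p)" using coset_epi[OF e N p] p z by auto
      ultimately have "(\<Union>a\<in>coset M N (\<phi> p). \<Union>b\<in>coset M N (\<phi> q). coset M N (add M a b))
          = coset M N (\<phi> (p + q))" by blast
      then show ?thesis unfolding quot_def by simp
    qed
  qed
  show "coset M N (\<phi> p) = zero (quot M N) \<longleftrightarrow> \<phi> p \<in> N" if p: "p \<in> carr P"
  proof
    assume "coset M N (\<phi> p) = zero (quot M N)"
    then have "coset M N (\<phi> p) = N" by (simp add: quot_def)
    moreover have "\<phi> p \<in> coset M N (\<phi> p)" using coset_epi[OF e N p] p z by auto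
    ultimately show "\<phi> p \<in> N" by simp
  next
    assume "\<phi> p \<in> N"
    then have "coset M N (\<phi> p) = coset M N (\<phi> 0)"
      by (intro coset_epi_eq[OF e N zero_in p]) simp
    then show "coset M N (\<phi> p) = zero (quot M N)" using N0 by (simp add: quot_def)
  qed
qed

section \<open>Socles depend only on the kernel of a presentation\<close>

lemma transfer_back:
  assumes e: "epi \<phi> M" and e': "epi \<psi> M'"
    and ker: "\<And>p. p \<in> carr P \<Longrightarrow> \<psi> p = zero M' \<Longrightarrow> \<phi> p = zero M"
    and S: "S \<subseteq> carr M"
  shows "\<phi> ` {p \<in> carr P. \<psi> p \<in> \<psi> ` {p \<in> carr P. \<phi> p \<in> S}} = S"
proof
  show "\<phi> ` {p \<in> carr P. \<psi> p \<in> \<psi> ` {p \<in> carr P. \<phi> p \<in> S}} \<subseteq> S"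
  proof clarify
    fix p q assume *: "p \<in> carr P" "q \<in> carr P" "\<psi> p = \<psi> q" "\<phi> q \<in> S"
    have "\<phi> p = \<phi> q" by (rule epi_eqD[OF e' e ker *(1-3)])
    then show "\<phi> p \<in> S" using * by simp
  qed
  show "S \<subseteq> \<phi> ` {p \<in> carr P. \<psi> p \<in> \<psi> ` {p \<in> carr P. \<phi> p \<in> S}}"
  proof
    fix s assume s: "s \<in> S"
    then obtain p where "p \<in> carr P" "s = \<phi> p" using S e unfolding epi_def by blast
    then show "s \<in> \<phi> ` {p \<in> carr P. \<psi> p \<in> \<psi> ` {p \<in> carr P. \<phi> p \<in> S}}" using s by blast
  qed
qed

text \<open>With equal kernels, taking preimages in \<open>P\<close> and pushing them forward is a
  bijection between the submodules of the two modules, inverse to the same map in the other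
  direction. A submodule strictly inside the image would come back to one strictly inside
  \<open>S\<close>.\<close>

lemma simple_transfer:
  assumes e: "epi \<phi> M" and e': "epi \<psi> M'"
    and ker: "\<And>p. p \<in> carr P \<Longrightarrow> \<phi> p = zero M \<longleftrightarrow> \<psi> p = zero M'"
    and S: "simple_submod g M S"
  shows "simple_submod g M' (\<psi> ` {p \<in> carr P. \<phi> p \<in> S})" (is "simple_submod g M' ?T")
proof -
  have Ss: "submod g M S" and Sc: "S \<subseteq> carr M" using S unfolding simple_submod_def submod_def by auto
  have bk: "\<phi> ` {p \<in> carr P. \<psi> p \<in> ?T} = S"
    by (rule transfer_back[OF e e' _ Sc]) (simp add: ker)
  have zz: "\<phi> ` {p \<in> carr P. \<psi> p \<in> {zero M'}} = {zero M}"
    using ker e e' zero_in unfolding epi_def by (auto simp: image_iff intro!: bexI[of _ 0])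
  have zz': "\<psi> ` {p \<in> carr P. \<phi> p \<in> {zero M}} = {zero M'}"
    using ker e e' zero_in unfolding epi_def by (auto simp: image_iff intro!: bexI[of _ 0])
  show ?thesis
    unfolding simple_submod_def
  proof (intro conjI allI impI)
    show "submod g M' ?T" by (rule submod_image[OF e' submod_preimage[OF e Ss]])
    show "?T \<noteq> {zero M'}"
    proof
      assume "?T = {zero M'}"
      then have "S = {zero M}" using bk zz by simp
      then show False using S unfolding simple_submod_def by simp
    qed
    fix N assume N: "submod g M' N \<and> N \<subseteq> ?T"
    let ?N = "\<phi> ` {p \<in> carr P. \<psi> p \<in> N}"
    have Nc: "N \<subseteq> carr M'" using N unfolding submod_def by auto
    have "submod g M ?N" using submod_image[OF e submod_preimage[OF e']] N by blast
    moreover have "?N \<subseteq> S" using N bk by blast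
    ultimately have "?N = {zero M} \<or> ?N = S" using S unfolding simple_submod_def by blast
    moreover have "\<psi> ` {p \<in> carr P. \<phi> p \<in> ?N} = N"
      by (rule transfer_back[OF e' e _ Nc]) (simp add: ker)
    ultimately show "N = {zero M'} \<or> N = ?T" using zz' by auto
  qed
qed

lemma soc_transfer:
  assumes e: "epi \<phi> M" and e': "epi \<psi> M'"
    and ker: "\<And>p. p \<in> carr P \<Longrightarrow> \<phi> p = zero M \<longleftrightarrow> \<psi> p = zero M'"
    and p: "p \<in> carr P" "\<phi> p \<in> soc g M"
  shows "\<psi> p \<in> soc g M'"
proof -
  have "\<exists>q\<in>carr P. m = \<phi> q \<and> \<psi> q \<in> soc g M'" if "m \<in> soc g M" for m
    using that unfolding soc_def
  proof induction
    case 1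
    have "\<psi> 0 \<in> sum_of M' {S. simple_submod g M' S}"
      using e' sum_of.intros(1)[of M'] unfolding epi_def by metis
    then show ?case using e zero_in unfolding epi_def by blast
  next
    case (2 x S y)
    then obtain q where q: "q \<in> carr P" "x = \<phi> q" "\<psi> q \<in> sum_of M' {S. simple_submod g M' S}" by blast
    have S: "simple_submod g M S" using 2 by simp
    then have "S \<subseteq> carr M" unfolding simple_submod_def submod_def by simp
    also have "carr M = \<phi> ` carr P" using e unfolding epi_def by simp
    finally obtain s where s: "s \<in> carr P" "y = \<phi> s" using 2 by blast
    have "\<psi> s \<in> \<psi> ` {p \<in> carr P. \<phi> p \<in> S}" using s 2 by blast
    then have "add M' (\<psi> q) (\<psi> s) \<in> sum_of M' {S. simple_submod g M' S}"
      using sum_of.intros(2)[OF q(3)] simple_transfer[OF e e' ker S] by blast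
    moreover have "add M x y = \<phi> (q + s)" using e q s unfolding epi_def by blast
    moreover have "add M' (\<psi> q) (\<psi> s) = \<psi> (q + s)" using e' q s unfolding epi_def by blast
    ultimately show ?case using add_in q s by metis
  qed
  then obtain q where q: "q \<in> carr P" "\<phi> p = \<phi> q" "\<psi> q \<in> soc g M'" using p by blast
  then have "\<psi> p = \<psi> q" using epi_eqD[OF e e' _ p(1) q(1)] ker by blast
  then show ?thesis using q by simp
qed

lemma submod_soc: "submod g P (soc g P)"
proof -
  have sub: "submod g P S" if "simple_submod g P S" for S using that unfolding simple_submod_def by simp
  have c: "x \<in> carr P" if "x \<in> soc g P" for x
    using that unfolding soc_def
  proof induction
    case 1 then show ?case by (simp add: zero_eq zero_in)
  next
    case (2 x S y)
    then have "y \<in> carr P" using sub unfolding submod_def by blast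
    then show ?case using 2 by (simp add: add_eq add_in)
  qed
  have a: "x + y \<in> soc g P" if "y \<in> soc g P" "x \<in> soc g P" for x y
    using that(1) unfolding soc_def
  proof induction
    case 1 then show ?case using that(2) by (simp add: zero_eq soc_def)
  next
    case (2 y S z)
    then have "add P (x + y) z \<in> sum_of P {S. simple_submod g P S}"
      by (intro sum_of.intros(2)) auto
    then show ?case by (simp add: add_eq add.assoc)
  qed
  have s: "smult P r x \<in> soc g P" if "x \<in> soc g P" for r x
    using that unfolding soc_def
  proof induction
    case 1
    have "smult P r 0 = 0" using smult_diff[of 0 0 r] zero_in by simp
    then show ?case using sum_of.intros(1)[of P] by (simp add: zero_eq)
  next
    case (2 x S y)
    have "y \<in> carr P" "smult P r y \<in> S" using sub[of S] 2 unfolding submod_def by auto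
    moreover have "x \<in> carr P" using c 2 unfolding soc_def by blast
    moreover have "add P (smult P r x) (smult P r y) \<in> sum_of P {S. simple_submod g P S}"
      by (rule sum_of.intros(2)) (use 2 calculation in auto)
    ultimately show ?case by (simp add: add_eq smult_add)
  qed
  have t: "act P X x \<in> soc g P" if "x \<in> soc g P" "X \<in> g" for X x
    using that(1) unfolding soc_def
  proof induction
    case 1
    have "act P X 0 = 0" using act_diff[of X 0 0] zero_in that by simp
    then show ?case using sum_of.intros(1)[of P] by (simp add: zero_eq)
  next
    case (2 x S y)
    have "y \<in> carr P" "act P X y \<in> S" using sub[of S] 2 that unfolding submod_def by auto
    moreover have "x \<in> carr P" using c 2 unfolding soc_def by blast
    moreover have "add P (act P X x) (act P X y) \<in> sum_of P {S. simple_submod g P S}"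
      by (rule sum_of.intros(2)) (use 2 calculation in auto)
    ultimately show ?case using that by (simp add: add_eq act_add)
  qed
  show ?thesis
    unfolding submod_def using c a s t sum_of.intros(1)[of P]
    by (auto simp: add_eq soc_def)
qed

lemma simple_subset_soc:
  assumes "simple_submod g P S" shows "S \<subseteq> soc g P"
proof
  fix x assume "x \<in> S"
  then have "add P (zero P) x \<in> soc g P" unfolding soc_def
    by (intro sum_of.intros) (use assms in auto)
  then show "x \<in> soc g P" by (simp add: add_eq zero_eq)
qed

lemma soc_subset:
  assumes "submod g P T" and "\<And>S. simple_submod g P S \<Longrightarrow> S \<subseteq> T"
  shows "soc g P \<subseteq> T"
proof
  fix x assume "x \<in> soc g P"
  then show "x \<in> T" unfolding soc_def
  proof induction
    case 1 then show ?case using assms(1) unfolding submod_def by simp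
  next
    case (2 x S y)
    then have "y \<in> T" using assms(2) by blast
    then show ?case using 2 assms(1) unfolding submod_def by simp
  qed
qed

end

section \<open>Countable quadratic spaces\<close>

context countable_quadratic_space
begin

lemma Q_add_left: "Q (x + y) w = Q x w + Q y w"
  and Q_scale_left: "Q (scale c x) w = c * Q x w"
  using bilinear_left[of w] by (simp_all add: Vector_Spaces.linear_iff)

lemma Q_add_right: "Q w (x + y) = Q w x + Q w y"
  and Q_scale_right: "Q w (scale c x) = c * Q w x"
  using bilinear_right[of w] by (simp_all add: Vector_Spaces.linear_iff)

lemma Q_zero_left [simp]: "Q 0 w = 0" and Q_zero_right [simp]: "Q w 0 = 0"
  using Q_scale_left[of 0 0 w] Q_scale_right[of w 0 0] by simp_all

lemma Q_diff_left: "Q (x - y) w = Q x w - Q y w" and Q_diff_right: "Q w (x - y) = Q w x - Q w y"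
  using Q_add_left[of "x - y" y w] Q_add_right[of w "x - y" y] by simp_all

lemma Q_sum_left: "Q (sum f I) w = (\<Sum>i\<in>I. Q (f i) w)"
  by (induction I rule: infinite_finite_induct) (auto simp: Q_add_left)

lemma Q_sum_right: "Q w (sum f I) = (\<Sum>i\<in>I. Q w (f i))"
  by (induction I rule: infinite_finite_induct) (auto simp: Q_add_right)

lemmas Q_simps = Q_add_left Q_scale_left Q_add_right Q_scale_right Q_diff_left Q_diff_right

text \<open>This replaces the identification of a finite-dimensional space with its dual, as the
  form may degenerate on the span of \<open>G\<close>. Each new generator \<open>g\<close> is
  eliminated from \<open>b\<close> and from \<open>w\<close> by means of a vector \<open>v\<close>
  that is dual to it and orthogonal to the earlier ones.\<close>

lemma separation:
  assumes "finite G" and "b \<notin> span G"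
  shows "\<exists>w. Q b w = 1 \<and> (\<forall>g\<in>G. Q g w = 0)"
  using assms
proof (induction G arbitrary: b)
  case empty
  then have "b \<noteq> 0" by auto
  then obtain w where "Q b w \<noteq> 0" using nondegenerate by blast
  then have "Q b (scale (1 / Q b w) w) = 1" by (simp add: Q_scale_right)
  then show ?case by blast
next
  case (insert g G)
  show ?case
  proof (cases "g \<in> span G")
    case True
    then have "b \<notin> span G" using insert.prems span_redundant by metis
    then obtain w where w: "Q b w = 1" "\<forall>g\<in>G. Q g w = 0" using insert.IH by blast
    have "span G \<subseteq> {x. Q x w = 0}"
      by (rule span_minimal) (use w in \<open>auto simp: subspace_def Q_simps\<close>)
    then show ?thesis using w True by blast
  next
    case False
    then obtain v where v: "Q g v = 1" "\<forall>g\<in>G. Q g v = 0" using insert.IH by blast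
    have "b - scale (Q b v) g \<notin> span G"
      using insert.prems span_breakdown_eq by blast
    then obtain w where w: "Q (b - scale (Q b v) g) w = 1" "\<forall>g\<in>G. Q g w = 0" using insert.IH by blast
    have "Q b (w - scale (Q g w) v) = 1" using w by (simp add: Q_simps algebra_simps)
    moreover have "\<forall>x\<in>insert g G. Q x (w - scale (Q g w) v) = 0" using w v by (simp add: Q_simps)
    ultimately show ?thesis by blast
  qed
qed

text \<open>The dual vectors may lie outside the span of \<open>B\<close>, on which the form can be
  degenerate.\<close>

definition dual_on :: "'v set \<Rightarrow> ('v \<Rightarrow> 'v) \<Rightarrow> bool" where
  "dual_on B d \<longleftrightarrow> finite B \<and> (\<forall>x\<in>B. \<forall>y\<in>B. Q x (d y) = (if x = y then 1 else 0))"

lemma dual_on_exists: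
  assumes "finite B" and "independent B"
  shows "\<exists>d. dual_on B d"
proof -
  have "\<exists>w. Q b w = 1 \<and> (\<forall>g\<in>B - {b}. Q g w = 0)" if "b \<in> B" for b
    using separation[of "B - {b}" b] assms that unfolding dependent_def by auto
  then obtain d where "\<forall>b\<in>B. Q b (d b) = 1 \<and> (\<forall>g\<in>B - {b}. Q g (d b) = 0)" by metis
  then have "dual_on B d" unfolding dual_on_def using assms by auto
  then show ?thesis by blast
qed

lemma dual_on_spanning:
  assumes "finite F" shows "\<exists>B d. B \<subseteq> F \<and> F \<subseteq> span B \<and> dual_on B d"
proof -
  obtain B where B: "B \<subseteq> F" "independent B" "F \<subseteq> span B"
    using maximal_independent_subset by blast
  then show ?thesis using dual_on_exists[of B] assms finite_subset by blast
qed

lemma dual_expand: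
  assumes "dual_on B d" and "v \<in> span B"
  shows "v = (\<Sum>x\<in>B. scale (Q v (d x)) x)"
proof -
  have fB: "finite B" using assms(1) by (simp add: dual_on_def)
  have "span B \<subseteq> {v. v = (\<Sum>x\<in>B. scale (Q v (d x)) x)}"
  proof (rule span_minimal)
    show "B \<subseteq> {v. v = (\<Sum>x\<in>B. scale (Q v (d x)) x)}"
    proof clarify
      fix b assume b: "b \<in> B"
      have "(\<Sum>x\<in>B. scale (Q b (d x)) x) = (\<Sum>x\<in>B. if b = x then x else 0)"
        by (rule sum.cong) (use assms b in \<open>auto simp: dual_on_def\<close>)
      then show "b = (\<Sum>x\<in>B. scale (Q b (d x)) x)" using b fB by (simp add: sum.delta)
    qed
    show "subspace {v. v = (\<Sum>x\<in>B. scale (Q v (d x)) x)}"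
      unfolding subspace_def
      by (auto simp: Q_simps scale_left_distrib sum.distrib scale_sum_right[symmetric]
          simp flip: scale_scale)
  qed
  then show ?thesis using assms by blast
qed

lemma not_spanned_finite:
  assumes "finite G" shows "\<exists>b. b \<notin> span G"
proof (rule ccontr)
  assume "\<not> ?thesis"
  then have *: "span G = UNIV" by blast
  obtain B where B: "independent B" "infinite B" using countable_basis by blast
  have "B \<subseteq> span G" using * by simp
  then have "finite B" using independent_span_bound[OF assms B(1)] by simp
  then show False using B by simp
qed

text \<open>If all vectors orthogonal to \<open>F\<close> were isotropic, polarisation would make
  the form vanish on the orthogonal space of \<open>F\<close>. A nonzero vector of this space that
  is also orthogonal to the dual vectors of a basis of the span of \<open>F\<close> would then be
  orthogonal to everything, against nondegeneracy.\<close>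

lemma unit_vector:
  assumes "finite F" shows "\<exists>v. Q v v = 1 \<and> (\<forall>y\<in>F. Q v y = 0)"
proof -
  have "\<exists>v. Q v v \<noteq> 0 \<and> (\<forall>y\<in>F. Q v y = 0)"
  proof (rule ccontr)
    assume "\<not> ?thesis"
    then have iso: "Q v v = 0" if "\<forall>y\<in>F. Q v y = 0" for v using that by blast
    have iso2: "Q v w = 0" if "\<forall>y\<in>F. Q v y = 0" "\<forall>y\<in>F. Q w y = 0" for v w
    proof -
      have "Q (v + w) (v + w) = 0" by (rule iso) (use that in \<open>simp add: Q_simps\<close>)
      then have "Q v w + Q w v = 0" using iso[of v] iso[of w] that by (simp add: Q_simps add.commute)
      then have "2 * Q v w = 0" using symmetric[of w v] by simp
      then show ?thesis by simp
    qed
    obtain B d where B: "B \<subseteq> F" "F \<subseteq> span B" "dual_on B d" using dual_on_spanning[OF assms] by blast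
    have fB: "finite B" using B by (simp add: dual_on_def)
    obtain b where b: "b \<notin> span (F \<union> d ` B)" using not_spanned_finite[of "F \<union> d ` B"] assms fB by auto
    then obtain w where w: "Q b w = 1" "\<forall>g\<in>F \<union> d ` B. Q g w = 0"
      using separation[OF _ b] assms fB by blast
    have "Q w z = 0" for z
    proof -
      \<comment> \<open>Subtracting dual vectors moves \<open>z\<close> into the orthogonal space of
        \<open>F\<close> without changing its product with \<open>w\<close>.\<close>
      define z' where "z' = z - (\<Sum>x\<in>B. scale (Q z x) (d x))"
      have zB: "Q z' y = 0" if "y \<in> B" for y
      proof -
        have "(\<Sum>x\<in>B. Q z x * Q (d x) y) = (\<Sum>x\<in>B. if y = x then Q z x else 0)"
          by (rule sum.cong) (use B(3) that symmetric in \<open>auto simp: dual_on_def\<close>)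
        also have "\<dots> = Q z y" using fB that by (simp add: sum.delta)
        finally show ?thesis unfolding z'_def by (simp add: Q_simps Q_sum_left)
      qed
      have "span B \<subseteq> {y. Q z' y = 0}"
        by (rule span_minimal) (use zB in \<open>auto simp: subspace_def Q_simps\<close>)
      then have "\<forall>y\<in>F. Q z' y = 0" using B by blast
      then have "Q w z' = 0" using iso2[of w z'] w symmetric by auto
      moreover have "Q w (\<Sum>x\<in>B. scale (Q z x) (d x)) = 0"
        unfolding Q_sum_right Q_scale_right using w symmetric[of w] by (simp add: image_Un)
      ultimately show ?thesis unfolding z'_def by (simp add: Q_diff_right)
    qed
    then show False using nondegenerate[of w] w by auto
  qed
  then obtain v where v: "Q v v \<noteq> 0" "\<forall>y\<in>F. Q v y = 0" by blast
  obtain c where c: "c ^ 2 = Q v v" using nth_root_exists[of 2 "Q v v"] by auto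
  have "Q (scale (1 / c) v) (scale (1 / c) v) = 1"
    using c v by (auto simp: Q_simps power2_eq_square field_simps)
  moreover have "\<forall>y\<in>F. Q (scale (1 / c) v) y = 0" using v by (simp add: Q_simps)
  ultimately show ?thesis by blast
qed

definition hyperbolic :: "nat \<Rightarrow> (nat \<Rightarrow> 'v) \<Rightarrow> (nat \<Rightarrow> 'v) \<Rightarrow> bool" where
  "hyperbolic n u v \<longleftrightarrow> (\<forall>i<n. \<forall>j<n. Q (u i) (u j) = 0 \<and> Q (v i) (v j) = 0
     \<and> Q (u i) (v j) = (if i = j then 1 else 0))"

lemma hyperbolic_pair:
  assumes "finite F"
  shows "\<exists>x y. Q x x = 0 \<and> Q y y = 0 \<and> Q x y = 1 \<and> (\<forall>z\<in>F. Q x z = 0 \<and> Q y z = 0)"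
proof -
  obtain a where a: "Q a a = 1" "\<forall>y\<in>F. Q a y = 0" using unit_vector[OF assms] by blast
  obtain b where b: "Q b b = 1" "\<forall>y\<in>insert a F. Q b y = 0" using unit_vector[of "insert a F"] assms by blast
  have ab: "Q b a = 0" "Q a b = 0" using b symmetric[of a b] by auto
  \<comment> \<open>With \<open>t\<close> a square root of -1, \<open>Q x x\<close> becomes 1 + t^2
    = 0, and the factor 1/2 in \<open>y\<close> normalises \<open>Q x y\<close> to (1 - t^2)/2 =
    1.\<close>
  obtain t where t: "t ^ 2 = (- 1 :: 'k)" using nth_root_exists[of 2 "- 1 :: 'k"] by auto
  then have tt: "t * t = - 1" by (simp add: power2_eq_square)
  define x where "x = a + scale t b"
  define y where "y = scale (1 / 2) (a - scale t b)"
  have "Q x x = 0" "Q y y = 0" "Q x y = 1"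
    unfolding x_def y_def using a(1) b(1) ab tt by (simp_all add: Q_simps)
  moreover have "\<forall>z\<in>F. Q x z = 0 \<and> Q y z = 0"
    unfolding x_def y_def using a b by (simp add: Q_simps)
  ultimately show ?thesis by blast
qed

lemma hyperbolic_exists:
  assumes "finite F"
  shows "\<exists>u v. hyperbolic n u v \<and> (\<forall>i<n. \<forall>z\<in>F. Q (u i) z = 0 \<and> Q (v i) z = 0)"
proof (induction n)
  case 0
  then show ?case by (simp add: hyperbolic_def)
next
  case (Suc n)
  then obtain u v where uv: "hyperbolic n u v" "\<forall>i<n. \<forall>z\<in>F. Q (u i) z = 0 \<and> Q (v i) z = 0" by blast
  have "finite (F \<union> u ` {..<n} \<union> v ` {..<n})" using assms by simp
  then obtain x y where xy: "Q x x = 0" "Q y y = 0" "Q x y = 1"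
    "\<forall>z\<in>F \<union> u ` {..<n} \<union> v ` {..<n}. Q x z = 0 \<and> Q y z = 0"
    using hyperbolic_pair[of "F \<union> u ` {..<n} \<union> v ` {..<n}"] by blast
  have xy': "Q (u i) x = 0" "Q (u i) y = 0" "Q (v i) x = 0" "Q (v i) y = 0"
    "Q x (u i) = 0" "Q y (u i) = 0" "Q x (v i) = 0" "Q y (v i) = 0" if "i < n" for i
    using xy(4) that symmetric[of "u i"] symmetric[of "v i"] by auto
  have "hyperbolic (Suc n) (u(n := x)) (v(n := y))"
    unfolding hyperbolic_def
    using uv(1) xy(1-3) xy' by (auto simp: hyperbolic_def less_Suc_eq)
  moreover have "\<forall>i<Suc n. \<forall>z\<in>F. Q ((u(n := x)) i) z = 0 \<and> Q ((v(n := y)) i) z = 0"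
    using uv(2) xy(4) by (auto simp: less_Suc_eq)
  ultimately show ?case by blast
qed

end

section \<open>Maschke's theorem\<close>

text \<open>The group is given as the set of its operators, so that only the number of operators has
  to be nonzero in the field and an unfaithful action calls for no separate treatment.\<close>

locale finite_linear_group = vector_space scale
  for scale :: "'a::field \<Rightarrow> 'b::ab_group_add \<Rightarrow> 'b" +
  fixes R :: "('b \<Rightarrow> 'b) set"
  assumes R: "finite R" "R \<noteq> {}" "\<And>\<rho> \<tau>. \<rho> \<in> R \<Longrightarrow> \<tau> \<in> R \<Longrightarrow> \<rho> \<circ> \<tau> \<in> R"
      "\<And>\<rho>. \<rho> \<in> R \<Longrightarrow> Vector_Spaces.linear scale scale \<rho>"
      "\<And>\<rho>. \<rho> \<in> R \<Longrightarrow> bij \<rho>" "\<And>\<rho>. \<rho> \<in> R \<Longrightarrow> inv \<rho> \<in> R"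
    and char: "of_nat (card R) \<noteq> (0 :: 'a)"
begin

definition stable :: "'b set \<Rightarrow> bool" where
  "stable U \<longleftrightarrow> subspace U \<and> (\<forall>\<rho>\<in>R. \<rho> ` U \<subseteq> U)"

text \<open>\<open>dim\<close> is a cardinality and drops to 0 for infinite bases. The ambient space
  consists of functions and may be infinite-dimensional, hence the bound by a finite
  \<open>F\<close>.\<close>

lemma psubset_dim_less:
  assumes "subspace U" and "U \<subset> W" and "W \<subseteq> span F" and "finite F"
  shows "dim U < dim W"
proof -
  obtain B where B: "B \<subseteq> U" "independent B" "U \<subseteq> span B" "card B = dim U"
    using basis_exists by blast
  have sB: "span B = U" using B assms(1) by (simp add: span_minimal subset_antisym)
  obtain C where C: "B \<subseteq> C" "C \<subseteq> W" "independent C" "W \<subseteq> span C"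
    using maximal_independent_subset_extend[of B W] B assms by blast
  have "finite C" using independent_span_bound[OF assms(4) C(3)] C(2) assms(3) by blast
  moreover have "B \<noteq> C" using sB C assms(2) by blast
  moreover have "card C = dim W"
    using basis_card_eq_dim[OF C(2,4,3)] .
  ultimately show ?thesis using B(4) C(1) psubset_card_mono by (metis psubsetI)
qed

lemma irreducible_exists:
  assumes W: "stable W" "W \<noteq> {0}" "W \<subseteq> span F" "finite F"
  shows "\<exists>J. stable J \<and> J \<subseteq> W \<and> J \<noteq> {0} \<and> (\<forall>J'. stable J' \<and> J' \<subseteq> J \<longrightarrow> J' = {0} \<or> J' = J)"
proof -
  define m where "m = (LEAST m. \<exists>J. stable J \<and> J \<subseteq> W \<and> J \<noteq> {0} \<and> dim J = m)"
  have "\<exists>J. stable J \<and> J \<subseteq> W \<and> J \<noteq> {0} \<and> dim J = m"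
    unfolding m_def by (rule LeastI_ex) (use W in blast)
  then obtain J where J: "stable J" "J \<subseteq> W" "J \<noteq> {0}" "dim J = m" by blast
  have "J' = {0} \<or> J' = J" if J': "stable J'" "J' \<subseteq> J" for J'
  proof (rule ccontr)
    assume *: "\<not> (J' = {0} \<or> J' = J)"
    then have "dim J' < m"
      using psubset_dim_less[of J' J F] J' J W(3,4) by (auto simp: stable_def)
    moreover have "m \<le> dim J'"
      unfolding m_def by (rule Least_le) (use * J' J in blast)
    ultimately show False by simp
  qed
  then show ?thesis using J by blast
qed

text \<open>The average \<open>q\<close> over the group of a linear projection onto \<open>U\<close>
  is an equivariant projection onto \<open>U\<close>. Its kernel inside \<open>W\<close> is a stable
  complement, nonzero because it contains \<open>x - q x\<close> for \<open>x\<close> in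
  \<open>W\<close> outside \<open>U\<close>, and a nonzero stable subspace of least dimension in it
  is irreducible.\<close>

lemma maschke:
  assumes UW: "stable U" "stable W" "U \<subset> W" "W \<subseteq> span F" "finite F"
  shows "\<exists>J. stable J \<and> J \<subseteq> W \<and> J \<inter> U = {0} \<and> J \<noteq> {0}
     \<and> (\<forall>J'. stable J' \<and> J' \<subseteq> J \<longrightarrow> J' = {0} \<or> J' = J)"
proof -
  interpret vector_space_pair scale scale ..
  have sU: "subspace U" and sW: "subspace W" using UW by (auto simp: stable_def)
  have "\<exists>p. range p \<subseteq> U \<and> Vector_Spaces.linear scale scale p \<and> (\<forall>v\<in>U. p v = v)"
    using linear_exists_left_inverse_on[of "\<lambda>x. x" U] sU linear_id by (auto simp: id_def inj_on_def)
  then obtain p where p: "\<And>x. p x \<in> U" "Vector_Spaces.linear scale scale p" "\<And>v. v \<in> U \<Longrightarrow> p v = v"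
    by blast
  define q where "q x = scale (1 / of_nat (card R)) (\<Sum>\<rho>\<in>R. inv \<rho> (p (\<rho> x)))" for x
  have lin: "\<rho> (x + y) = \<rho> x + \<rho> y" "\<rho> (scale c x) = scale c (\<rho> x)" if "\<rho> \<in> R \<or> \<rho> = p" for \<rho> x y c
    using R(4)[of \<rho>] p(2) that by (auto simp: Vector_Spaces.linear_iff)
  have lin0: "\<rho> 0 = 0" if "\<rho> \<in> R" for \<rho> using lin(2)[of \<rho> 0 0] that by simp
  have lin_sum: "\<rho> (sum f I) = (\<Sum>i\<in>I. \<rho> (f i))" if "\<rho> \<in> R" for \<rho> and f :: "('b \<Rightarrow> 'b) \<Rightarrow> 'b" and I
    using that by (induction I rule: infinite_finite_induct) (auto simp: lin lin0)
  have q_add: "q (x + y) = q x + q y" for x y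
    unfolding q_def by (simp add: lin R(6) sum.distrib scale_right_distrib)
  have q_scale: "q (scale c x) = scale c (q x)" for c x
    unfolding q_def by (simp add: lin R(6) scale_sum_right mult.commute)
  have q_U: "q x \<in> U" for x
    unfolding q_def
  proof (intro subspace_scale[OF sU] subspace_sum[OF sU])
    fix \<rho> assume "\<rho> \<in> R"
    then show "inv \<rho> (p (\<rho> x)) \<in> U" using p(1) R(6) UW(1) unfolding stable_def by blast
  qed
  have q_id: "q x = x" if "x \<in> U" for x
  proof -
    have "inv \<rho> (p (\<rho> x)) = x" if "\<rho> \<in> R" for \<rho>
    proof -
      have "\<rho> x \<in> U" using that UW(1) \<open>x \<in> U\<close> unfolding stable_def by blast
      then show ?thesis using p(3) R(5)[OF that] by (simp add: bij_is_inj)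
    qed
    then have "(\<Sum>\<rho>\<in>R. inv \<rho> (p (\<rho> x))) = (\<Sum>\<rho>\<in>R. x)" by (intro sum.cong) auto
    then show ?thesis unfolding q_def using char by (simp add: sum_constant_scale)
  qed
  have q_eq: "q (\<tau> x) = \<tau> (q x)" if \<tau>: "\<tau> \<in> R" for \<tau> x
  proof -
    \<comment> \<open>Right translation by \<open>\<tau>\<close> permutes the finite set
      \<open>R\<close>, which allows the average to be reindexed.\<close>
    have inj: "inj_on (\<lambda>\<rho>. \<rho> \<circ> \<tau>) R"
      using R(5)[OF \<tau>] by (auto simp: inj_on_def fun_eq_iff) (metis bij_pointE)
    have "(\<lambda>\<rho>. \<rho> \<circ> \<tau>) ` R \<subseteq> R" using R(3) \<tau> by blast
    then have im: "(\<lambda>\<rho>. \<rho> \<circ> \<tau>) ` R = R" using inj R(1) by (simp add: endo_inj_surj)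
    have "(\<Sum>\<rho>\<in>R. inv \<rho> (p (\<rho> x))) = (\<Sum>\<rho>\<in>(\<lambda>\<rho>. \<rho> \<circ> \<tau>) ` R. inv \<rho> (p (\<rho> x)))" using im by simp
    also have "\<dots> = (\<Sum>\<rho>\<in>R. inv (\<rho> \<circ> \<tau>) (p (\<rho> (\<tau> x))))"
      using inj by (simp add: sum.reindex)
    also have "\<dots> = (\<Sum>\<rho>\<in>R. inv \<tau> (inv \<rho> (p (\<rho> (\<tau> x)))))"
      by (intro sum.cong) (use R(5) \<tau> in \<open>auto simp: o_inv_distrib\<close>)
    also have "\<dots> = inv \<tau> (\<Sum>\<rho>\<in>R. inv \<rho> (p (\<rho> (\<tau> x))))"
      by (rule lin_sum[OF R(6)[OF \<tau>], symmetric])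
    finally have "\<tau> (\<Sum>\<rho>\<in>R. inv \<rho> (p (\<rho> x))) = (\<Sum>\<rho>\<in>R. inv \<rho> (p (\<rho> (\<tau> x))))"
      using R(5)[OF \<tau>] by (simp add: bij_is_surj surj_f_inv_f)
    then show ?thesis unfolding q_def using \<tau> by (simp add: lin)
  qed
  define C where "C = {x \<in> W. q x = 0}"
  have q0: "q 0 = 0" using q_scale[of 0 0] by simp
  have "stable C"
    unfolding stable_def
  proof
    show "subspace C" unfolding C_def using sW by (auto simp: subspace_def q_add q_scale q0)
    show "\<forall>\<rho>\<in>R. \<rho> ` C \<subseteq> C"
      unfolding C_def using UW(2) by (auto simp: stable_def q_eq lin0)
  qed
  moreover have "C \<noteq> {0}"
  proof -
    obtain x where x: "x \<in> W" "x \<notin> U" using UW(3) by blast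
    have "q (x - q x) + q (q x) = q x" using q_add[of "x - q x" "q x"] by simp
    then have "q (x - q x) = 0" using q_id[OF q_U] by simp
    moreover have "x - q x \<in> W" using x q_U UW(3) sW by (meson psubsetD subspace_diff)
    moreover have "x - q x \<noteq> 0" using q_U[of x] x by auto
    ultimately show ?thesis unfolding C_def by blast
  qed
  moreover have "C \<subseteq> span F" unfolding C_def using UW(4) by blast
  ultimately obtain J where J: "stable J" "J \<subseteq> C" "J \<noteq> {0}"
      "\<forall>J'. stable J' \<and> J' \<subseteq> J \<longrightarrow> J' = {0} \<or> J' = J"
    using irreducible_exists[of C F] UW(5) by blast
  have "J \<inter> U = {0}"
  proof -
    have "x = 0" if "x \<in> J" "x \<in> U" for x using that J(2) q_id[of x] unfolding C_def by auto
    moreover have "0 \<in> J" "0 \<in> U" using J(1) sU unfolding stable_def subspace_def by auto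
    ultimately show ?thesis by blast
  qed
  moreover have "J \<subseteq> W" using J(2) unfolding C_def by blast
  ultimately show ?thesis using J by blast
qed

end

section \<open>Families of multilinear functions\<close>

text \<open>Entry \<open>a\<close> of an arrangement is the slot into which the \<open>a\<close>-th
  vector is put.\<close>

definition arrangements :: "'a set \<Rightarrow> nat \<Rightarrow> 'a list set" where
  "arrangements S m = {xs. length xs = m \<and> distinct xs \<and> set xs \<subseteq> S}"

lemma finite_arrangements: "finite S \<Longrightarrow> finite (arrangements S m)"
  unfolding arrangements_def
  by (rule finite_subset[OF _ finite_lists_length_eq[of S m]]) auto

lemma arrangements_0: "arrangements S 0 = {[]}"
  unfolding arrangements_def by auto

lemma arrangements_empty:
  assumes "finite S" and "card S < m" shows "arrangements S m = {}"
proof -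
  have False if "xs \<in> arrangements S m" for xs
    using that assms card_mono[of S "set xs"] distinct_card[of xs] unfolding arrangements_def by auto
  then show ?thesis by blast
qed

lemma arrangements_full:
  assumes "finite S" and "card S = m" and "xs \<in> arrangements S m" shows "set xs = S"
  using assms distinct_card[of xs] card_subset_eq[of S "set xs"] unfolding arrangements_def by auto

text \<open>The recursion of successive substitutions: the new last entry is the slot chosen in step
  \<open>m\<close>.\<close>

lemma sum_arrangements_Suc:
  fixes h :: "'a list \<Rightarrow> 'b::comm_monoid_add"
  assumes "finite S"
  shows "(\<Sum>zs\<in>arrangements S (Suc m). h zs)
    = (\<Sum>xs\<in>arrangements S m. \<Sum>k\<in>S - set xs. h (xs @ [k]))"
proof -
  let ?P = "SIGMA xs:arrangements S m. S - set xs"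
  let ?g = "\<lambda>(xs, k). xs @ [k]"
  have inj: "inj_on ?g ?P" by (auto simp: inj_on_def)
  have im: "?g ` ?P = arrangements S (Suc m)"
  proof
    show "?g ` ?P \<subseteq> arrangements S (Suc m)" unfolding arrangements_def by auto
    show "arrangements S (Suc m) \<subseteq> ?g ` ?P"
    proof
      fix zs assume zs: "zs \<in> arrangements S (Suc m)"
      then have "zs \<noteq> []" unfolding arrangements_def by auto
      then obtain xs k where "zs = xs @ [k]" by (metis append_butlast_last_id)
      then have "zs = ?g (xs, k)" "(xs, k) \<in> ?P" using zs unfolding arrangements_def by auto
      then show "zs \<in> ?g ` ?P" by blast
    qed
  qed
  have "(\<Sum>xs\<in>arrangements S m. \<Sum>k\<in>S - set xs. h (xs @ [k])) = (\<Sum>p\<in>?P. h (?g p))"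
    using assms finite_arrangements[OF assms]
    by (subst sum.Sigma) (auto simp: case_prod_unfold)
  also have "\<dots> = (\<Sum>zs\<in>?g ` ?P. h zs)" using inj by (simp add: sum.reindex)
  finally show ?thesis using im by simp
qed

text \<open>\<open>w\<close> is indexed by the position in \<open>xs\<close>, \<open>W\<close> by
  the slot. The description operator is unambiguous for distinct lists.\<close>

definition put :: "('a \<Rightarrow> 'v) \<Rightarrow> 'a list \<Rightarrow> (nat \<Rightarrow> 'v) \<Rightarrow> 'a \<Rightarrow> 'v" where
  "put W xs w k = (if k \<in> set xs then w (THE a. a < length xs \<and> xs ! a = k) else W k)"

lemma put_nth [simp]: "distinct xs \<Longrightarrow> a < length xs \<Longrightarrow> put W xs w (xs ! a) = w a"
proof -
  assume "distinct xs" "a < length xs"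
  then have "(THE b. b < length xs \<and> xs ! b = xs ! a) = a"
    by (auto simp: nth_eq_iff_index_eq)
  then show ?thesis using \<open>a < length xs\<close> unfolding put_def by simp
qed

lemma put_notin [simp]: "k \<notin> set xs \<Longrightarrow> put W xs w k = W k"
  unfolding put_def by simp

lemma put_Nil [simp]: "put W [] w = W"
  by (rule ext) simp

lemma put_eqI:
  assumes "distinct xs" and "\<And>a. a < length xs \<Longrightarrow> V (xs ! a) = w a"
    and "\<And>k. k \<notin> set xs \<Longrightarrow> V k = W k"
  shows "put W xs w = V"
proof
  fix k show "put W xs w k = V k"
    using assms by (cases "k \<in> set xs") (auto simp: in_set_conv_nth)
qed

lemma put_snoc:
  assumes "distinct (xs @ [k])"
  shows "put W (xs @ [k]) w = (put W xs w)(k := w (length xs))"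
proof (rule put_eqI)
  show "((put W xs w)(k := w (length xs))) ((xs @ [k]) ! a) = w a" if "a < length (xs @ [k])" for a
  proof (cases "a < length xs")
    case True
    then have "xs ! a \<noteq> k" using assms nth_mem[OF True] by auto
    then show ?thesis using assms True by (simp add: nth_append)
  next
    case False
    then show ?thesis using that by (simp add: nth_append less_Suc_eq)
  qed
qed (use assms in auto)

lemma put_upd:
  assumes "distinct xs" and "k \<notin> set xs"
  shows "put (W(k := z)) xs w = (put W xs w)(k := z)"
proof (rule put_eqI)
  show "((put W xs w)(k := z)) (xs ! a) = w a" if "a < length xs" for a
  proof -
    have "xs ! a \<noteq> k" using assms nth_mem[OF that] by auto
    then show ?thesis using that assms by simp
  qed
qed (use assms in auto)

text \<open>
  The index \<open>i\<close> stands for a collection of contracted pairs and \<open>S i\<close> for the slots left over. The action on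
  functions of the test vectors is contragredient, which is why the sign appears.
\<close>

definition slot_act ::
    "('i \<Rightarrow> nat set) \<Rightarrow> ('v \<Rightarrow> 'v) \<Rightarrow> ('i \<Rightarrow> (nat \<Rightarrow> 'v) \<Rightarrow> 'k) \<Rightarrow> 'i \<Rightarrow> (nat \<Rightarrow> 'v) \<Rightarrow> 'k::field" where
  "slot_act S X f i W = - (\<Sum>k\<in>S i. f i (W(k := X (W k))))"

definition scl :: "'k::field \<Rightarrow> ('i \<Rightarrow> 'a \<Rightarrow> 'k) \<Rightarrow> 'i \<Rightarrow> 'a \<Rightarrow> 'k" where
  "scl c f i x = c * f i x"

lemma vector_space_scl: "vector_space scl"
  by unfold_locales (auto simp: scl_def fun_eq_iff algebra_simps)

context countable_quadratic_space
begin

text \<open>This is \<open>u \<and> w\<close> in the identification of the orthogonal Lie algebra with the exterior square.\<close>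

definition wedge :: "'v \<Rightarrow> 'v \<Rightarrow> 'v \<Rightarrow> 'v" where
  "wedge u w v = scale (Q v w) u - scale (Q v u) w"

lemma wedge_so: "wedge u w \<in> so_inf scale Q"
proof -
  interpret op: module "\<lambda>c (X :: 'v \<Rightarrow> 'v) v. scale c (X v)"
    by unfold_locales (auto simp: fun_eq_iff scale_right_distrib scale_left_distrib)
  have g: "(\<lambda>v. scale (Q v b) a) \<in> gl_inf scale Q" for a b
    unfolding gl_inf_def by (rule op.span_base) blast
  have "(\<lambda>v. scale (Q v w) u) - (\<lambda>v. scale (Q v u) w) \<in> gl_inf scale Q"
    using g[of w u] g[of u w] unfolding gl_inf_def by (rule op.span_diff)
  moreover have "(\<lambda>v. scale (Q v w) u) - (\<lambda>v. scale (Q v u) w) = wedge u w"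
    by (simp add: fun_eq_iff wedge_def)
  ultimately have "wedge u w \<in> gl_inf scale Q" by simp
  then show ?thesis
    unfolding so_inf_def wedge_def using symmetric[of _ u] symmetric[of _ w] by (simp add: Q_simps)
qed

end

text \<open>\<open>M_linear\<close> states linearity in a slot in the form that matches the two
  terms of \<open>wedge\<close>. \<open>M_adapted\<close> is the finiteness that separates tensors
  from arbitrary multilinear functions: all slots of all members of \<open>f\<close> take values in
  the span of one finite \<open>B\<close>, and hence can be tested on its dual vectors.\<close>

locale tensor_family = countable_quadratic_space scale Q
  for scale :: "'k::{alg_closed_field, field_char_0} \<Rightarrow> 'v::ab_group_add \<Rightarrow> 'v" and Q +
  fixes A :: "'i set" and S :: "'i \<Rightarrow> nat set" and M :: "('i \<Rightarrow> (nat \<Rightarrow> 'v) \<Rightarrow> 'k) set"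
  assumes finite_A: "finite A" and finite_S: "i \<in> A \<Longrightarrow> finite (S i)"
    and M_zero: "0 \<in> M" and M_add: "f \<in> M \<Longrightarrow> h \<in> M \<Longrightarrow> f + h \<in> M"
    and M_scl: "f \<in> M \<Longrightarrow> scl c f \<in> M"
    and M_act: "X \<in> so_inf scale Q \<Longrightarrow> f \<in> M \<Longrightarrow> slot_act S X f \<in> M"
    and M_outside: "f \<in> M \<Longrightarrow> i \<notin> A \<Longrightarrow> f i W = 0"
    and M_local: "f \<in> M \<Longrightarrow> i \<in> A \<Longrightarrow> (\<And>k. k \<in> S i \<Longrightarrow> W k = W' k) \<Longrightarrow> f i W = f i W'"
    and M_linear: "f \<in> M \<Longrightarrow> i \<in> A \<Longrightarrow> k \<in> S i \<Longrightarrow>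
      f i (W(k := scale a x - scale b y)) = a * f i (W(k := x)) - b * f i (W(k := y))"
    and M_adapted: "f \<in> M \<Longrightarrow> \<exists>B d. dual_on B d \<and> (\<forall>i\<in>A. \<forall>k\<in>S i. \<forall>W.
      f i W = (\<Sum>x\<in>B. Q x (W k) * f i (W(k := d x))))"
begin

section \<open>The Lie algebra acting on families\<close>

definition FM :: "('k, 'v \<Rightarrow> 'v, 'i \<Rightarrow> (nat \<Rightarrow> 'v) \<Rightarrow> 'k) rep" where
  "FM = \<lparr> carr = M, add = (+), zero = 0, smult = scl, act = slot_act S \<rparr>"

abbreviation subm where "subm N \<equiv> submod (so_inf scale Q) FM N"

lemma submD:
  assumes "subm N"
  shows "N \<subseteq> M" "0 \<in> N" "f \<in> N \<Longrightarrow> h \<in> N \<Longrightarrow> f + h \<in> N" "f \<in> N \<Longrightarrow> scl c f \<in> N"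
    "f \<in> N \<Longrightarrow> slot_act S (wedge u w) f \<in> N"
  using assms wedge_so unfolding submod_def FM_def by auto

lemma subm_sum:
  assumes "subm N" and "\<And>x. x \<in> I \<Longrightarrow> f x \<in> N" shows "sum f I \<in> N"
  using assms(2)
  by (induction I rule: infinite_finite_induct) (auto simp: submD[OF assms(1)])

lemma FM_lin_rep: "lin_rep (so_inf scale Q) FM"
  by unfold_locales
    (auto simp: FM_def M_zero M_add M_scl M_act scl_def slot_act_def fun_eq_iff algebra_simps sum.distrib)

lemma wedge_act:
  assumes "f \<in> M" and "i \<in> A"
  shows "slot_act S (wedge u w) f i W
    = (\<Sum>k\<in>S i. Q u (W k) * f i (W(k := w)) - Q w (W k) * f i (W(k := u)))"
  unfolding slot_act_def wedge_def sum_negf[symmetric]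
  by (rule sum.cong)
    (use M_linear[OF assms] symmetric[of u] symmetric[of w] in \<open>auto simp: algebra_simps\<close>)

text \<open>This holds whenever \<open>u\<close> is orthogonal to the vectors from which
  \<open>f\<close> is built, see \<open>adapted_kills\<close>. It removes the term of
  \<open>wedge u w\<close> in which \<open>u\<close> enters \<open>f\<close>.\<close>

definition kills :: "('i \<Rightarrow> (nat \<Rightarrow> 'v) \<Rightarrow> 'k) \<Rightarrow> 'v \<Rightarrow> bool" where
  "kills f u \<longleftrightarrow> (\<forall>i\<in>A. \<forall>k\<in>S i. \<forall>W. f i (W(k := u)) = 0)"

lemma wedge_act_kills:
  assumes "f \<in> M" and "i \<in> A" and "kills f u"
  shows "slot_act S (wedge u w) f i W = (\<Sum>k\<in>S i. Q u (W k) * f i (W(k := w)))"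
  unfolding wedge_act[OF assms(1,2)]
  by (rule sum.cong) (use assms(2,3) in \<open>auto simp: kills_def\<close>)

lemma adapted_kills:
  assumes "\<forall>i\<in>A. \<forall>k\<in>S i. \<forall>W. f i W = (\<Sum>x\<in>I. Q (b x) (W k) * f i (W(k := d x)))"
    and "\<forall>x\<in>I. Q (b x) u = 0"
  shows "kills f u"
  unfolding kills_def
proof (intro ballI allI)
  fix i k W assume "i \<in> A" "k \<in> S i"
  then have "f i (W(k := u)) = (\<Sum>x\<in>I. Q (b x) ((W(k := u)) k) * f i ((W(k := u))(k := d x)))"
    using assms(1) by blast
  also have "\<dots> = 0" by (rule sum.neutral) (use assms(2) in simp)
  finally show "f i (W(k := u)) = 0" .
qed

primrec subst_all :: "(nat \<Rightarrow> 'v) \<Rightarrow> (nat \<Rightarrow> 'v) \<Rightarrow> nat \<Rightarrow> ('i \<Rightarrow> (nat \<Rightarrow> 'v) \<Rightarrow> 'k) \<Rightarrow> 'i \<Rightarrow> (nat \<Rightarrow> 'v) \<Rightarrow> 'k" where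
  "subst_all u w 0 f = f"
| "subst_all u w (Suc m) f = slot_act S (wedge (u m) (w m)) (subst_all u w m f)"

lemma subst_all_in: "subm N \<Longrightarrow> f \<in> N \<Longrightarrow> subst_all u w m f \<in> N"
  by (induction m) (auto simp: submD)

lemma subm_M: "subm M"
  using M_zero M_add M_scl M_act unfolding submod_def FM_def by auto

lemma subst_all_cong: "(\<And>a. a < m \<Longrightarrow> w a = w' a) \<Longrightarrow> subst_all u w m f = subst_all u w' m f"
  by (induction m) auto

text \<open>Step \<open>a\<close> chooses a slot, leaves the product of \<open>u a\<close> with its
  test vector as a factor and feeds \<open>w a\<close> to \<open>f\<close> there. The
  \<open>u a\<close> are isotropic, mutually orthogonal and orthogonal to the \<open>w b\<close>, so
  that no slot is chosen twice; the sum over injective choices remains.\<close>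

lemma subst_all_formula:
  assumes "f \<in> M" and "\<And>a. a < n \<Longrightarrow> kills f (u a)"
    and iso: "\<And>a b. a < n \<Longrightarrow> b < n \<Longrightarrow> Q (u a) (u b) = 0"
    and uw: "\<And>a b. a < n \<Longrightarrow> b < n \<Longrightarrow> Q (u a) (w b) = 0"
    and "m \<le> n" and i: "i \<in> A"
  shows "subst_all u w m f i W
    = (\<Sum>xs\<in>arrangements (S i) m. (\<Prod>a<m. Q (u a) (W (xs ! a))) * f i (put W xs w))"
  using \<open>m \<le> n\<close> i
proof (induction m arbitrary: i W)
  case 0
  then show ?case by (simp add: arrangements_0)
next
  case (Suc m)
  note IH = Suc.IH[OF Suc_leD[OF Suc.prems(1)]]
  \<comment> \<open>Earlier substitutions do not spoil the hypothesis on \<open>u m\<close>: in a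
    slot already chosen it meets some \<open>u a\<close> and gives 0, in any other slot it reaches
    \<open>f\<close>.\<close>
  have "kills (subst_all u w m f) (u m)"
    unfolding kills_def
  proof (intro ballI allI)
    fix j k W assume jk: "j \<in> A" "k \<in> S j"
    have "(\<Prod>a<m. Q (u a) ((W(k := u m)) (xs ! a))) * f j (put (W(k := u m)) xs w) = 0"
      if xs: "xs \<in> arrangements (S j) m" for xs
    proof (cases "k \<in> set xs")
      case True
      then obtain a where "a < m" "xs ! a = k" using xs by (auto simp: arrangements_def in_set_conv_nth)
      then have "(\<Prod>a<m. Q (u a) ((W(k := u m)) (xs ! a))) = 0"
        using iso Suc.prems(1) by (intro prod_zero) auto
      then show ?thesis by simp
    next
      case False
      have "f j (put (W(k := u m)) xs w) = 0"
        using False xs assms(2)[of m] Suc.prems(1) jk by (simp add: put_upd arrangements_def kills_def)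
      then show ?thesis by simp
    qed
    then show "subst_all u w m f j (W(k := u m)) = 0" unfolding IH[OF jk(1)] by (rule sum.neutral[rule_format])
  qed
  then have "subst_all u w (Suc m) f i W
      = (\<Sum>k\<in>S i. Q (u m) (W k) * subst_all u w m f i (W(k := w m)))"
    using wedge_act_kills[OF subst_all_in[OF subm_M assms(1)] Suc.prems(2)] by simp
  also have "\<dots> = (\<Sum>k\<in>S i. \<Sum>xs\<in>arrangements (S i) m.
      Q (u m) (W k) * ((\<Prod>a<m. Q (u a) ((W(k := w m)) (xs ! a))) * f i (put (W(k := w m)) xs w)))"
    unfolding IH[OF Suc.prems(2)] sum_distrib_left ..
  also have "\<dots> = (\<Sum>xs\<in>arrangements (S i) m. \<Sum>k\<in>S i.
      Q (u m) (W k) * ((\<Prod>a<m. Q (u a) ((W(k := w m)) (xs ! a))) * f i (put (W(k := w m)) xs w)))"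
    by (rule sum.swap)
  also have "\<dots> = (\<Sum>xs\<in>arrangements (S i) m. \<Sum>k\<in>S i - set xs.
      (\<Prod>a<Suc m. Q (u a) (W ((xs @ [k]) ! a))) * f i (put W (xs @ [k]) w))"
  proof (rule sum.cong[OF refl])
    fix xs assume xs: "xs \<in> arrangements (S i) m"
    show "(\<Sum>k\<in>S i. Q (u m) (W k) * ((\<Prod>a<m. Q (u a) ((W(k := w m)) (xs ! a))) * f i (put (W(k := w m)) xs w)))
      = (\<Sum>k\<in>S i - set xs. (\<Prod>a<Suc m. Q (u a) (W ((xs @ [k]) ! a))) * f i (put W (xs @ [k]) w))"
    \<comment> \<open>If \<open>k\<close> was chosen before in step \<open>a\<close>, the vector
      \<open>w m\<close> placed there meets \<open>u a\<close>, and the product vanishes.\<close>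
    proof (rule sum.mono_neutral_cong_right)
      show "\<forall>k\<in>S i - (S i - set xs). Q (u m) (W k) *
          ((\<Prod>a<m. Q (u a) ((W(k := w m)) (xs ! a))) * f i (put (W(k := w m)) xs w)) = 0"
      proof
        fix k assume "k \<in> S i - (S i - set xs)"
        then obtain a where "a < m" "xs ! a = k" using xs by (auto simp: arrangements_def in_set_conv_nth)
        then have "(\<Prod>a<m. Q (u a) ((W(k := w m)) (xs ! a))) = 0"
          using uw Suc.prems(1) by (intro prod_zero) auto
        then show "Q (u m) (W k) *
          ((\<Prod>a<m. Q (u a) ((W(k := w m)) (xs ! a))) * f i (put (W(k := w m)) xs w)) = 0" by simp
      qed
      fix k assume k: "k \<in> S i - set xs"
      have "(\<Prod>a<m. Q (u a) ((W(k := w m)) (xs ! a))) = (\<Prod>a<m. Q (u a) (W ((xs @ [k]) ! a)))"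
      proof (rule prod.cong[OF refl])
        fix a assume a: "a \<in> {..<m}"
        then have "xs ! a \<noteq> k" using k xs nth_mem[of a xs] by (auto simp: arrangements_def)
        then show "Q (u a) ((W(k := w m)) (xs ! a)) = Q (u a) (W ((xs @ [k]) ! a))"
          using a xs by (simp add: nth_append arrangements_def)
      qed
      moreover have "put (W(k := w m)) xs w = put W (xs @ [k]) w"
        using k xs by (simp add: put_upd put_snoc arrangements_def)
      moreover have "(xs @ [k]) ! m = k" using xs by (simp add: nth_append arrangements_def)
      ultimately show "Q (u m) (W k) * ((\<Prod>a<m. Q (u a) ((W(k := w m)) (xs ! a))) * f i (put (W(k := w m)) xs w))
        = (\<Prod>a<Suc m. Q (u a) (W ((xs @ [k]) ! a))) * f i (put W (xs @ [k]) w)"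
        by simp
    qed (use finite_S Suc.prems in auto)
  qed
  also have "\<dots> = (\<Sum>xs\<in>arrangements (S i) (Suc m). (\<Prod>a<Suc m. Q (u a) (W (xs ! a))) * f i (put W xs w))"
    by (rule sum_arrangements_Suc[symmetric]) (use finite_S Suc.prems in auto)
  finally show ?case .
qed

text \<open>
  With \<open>b\<close> and \<open>d\<close> dual bases, the eigenvalue \<open>c\<close> counts the slots that take values in the span of \<open>b\<close>.
\<close>

definition euler :: "'j set \<Rightarrow> ('j \<Rightarrow> 'v) \<Rightarrow> ('j \<Rightarrow> 'v) \<Rightarrow> 'k \<Rightarrow> ('i \<Rightarrow> (nat \<Rightarrow> 'v) \<Rightarrow> 'k) \<Rightarrow> bool" where
  "euler I b d c f \<longleftrightarrow> (\<forall>i\<in>A. \<forall>W.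
     (\<Sum>k\<in>S i. \<Sum>x\<in>I. Q (b x) (W k) * f i (W(k := d x))) = c * f i W)"

text \<open>For dual \<open>b\<close> and \<open>d\<close> and \<open>q\<close> in the span of the
  \<open>b x\<close>, the sum of \<open>Q p (b x) * Q q (d x)\<close> over \<open>x\<close> is
  \<open>Q p q\<close>. The sum in the body is therefore the contraction of slots \<open>l\<close>
  and \<open>k\<close> when the entries of \<open>f\<close> lie in that span.\<close>

definition no_trace :: "'j set \<Rightarrow> ('j \<Rightarrow> 'v) \<Rightarrow> ('j \<Rightarrow> 'v) \<Rightarrow> ('i \<Rightarrow> (nat \<Rightarrow> 'v) \<Rightarrow> 'k) \<Rightarrow> bool" where
  "no_trace I b d f \<longleftrightarrow> (\<forall>i\<in>A. \<forall>k\<in>S i. \<forall>l\<in>S i. k \<noteq> l \<longrightarrow>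
     (\<forall>W. (\<Sum>x\<in>I. f i (W(l := b x, k := d x))) = 0))"

text \<open>
  Replacing \<open>b x\<close> by \<open>u\<close> and back reproduces \<open>f\<close> once for each slot; the remaining terms are traces of \<open>f\<close>.
\<close>

lemma casimir:
  assumes f: "f \<in> M" and ku: "kills f u" and kv: "kills f v"
    and Quv: "Q u v = 1" and ub: "\<forall>x\<in>I. Q u (b x) = 0"
    and eu: "euler I b d c f" and nt: "no_trace I b d f" and i: "i \<in> A"
  shows "(\<Sum>x\<in>I. slot_act S (wedge (b x) v) (slot_act S (wedge u (d x)) f) i W) = c * f i W"
proof -
  define s where "s x = slot_act S (wedge u (d x)) f" for x
  have sM: "s x \<in> M" for x unfolding s_def by (rule submD(5)[OF subm_M f])
  have s: "s x i W = (\<Sum>k\<in>S i. Q u (W k) * f i (W(k := d x)))" for x W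
    unfolding s_def by (rule wedge_act_kills[OF f i ku])
  \<comment> \<open>With \<open>v\<close> in slot \<open>l\<close>, a term that pairs
    \<open>u\<close> with another slot leaves \<open>v\<close> inside \<open>f\<close> and vanishes;
    pairing \<open>u\<close> with slot \<open>l\<close> itself gives
    \<open>Q u v = 1\<close>.\<close>
  have s1: "s x i (W(l := v)) = f i (W(l := d x))" if l: "l \<in> S i" for x l
  proof -
    have "s x i (W(l := v)) = (\<Sum>k\<in>S i. if k = l then f i (W(l := d x)) else 0)"
      unfolding s
    proof (rule sum.cong[OF refl])
      fix k assume k: "k \<in> S i"
      show "Q u ((W(l := v)) k) * f i (W(l := v, k := d x)) = (if k = l then f i (W(l := d x)) else 0)"
      proof (cases "k = l")
        case True
        then show ?thesis using Quv by simp
      next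
        case False
        then have "W(l := v, k := d x) = (W(k := d x))(l := v)" by (rule fun_upd_twist[OF not_sym])
        then show ?thesis using False kv i l unfolding kills_def by simp
      qed
    qed
    then show ?thesis using l finite_S[OF i] by simp
  qed
  \<comment> \<open>Here the term \<open>k = l\<close> vanishes because \<open>u\<close> is
    orthogonal to \<open>b x\<close>, and the others are traces of \<open>f\<close> up to the factor
    \<open>Q u (W k)\<close>.\<close>
  have s2: "(\<Sum>x\<in>I. s x i (W(l := b x))) = 0" if l: "l \<in> S i" for l
  proof -
    have "(\<Sum>x\<in>I. s x i (W(l := b x)))
        = (\<Sum>k\<in>S i. \<Sum>x\<in>I. Q u ((W(l := b x)) k) * f i (W(l := b x, k := d x)))"
      unfolding s by (rule sum.swap)
    also have "\<dots> = 0"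
    proof (rule sum.neutral, rule ballI)
      fix k assume k: "k \<in> S i"
      show "(\<Sum>x\<in>I. Q u ((W(l := b x)) k) * f i (W(l := b x, k := d x))) = 0"
      proof (cases "k = l")
        case True
        then show ?thesis using ub by (intro sum.neutral) auto
      next
        case False
        then have "(\<Sum>x\<in>I. Q u ((W(l := b x)) k) * f i (W(l := b x, k := d x)))
          = Q u (W k) * (\<Sum>x\<in>I. f i (W(l := b x, k := d x)))" by (simp add: sum_distrib_left)
        then show ?thesis using nt False i k l unfolding no_trace_def by simp
      qed
    qed
    finally show ?thesis .
  qed
  have "(\<Sum>x\<in>I. slot_act S (wedge (b x) v) (s x) i W)
      = (\<Sum>x\<in>I. \<Sum>l\<in>S i. Q (b x) (W l) * s x i (W(l := v)) - Q v (W l) * s x i (W(l := b x)))"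
    unfolding wedge_act[OF sM i] ..
  also have "\<dots> = (\<Sum>l\<in>S i. \<Sum>x\<in>I. Q (b x) (W l) * s x i (W(l := v)) - Q v (W l) * s x i (W(l := b x)))"
    by (rule sum.swap)
  also have "\<dots> = (\<Sum>l\<in>S i. \<Sum>x\<in>I. Q (b x) (W l) * f i (W(l := d x)))"
  proof (rule sum.cong[OF refl])
    fix l assume l: "l \<in> S i"
    have "(\<Sum>x\<in>I. Q v (W l) * s x i (W(l := b x))) = 0"
      unfolding sum_distrib_left[symmetric] s2[OF l] by simp
    then show "(\<Sum>x\<in>I. Q (b x) (W l) * s x i (W(l := v)) - Q v (W l) * s x i (W(l := b x)))
        = (\<Sum>x\<in>I. Q (b x) (W l) * f i (W(l := d x)))"
      unfolding sum_subtractf s1[OF l] by simp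
  qed
  also have "\<dots> = c * f i W" using eu i unfolding euler_def by blast
  finally show ?thesis unfolding s_def .
qed

text \<open>The substituted slot drops out of the count: it is paired with \<open>u\<close>, which
  is orthogonal to every \<open>d x\<close>, while in \<open>f\<close> with \<open>d y\<close> in
  slot \<open>k\<close> that slot alone accounts for exactly 1 of the eigenvalue, by duality.
  Vanishing traces and killed vectors are inherited because \<open>u\<close> is orthogonal to the
  \<open>b x\<close>, the \<open>d x\<close> and \<open>z\<close>.\<close>

lemma wedge_act_step:
  assumes f: "f \<in> M" and ku: "kills f u"
    and I: "finite I" "\<forall>x\<in>I. \<forall>y\<in>I. Q (b x) (d y) = (if x = y then 1 else 0)"
    and ub: "\<forall>x\<in>I. Q u (b x) = 0 \<and> Q u (d x) = 0"
    and y: "y \<in> I"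
  shows "euler I b d c f \<Longrightarrow> euler I b d (c - 1) (slot_act S (wedge u (d y)) f)"
    and "no_trace I b d f \<Longrightarrow> no_trace I b d (slot_act S (wedge u (d y)) f)"
    and "kills f z \<Longrightarrow> Q u z = 0 \<Longrightarrow> kills (slot_act S (wedge u (d y)) f) z"
proof -
  have s: "slot_act S (wedge u (d y)) f i W = (\<Sum>k\<in>S i. Q u (W k) * f i (W(k := d y)))"
    if "i \<in> A" for i W
    by (rule wedge_act_kills[OF f that ku])
  show "euler I b d (c - 1) (slot_act S (wedge u (d y)) f)" if eu: "euler I b d c f"
    unfolding euler_def
  proof (intro ballI allI)
    fix i W assume i: "i \<in> A"
    note fin = finite_S[OF i]
    have "(\<Sum>l\<in>S i. \<Sum>x\<in>I. Q (b x) (W l) * slot_act S (wedge u (d y)) f i (W(l := d x)))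
      = (\<Sum>l\<in>S i. \<Sum>x\<in>I. \<Sum>k\<in>S i. if k = l then 0 else
          Q u (W k) * (Q (b x) (W l) * f i (W(k := d y, l := d x))))"
      unfolding s[OF i] sum_distrib_left
      by (intro sum.cong refl) (use ub in \<open>auto simp: fun_upd_twist\<close>)
    also have "\<dots> = (\<Sum>l\<in>S i. \<Sum>k\<in>S i. \<Sum>x\<in>I. if k = l then 0 else
          Q u (W k) * (Q (b x) (W l) * f i (W(k := d y, l := d x))))"
      by (intro sum.cong refl sum.swap)
    also have "\<dots> = (\<Sum>k\<in>S i. \<Sum>l\<in>S i. \<Sum>x\<in>I. if k = l then 0 else
          Q u (W k) * (Q (b x) (W l) * f i (W(k := d y, l := d x))))"
      by (rule sum.swap)
    also have "\<dots> = (\<Sum>k\<in>S i. Q u (W k) * ((c - 1) * f i (W(k := d y))))"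
    proof (rule sum.cong[OF refl])
      fix k assume k: "k \<in> S i"
      let ?V = "W(k := d y)"
      have "(\<Sum>x\<in>I. Q (b x) (?V k) * f i (?V(k := d x))) = (\<Sum>x\<in>I. if x = y then f i ?V else 0)"
        by (rule sum.cong) (use I(2) y in auto)
      then have kk: "(\<Sum>x\<in>I. Q (b x) (?V k) * f i (?V(k := d x))) = f i ?V" using I(1) y by simp
      have "(\<Sum>l\<in>S i. \<Sum>x\<in>I. Q (b x) (?V l) * f i (?V(l := d x))) = c * f i ?V"
        using eu i unfolding euler_def by blast
      then have "(\<Sum>l\<in>S i - {k}. \<Sum>x\<in>I. Q (b x) (?V l) * f i (?V(l := d x))) = (c - 1) * f i ?V"
        unfolding sum.remove[OF fin k] kk by (simp add: algebra_simps)
      moreover have "(\<Sum>l\<in>S i. \<Sum>x\<in>I. if k = l then 0 else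
          Q u (W k) * (Q (b x) (W l) * f i (?V(l := d x))))
        = (\<Sum>l\<in>S i - {k}. \<Sum>x\<in>I. Q u (W k) * (Q (b x) (?V l) * f i (?V(l := d x))))"
        using fin I(1) by (intro sum.mono_neutral_cong_right) auto
      ultimately show "(\<Sum>l\<in>S i. \<Sum>x\<in>I. if k = l then 0 else
          Q u (W k) * (Q (b x) (W l) * f i (?V(l := d x)))) = Q u (W k) * ((c - 1) * f i ?V)"
        by (simp flip: sum_distrib_left)
    qed
    also have "\<dots> = (c - 1) * slot_act S (wedge u (d y)) f i W"
      unfolding s[OF i] by (simp add: sum_distrib_left algebra_simps)
    finally show "(\<Sum>l\<in>S i. \<Sum>x\<in>I. Q (b x) (W l) * slot_act S (wedge u (d y)) f i (W(l := d x)))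
      = (c - 1) * slot_act S (wedge u (d y)) f i W" .
  qed
  show "no_trace I b d (slot_act S (wedge u (d y)) f)" if nt: "no_trace I b d f"
    unfolding no_trace_def
  proof (intro ballI allI impI)
    fix i k l W assume ikl: "i \<in> A" "k \<in> S i" "l \<in> S i" "k \<noteq> l"
    have "(\<Sum>x\<in>I. slot_act S (wedge u (d y)) f i (W(l := b x, k := d x)))
      = (\<Sum>j\<in>S i. \<Sum>x\<in>I. Q u ((W(l := b x, k := d x)) j) * f i (W(l := b x, k := d x, j := d y)))"
      unfolding s[OF ikl(1)] by (rule sum.swap)
    also have "\<dots> = 0"
    proof (rule sum.neutral, rule ballI)
      fix j assume j: "j \<in> S i"
      show "(\<Sum>x\<in>I. Q u ((W(l := b x, k := d x)) j) * f i (W(l := b x, k := d x, j := d y))) = 0"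
      proof (cases "j = k \<or> j = l")
        case True
        then show ?thesis using ub by (intro sum.neutral) auto
      next
        case False
        then have "W(l := b x, k := d x, j := d y) = W(j := d y, l := b x, k := d x)" for x
          by (auto simp: fun_eq_iff)
        then have "(\<Sum>x\<in>I. Q u ((W(l := b x, k := d x)) j) * f i (W(l := b x, k := d x, j := d y)))
          = Q u (W j) * (\<Sum>x\<in>I. f i (W(j := d y, l := b x, k := d x)))"
          using False by (simp add: sum_distrib_left)
        then show ?thesis using nt ikl unfolding no_trace_def by simp
      qed
    qed
    finally show "(\<Sum>x\<in>I. slot_act S (wedge u (d y)) f i (W(l := b x, k := d x))) = 0" .
  qed
  show "kills (slot_act S (wedge u (d y)) f) z" if "kills f z" "Q u z = 0"
    unfolding kills_def
  proof (intro ballI allI)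
    fix i l W assume il: "i \<in> A" "l \<in> S i"
    have "Q u ((W(l := z)) k) * f i (W(l := z, k := d y)) = 0" if "k \<in> S i" for k
    proof (cases "k = l")
      case True
      then show ?thesis using \<open>Q u z = 0\<close> by simp
    next
      case False
      then have "W(l := z, k := d y) = W(k := d y, l := z)" by (rule fun_upd_twist[OF not_sym])
      then show ?thesis using \<open>kills f z\<close> il unfolding kills_def by simp
    qed
    then show "slot_act S (wedge u (d y)) f i (W(l := z)) = 0"
      unfolding s[OF il(1)] by (intro sum.neutral) blast
  qed
qed

text \<open>Descending induction on the number \<open>j\<close> of substitutions. By
  \<open>casimir\<close>, \<open>n - j\<close> times the family with \<open>j\<close> substitutions
  is a sum of Lie algebra images of families with \<open>j + 1\<close> substitutions, and
  characteristic zero permits the division. The number \<open>n\<close> of hyperbolic pairs is the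
  eigenvalue of \<open>f\<close>, so the eigenvalue reaches 0 only when all pairs are used
  up.\<close>

lemma generated_by_substitutions:
  assumes f: "f \<in> M" and N: "subm N" and hyp: "hyperbolic n u v"
    and I: "finite I" "\<forall>x\<in>I. \<forall>y\<in>I. Q (b x) (d y) = (if x = y then 1 else 0)"
    and ub: "\<forall>a<n. \<forall>x\<in>I. Q (u a) (b x) = 0 \<and> Q (u a) (d x) = 0"
    and k: "\<forall>a<n. kills f (u a) \<and> kills f (v a)"
    and eu: "euler I b d (of_nat n) f" and nt: "no_trace I b d f"
    and sub: "\<And>w. (\<And>a. a < n \<Longrightarrow> w a \<in> d ` I) \<Longrightarrow> subst_all u w n f \<in> N"
  shows "f \<in> N"
proof -
  let ?D = "\<lambda>w j. subst_all u w j f"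
  have up: "j \<le> n \<Longrightarrow> euler I b d (of_nat n - of_nat j) (?D w j) \<and> no_trace I b d (?D w j)
      \<and> (\<forall>a<n. j \<le> a \<longrightarrow> kills (?D w j) (u a) \<and> kills (?D w j) (v a))"
    if "\<And>a. a < j \<Longrightarrow> w a \<in> d ` I" for w j
    using that
  proof (induction j)
    case 0
    then show ?case using eu nt k by simp
  next
    case (Suc j)
    obtain y where y: "y \<in> I" "w j = d y" using Suc.prems(2)[of j] by blast
    have IH: "euler I b d (of_nat n - of_nat j) (?D w j)" "no_trace I b d (?D w j)"
      "\<And>a. a < n \<Longrightarrow> j \<le> a \<Longrightarrow> kills (?D w j) (u a)" "\<And>a. a < n \<Longrightarrow> j \<le> a \<Longrightarrow> kills (?D w j) (v a)"
      using Suc by auto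
    have ku: "kills (?D w j) (u j)" using IH(3) Suc.prems by simp
    have ub': "\<forall>x\<in>I. Q (u j) (b x) = 0 \<and> Q (u j) (d x) = 0" using ub Suc.prems(1) by simp
    note step = wedge_act_step[OF subst_all_in[OF subm_M f] ku I ub' y(1)]
    have "of_nat n - of_nat (Suc j) = (of_nat n - of_nat j - 1 :: 'k)" by simp
    then show ?case
      using step(1)[OF IH(1)] step(2)[OF IH(2)] step(3)[OF IH(3)] step(3)[OF IH(4)] hyp Suc.prems(1)
      by (auto simp: y(2) hyperbolic_def algebra_simps)
  qed
  have down: "j \<le> n \<Longrightarrow> (\<And>a. a < j \<Longrightarrow> w a \<in> d ` I) \<Longrightarrow> ?D w j \<in> N" for w j
  proof (induction j arbitrary: w rule: inc_induct)
    case base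
    then show ?case using sub by blast
  next
    case (step j)
    let ?c = "of_nat n - of_nat j :: 'k"
    have c: "?c \<noteq> 0" using step.hyps by simp
    have j: "j < n" using step.hyps by simp
    have P: "euler I b d ?c (?D w j)" "no_trace I b d (?D w j)"
        "kills (?D w j) (u j)" "kills (?D w j) (v j)"
      using up[of j w] step.prems j by auto
    have uj: "Q (u j) (v j) = 1" "\<forall>x\<in>I. Q (u j) (b x) = 0"
      using hyp ub j by (auto simp: hyperbolic_def)
    define h where "h = (\<Sum>x\<in>I. slot_act S (wedge (b x) (v j)) (slot_act S (wedge (u j) (d x)) (?D w j)))"
    have "h \<in> N"
      unfolding h_def
    proof (rule subm_sum[OF N])
      fix x assume x: "x \<in> I"
      \<comment> \<open>The entry \<open>w j\<close> affects step \<open>j\<close> only, so each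
        \<open>d x\<close> may be inserted there on top of the same \<open>?D w j\<close>.\<close>
      have "?D (w(j := d x)) (Suc j) \<in> N"
        by (rule step.IH) (use step.prems x in \<open>auto simp: less_Suc_eq\<close>)
      moreover have "?D (w(j := d x)) j = ?D w j" by (rule subst_all_cong) simp
      ultimately have "slot_act S (wedge (u j) (d x)) (?D w j) \<in> N" by simp
      then show "slot_act S (wedge (b x) (v j)) (slot_act S (wedge (u j) (d x)) (?D w j)) \<in> N"
        by (rule submD(5)[OF N])
    qed
    moreover have "?D w j = scl (1 / ?c) h"
    proof (intro ext)
      fix i W
      have DM: "?D w j \<in> M" by (rule subst_all_in[OF subm_M f])
      show "?D w j i W = scl (1 / ?c) h i W"
      proof (cases "i \<in> A")
        case True
        have hs: "sum g I i W = (\<Sum>x\<in>I. g x i W)" for g :: "_ \<Rightarrow> 'i \<Rightarrow> (nat \<Rightarrow> 'v) \<Rightarrow> 'k"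
          by (induction I rule: infinite_finite_induct) auto
        have "h i W = ?c * ?D w j i W"
          unfolding h_def hs by (rule casimir[OF DM P(3,4) uj P(1,2) True])
        then show ?thesis using c by (simp add: scl_def)
      next
        case False
        have "h \<in> M" using \<open>h \<in> N\<close> submD(1)[OF N] by blast
        then show ?thesis using M_outside[OF DM False] M_outside[OF _ False, of h] by (simp add: scl_def)
      qed
    qed
    ultimately show ?case using submD(4)[OF N] by simp
  qed
  show ?thesis using down[of 0] by simp
qed

end

section \<open>Generic pure tensors and the socle of a family\<close>

text \<open>
  In the application \<open>T\<close> consists of the families killed by every further contraction. The last assumption
  holds because after substituting fresh isotropic vectors for all \<open>e\<close> slots there is nothing left to contract.
\<close>

locale traceless_family = tensor_family scale Q A S M
  for scale :: "'k::{alg_closed_field, field_char_0} \<Rightarrow> 'v::ab_group_add \<Rightarrow> 'v" and Q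
    and A :: "'i set" and S M +
  fixes e :: nat and T :: "('i \<Rightarrow> (nat \<Rightarrow> 'v) \<Rightarrow> 'k) set"
  assumes card_S: "i \<in> A \<Longrightarrow> card (S i) = e"
    and T_subm: "subm T"
    and T_adapted: "f \<in> T \<Longrightarrow> \<exists>B d. dual_on B d \<and> (\<forall>i\<in>A. \<forall>k\<in>S i. \<forall>W.
      f i W = (\<Sum>x\<in>B. Q x (W k) * f i (W(k := d x)))) \<and> no_trace B (\<lambda>x. x) d f"
    and T_subst: "f \<in> M \<Longrightarrow> \<exists>F. finite F \<and> (\<forall>u w.
      (\<forall>a<e. \<forall>b<e. Q (u a) (u b) = 0 \<and> Q (u a) (w b) = 0) \<and> (\<forall>a<e. \<forall>z\<in>F. Q (u a) z = 0)
        \<longrightarrow> subst_all u w e f \<in> T)"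
begin

section \<open>Coefficients of pure tensors\<close>

abbreviation arr :: "'i \<Rightarrow> nat list set" where "arr i \<equiv> arrangements (S i) e"

lemma arrD:
  assumes "i \<in> A" and "xs \<in> arr i"
  shows "length xs = e" "distinct xs" "set xs = S i"
  using assms arrangements_full[OF finite_S card_S, of i xs] by (auto simp: arrangements_def)

lemma arr_nth:
  assumes "i \<in> A" and "xs \<in> arr i" and "k \<in> S i"
  obtains a where "a < e" "xs ! a = k"
  using arrD[OF assms(1,2)] assms(3) by (metis in_set_conv_nth)

text \<open>\<open>w\<close> is indexed by positions, so that one \<open>w\<close> tests all members
  \<open>f i\<close> at once, whatever their slots. An arrangement of \<open>e\<close> slots covers
  \<open>S i\<close>, hence the zero background in \<open>put\<close> is never seen; the value 0
  elsewhere confines the coefficients to a finite-dimensional space.\<close>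

definition coef :: "(nat \<Rightarrow> 'v) \<Rightarrow> ('i \<Rightarrow> (nat \<Rightarrow> 'v) \<Rightarrow> 'k) \<Rightarrow> 'i \<Rightarrow> nat list \<Rightarrow> 'k" where
  "coef w f i xs = (if i \<in> A \<and> xs \<in> arr i then f i (put (\<lambda>_. 0) xs w) else 0)"

text \<open>
  The families whose members are combinations of the pure tensors with entries \<open>u 0, \<dots>, u (e - 1)\<close> in some
  order; \<open>v\<close> is dual to \<open>u\<close>, so that evaluation at \<open>v\<close> reads off the coefficients.
\<close>

definition pure_span where
  "pure_span u v = {f \<in> M. \<forall>i\<in>A. \<forall>W.
     f i W = (\<Sum>xs\<in>arr i. (\<Prod>a<e. Q (u a) (W (xs ! a))) * coef v f i xs)}"

lemma put_local:
  assumes "f \<in> M" "i \<in> A" "xs \<in> arr i" shows "f i (put W xs w) = f i (put (\<lambda>_. 0) xs w)"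
proof (rule M_local[OF assms(1,2)])
  fix k assume "k \<in> S i"
  then show "put W xs w k = put (\<lambda>_. 0) xs w k"
    using arrD[OF assms(2,3)] by (simp add: put_def)
qed

lemma prod_delta:
  assumes "hyperbolic e u v" and "i \<in> A" and "xs \<in> arr i" and "ys \<in> arr i"
  shows "(\<Prod>a<e. Q (u a) (put W xs v (ys ! a))) = (if xs = ys then 1 else 0)"
proof (cases "xs = ys")
  case True
  have "(\<Prod>a<e. Q (u a) (put W xs v (ys ! a))) = (\<Prod>a<e. 1)"
    by (rule prod.cong) (use True assms(1) arrD[OF assms(2,3)] in \<open>auto simp: hyperbolic_def\<close>)
  then show ?thesis using True by simp
next
  case False
  then obtain a where a: "a < e" "xs ! a \<noteq> ys ! a"
    using arrD[OF assms(2,3)] arrD[OF assms(2,4)] by (metis nth_equalityI)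
  have "ys ! a \<in> S i" using arrD[OF assms(2,4)] a nth_mem by metis
  then obtain b where b: "b < e" "xs ! b = ys ! a" by (rule arr_nth[OF assms(2,3)])
  then have "put W xs v (ys ! a) = v b" using arrD[OF assms(2,3)] put_nth by metis
  moreover have "a \<noteq> b" using a b by auto
  ultimately have "Q (u a) (put W xs v (ys ! a)) = 0" using assms(1) a b by (simp add: hyperbolic_def)
  then have "(\<Prod>a<e. Q (u a) (put W xs v (ys ! a))) = 0" using a by (intro prod_zero) auto
  then show ?thesis using False by simp
qed

text \<open>With all \<open>e\<close> slots substituted, nothing of \<open>W\<close> enters
  \<open>f\<close> any more: the result is a combination of products of the \<open>Q (u a)\<close>,
  with values of \<open>f\<close> at \<open>w\<close> as coefficients. Evaluations of
  \<open>f\<close> thus become coefficients of a pure family that is obtained from \<open>f\<close>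
  by the Lie algebra.\<close>

lemma subst_all_pure:
  assumes hyp: "hyperbolic e u v" and f: "f \<in> M"
    and k: "\<And>a. a < e \<Longrightarrow> kills f (u a)"
    and uw: "\<And>a b. a < e \<Longrightarrow> b < e \<Longrightarrow> Q (u a) (w b) = 0"
  shows "subst_all u w e f \<in> pure_span u v" "coef v (subst_all u w e f) = coef w f"
proof -
  have iso: "Q (u a) (u b) = 0" if "a < e" "b < e" for a b
    using hyp that by (simp add: hyperbolic_def)
  have F: "subst_all u w e f i W = (\<Sum>xs\<in>arr i. (\<Prod>a<e. Q (u a) (W (xs ! a))) * coef w f i xs)"
    if i: "i \<in> A" for i W
  proof -
    have "subst_all u w e f i W = (\<Sum>xs\<in>arr i. (\<Prod>a<e. Q (u a) (W (xs ! a))) * f i (put W xs w))"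
      by (rule subst_all_formula[of f e u w, OF f k iso uw order_refl i])
    also have "\<dots> = (\<Sum>xs\<in>arr i. (\<Prod>a<e. Q (u a) (W (xs ! a))) * coef w f i xs)"
    proof (rule sum.cong[OF refl])
      fix xs assume "xs \<in> arr i"
      then show "(\<Prod>a<e. Q (u a) (W (xs ! a))) * f i (put W xs w)
        = (\<Prod>a<e. Q (u a) (W (xs ! a))) * coef w f i xs"
        using i put_local[OF f i, of xs W w] by (simp only: coef_def if_True simp_thms)
    qed
    finally show ?thesis .
  qed
  show c: "coef v (subst_all u w e f) = coef w f"
  proof (intro ext)
    fix i xs show "coef v (subst_all u w e f) i xs = coef w f i xs"
    proof (cases "i \<in> A \<and> xs \<in> arr i")
      case True
      have "coef v (subst_all u w e f) i xs
        = (\<Sum>ys\<in>arr i. (\<Prod>a<e. Q (u a) (put (\<lambda>_. 0) xs v (ys ! a))) * coef w f i ys)"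
        using True F by (simp add: coef_def[of v])
      also have "\<dots> = (\<Sum>ys\<in>arr i. if xs = ys then coef w f i ys else 0)"
      proof (rule sum.cong[OF refl])
        fix ys assume "ys \<in> arr i"
        then show "(\<Prod>a<e. Q (u a) (put (\<lambda>_. 0) xs v (ys ! a))) * coef w f i ys
          = (if xs = ys then coef w f i ys else 0)"
          using True by (subst prod_delta[OF hyp, of i]) auto
      qed
      also have "\<dots> = coef w f i xs" using True finite_arrangements[OF finite_S] by simp
      finally show ?thesis .
    next
      case False
      then show ?thesis by (simp only: coef_def if_False)
    qed
  qed
  show "subst_all u w e f \<in> pure_span u v"
    unfolding pure_span_def mem_Collect_eq c using F subst_all_in[OF subm_M f, of u w e] by blast
qed

lemma pure_span_factor_zero:
  assumes "f \<in> pure_span u v" and i: "i \<in> A" and "k \<in> S i" and "\<forall>a<e. Q (u a) (W k) = 0"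
  shows "f i W = 0"
proof -
  have "(\<Prod>a<e. Q (u a) (W (xs ! a))) * coef v f i xs = 0" if xs: "xs \<in> arr i" for xs
  proof -
    obtain a where "a < e" "xs ! a = k" by (rule arr_nth[OF i xs assms(3)])
    then have "(\<Prod>a<e. Q (u a) (W (xs ! a))) = 0" using assms(4) by (intro prod_zero) auto
    then show ?thesis by simp
  qed
  then show ?thesis using assms(1) i unfolding pure_span_def by (simp add: sum.neutral)
qed

lemma pure_span_kills:
  assumes "f \<in> pure_span u v" and "\<forall>a<e. Q (u a) z = 0" shows "kills f z"
  unfolding kills_def using pure_span_factor_zero[OF assms(1)] assms(2) by simp

lemma pure_span_inj:
  assumes "f \<in> pure_span u v" "h \<in> pure_span u v" and "coef v f = coef v h"
  shows "f = h"
proof (intro ext)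
  fix i W show "f i W = h i W"
    using assms M_outside[of f i W] M_outside[of h i W] unfolding pure_span_def
    by (cases "i \<in> A") auto
qed

lemma coef_add: "coef w (f + h) = coef w f + coef w h"
  and coef_scl: "coef w (scl c f) = scl c (coef w f)"
  and coef_zero: "coef w 0 = 0"
  by (auto simp: coef_def scl_def fun_eq_iff)

lemma pure_span_closed:
  shows "0 \<in> pure_span u v" "f \<in> pure_span u v \<Longrightarrow> h \<in> pure_span u v \<Longrightarrow> f + h \<in> pure_span u v"
    "f \<in> pure_span u v \<Longrightarrow> scl c f \<in> pure_span u v"
  unfolding pure_span_def
  by (auto simp: M_zero M_add M_scl coef_add coef_scl coef_zero scl_def sum.distrib algebra_simps sum_distrib_left)

text \<open>Each slot of each product holds exactly one of the \<open>u a\<close>, so that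
  \<open>u\<close> and \<open>v\<close> form a dual system adapted to \<open>f\<close> and can take
  the role of \<open>b\<close> and \<open>d\<close> in the Casimir argument.\<close>

lemma pure_span_euler:
  assumes hyp: "hyperbolic e u v" and f: "f \<in> pure_span u v" and i: "i \<in> A" and k: "k \<in> S i"
  shows "f i W = (\<Sum>c<e. Q (u c) (W k) * f i (W(k := v c)))"
proof -
  have fW: "f i W = (\<Sum>xs\<in>arr i. (\<Prod>a<e. Q (u a) (W (xs ! a))) * coef v f i xs)" for W
    using f i unfolding pure_span_def by blast
  have main: "(\<Sum>c<e. Q (u c) (W k) * (\<Prod>a<e. Q (u a) ((W(k := v c)) (xs ! a))))
      = (\<Prod>a<e. Q (u a) (W (xs ! a)))" if xs: "xs \<in> arr i" for xs
  proof -
    obtain b where b: "b < e" "xs ! b = k" by (rule arr_nth[OF i xs k])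
    have other: "xs ! a \<noteq> k" if "a < e" "a \<noteq> b" for a
      using b that arrD[OF i xs] by (auto simp: nth_eq_iff_index_eq)
    have "Q (u c) (W k) * (\<Prod>a<e. Q (u a) ((W(k := v c)) (xs ! a)))
        = (if c = b then (\<Prod>a<e. Q (u a) (W (xs ! a))) else 0)" if c: "c < e" for c
    proof -
      have "(\<Prod>a<e. Q (u a) ((W(k := v c)) (xs ! a)))
        = Q (u b) (v c) * (\<Prod>a\<in>{..<e} - {b}. Q (u a) ((W(k := v c)) (xs ! a)))"
        using b by (subst prod.remove[of _ b]) auto
      also have "(\<Prod>a\<in>{..<e} - {b}. Q (u a) ((W(k := v c)) (xs ! a)))
        = (\<Prod>a\<in>{..<e} - {b}. Q (u a) (W (xs ! a)))"
        by (rule prod.cong[OF refl]) (use other in auto)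
      also have "Q (u b) (v c) = (if c = b then 1 else 0)"
        using hyp b c by (auto simp: hyperbolic_def)
      finally have "(\<Prod>a<e. Q (u a) ((W(k := v c)) (xs ! a)))
        = (if c = b then (\<Prod>a\<in>{..<e} - {b}. Q (u a) (W (xs ! a))) else 0)" by simp
      moreover have "(\<Prod>a<e. Q (u a) (W (xs ! a)))
        = Q (u b) (W k) * (\<Prod>a\<in>{..<e} - {b}. Q (u a) (W (xs ! a)))"
        using b by (subst prod.remove[of _ b]) auto
      ultimately show ?thesis by simp
    qed
    then show ?thesis using b by simp
  qed
  have "(\<Sum>c<e. Q (u c) (W k) * f i (W(k := v c)))
    = (\<Sum>c<e. \<Sum>xs\<in>arr i. Q (u c) (W k) * (\<Prod>a<e. Q (u a) ((W(k := v c)) (xs ! a))) * coef v f i xs)"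
    unfolding fW[of "W(k := _)"] sum_distrib_left by (simp add: mult.assoc)
  also have "\<dots> = (\<Sum>xs\<in>arr i. (\<Sum>c<e. Q (u c) (W k) * (\<Prod>a<e. Q (u a) ((W(k := v c)) (xs ! a)))) * coef v f i xs)"
    unfolding sum_distrib_right by (rule sum.swap)
  also have "\<dots> = f i W" unfolding fW[of W] by (rule sum.cong[OF refl]) (use main in simp)
  finally show ?thesis ..
qed

lemma euler_full:
  assumes "\<forall>i\<in>A. \<forall>k\<in>S i. \<forall>W. f i W = (\<Sum>x\<in>I. Q (b x) (W k) * f i (W(k := d x)))"
  shows "euler I b d (of_nat e) f"
  unfolding euler_def
proof (intro ballI allI)
  fix i W assume i: "i \<in> A"
  have "(\<Sum>k\<in>S i. \<Sum>x\<in>I. Q (b x) (W k) * f i (W(k := d x))) = (\<Sum>k\<in>S i. f i W)"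
    by (rule sum.cong[OF refl]) (use assms i in \<open>metis (no_types, lifting)\<close>)
  then show "(\<Sum>k\<in>S i. \<Sum>x\<in>I. Q (b x) (W k) * f i (W(k := d x))) = of_nat e * f i W"
    using card_S[OF i] by simp
qed

text \<open>Every slot holds one of the isotropic, mutually orthogonal \<open>u a\<close>, so
  inserting \<open>u x\<close> gives 0 in each term of the trace.\<close>

lemma pure_span_no_trace:
  assumes hyp: "hyperbolic e u v" and f: "f \<in> pure_span u v"
  shows "no_trace {..<e} u v f"
  unfolding no_trace_def
proof (intro ballI impI allI sum.neutral)
  fix i k l W x assume *: "i \<in> A" "k \<in> S i" "l \<in> S i" "k \<noteq> l" "x \<in> {..<e}"
  show "f i (W(l := u x, k := v x)) = 0"
    by (rule pure_span_factor_zero[OF f *(1,3)]) (use hyp * in \<open>auto simp: hyperbolic_def\<close>)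
qed

text \<open>
  The given \<open>u\<close> and \<open>v\<close> need not be orthogonal to the vectors occurring in \<open>f\<close>, so \<open>f\<close> is first moved to a
  fresh system \<open>u'\<close>, \<open>v'\<close> and from there to \<open>u\<close>, \<open>v\<close>.
\<close>

lemma generated_by_pure:
  assumes f: "f \<in> T" and N: "subm N" and hyp: "hyperbolic e u v"
    and pure: "\<And>h. h \<in> pure_span u v \<Longrightarrow> (\<And>N'. subm N' \<Longrightarrow> f \<in> N' \<Longrightarrow> h \<in> N') \<Longrightarrow> h \<in> N"
  shows "f \<in> N"
proof -
  have fM: "f \<in> M" using f submD(1)[OF T_subm] by blast
  obtain B d where B: "dual_on B d" "\<forall>i\<in>A. \<forall>k\<in>S i. \<forall>W.
      f i W = (\<Sum>x\<in>B. Q x (W k) * f i (W(k := d x)))" "no_trace B (\<lambda>x. x) d f"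
    using T_adapted[OF f] by blast
  have fB: "finite B" using B(1) by (simp add: dual_on_def)
  let ?F = "B \<union> d ` B \<union> u ` {..<e} \<union> v ` {..<e}"
  obtain u' v' where h': "hyperbolic e u' v'" "\<forall>a<e. \<forall>z\<in>?F. Q (u' a) z = 0 \<and> Q (v' a) z = 0"
    using hyperbolic_exists[of ?F] fB by blast
  have kill: "kills f z" if "\<forall>x\<in>B. Q z x = 0" for z
    by (rule adapted_kills[OF B(2)]) (use that symmetric in metis)
  \<comment> \<open>The entries of \<open>?h\<close> are the \<open>u' a\<close>, with
    \<open>v'\<close> as their dual system, whereas the given \<open>u\<close> and \<open>v\<close>
    are orthogonal to both and supply the hyperbolic pairs for a second use of
    \<open>generated_by_substitutions\<close>.\<close>
  have sub: "subst_all u' w e f \<in> N" if w: "\<And>a. a < e \<Longrightarrow> w a \<in> d ` B" for w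
  proof -
    let ?h = "subst_all u' w e f"
    have h: "?h \<in> pure_span u' v'"
      by (rule subst_all_pure[OF h'(1) fM kill]) (use w h'(2) in auto)
    have hM: "?h \<in> M" using h unfolding pure_span_def by blast
    have o: "Q (u' a) (u b) = 0" "Q (u' a) (v b) = 0" "Q (v' a) (u b) = 0" "Q (v' a) (v b) = 0"
      if "a < e" "b < e" for a b using h'(2) that by auto
    show ?thesis
    proof (rule generated_by_substitutions[OF hM N hyp, of "{..<e}" u' v'])
      show "\<forall>x\<in>{..<e}. \<forall>y\<in>{..<e}. Q (u' x) (v' y) = (if x = y then 1 else 0)"
        using h'(1) by (auto simp: hyperbolic_def)
      show "\<forall>a<e. \<forall>x\<in>{..<e}. Q (u a) (u' x) = 0 \<and> Q (u a) (v' x) = 0"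
        using o symmetric by (metis lessThan_iff)
      show "\<forall>a<e. kills ?h (u a) \<and> kills ?h (v a)"
        using pure_span_kills[OF h] o by simp
      show "euler {..<e} u' v' (of_nat e) ?h"
        by (rule euler_full) (use pure_span_euler[OF h'(1) h] in blast)
      show "no_trace {..<e} u' v' ?h" by (rule pure_span_no_trace[OF h'(1) h])
      show "subst_all u w' e ?h \<in> N" if w': "\<And>a. a < e \<Longrightarrow> w' a \<in> v' ` {..<e}" for w'
      proof (rule pure)
        show "subst_all u w' e ?h \<in> pure_span u v"
        proof (rule subst_all_pure[OF hyp hM])
          show "kills ?h (u a)" if "a < e" for a using pure_span_kills[OF h] o that by simp
          show "Q (u a) (w' b) = 0" if "a < e" "b < e" for a b
          proof -
            obtain c where "c < e" "w' b = v' c" using w'[OF \<open>b < e\<close>] by auto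
            then show ?thesis using o(3)[of c a] symmetric[of "u a" "v' c"] that by simp
          qed
        qed
        \<comment> \<open>Only Lie algebra elements have been applied to \<open>f\<close>, so the
          family lies in every submodule containing \<open>f\<close>; the premise
          \<open>pure\<close> makes this available to its user.\<close>
        show "subst_all u w' e ?h \<in> N'" if "subm N'" "f \<in> N'" for N'
          using subst_all_in that by blast
      qed
    qed simp
  qed
  show ?thesis
  proof (rule generated_by_substitutions[OF fM N h'(1) fB, of "\<lambda>x. x" d])
    show "\<forall>x\<in>B. \<forall>y\<in>B. Q x (d y) = (if x = y then 1 else 0)" using B(1) by (simp add: dual_on_def)
    show "\<forall>a<e. \<forall>x\<in>B. Q (u' a) x = 0 \<and> Q (u' a) (d x) = 0" using h'(2) by auto
    show "\<forall>a<e. kills f (u' a) \<and> kills f (v' a)" using kill h'(2) by simp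
    show "euler B (\<lambda>x. x) d (of_nat e) f" by (rule euler_full[OF B(2)])
    show "no_trace B (\<lambda>x. x) d f" by (rule B(3))
  qed (rule sub)
qed

text \<open>The place action of the symmetric group on coefficients. Lists of other lengths are
  fixed, which makes each relabelling a bijection of the whole function space and not only of the
  functions supported on arrangements.\<close>

definition relabel :: "(nat \<Rightarrow> nat) \<Rightarrow> ('i \<Rightarrow> nat list \<Rightarrow> 'k) \<Rightarrow> 'i \<Rightarrow> nat list \<Rightarrow> 'k" where
  "relabel \<pi> c i xs = c i (if length xs = e then permute_list \<pi> xs else xs)"

definition relabels where "relabels = relabel ` {\<pi>. \<pi> permutes {..<e}}"

lemma relabel_comp: "\<pi> permutes {..<e} \<Longrightarrow> relabel \<sigma> \<circ> relabel \<pi> = relabel (\<sigma> \<circ> \<pi>)"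
  by (auto simp: relabel_def fun_eq_iff permute_list_compose)

lemma relabel_id: "relabel id = id"
  by (auto simp: relabel_def fun_eq_iff)

lemma relabel_inv:
  assumes "\<pi> permutes {..<e}"
  shows "bij (relabel \<pi>)" "inv (relabel \<pi>) = relabel (inv \<pi>)"
proof -
  have 1: "relabel \<pi> \<circ> relabel (inv \<pi>) = id" "relabel (inv \<pi>) \<circ> relabel \<pi> = id"
    using assms permutes_inv[OF assms]
    by (simp_all add: relabel_comp relabel_id permutes_inv_o)
  then show "bij (relabel \<pi>)" by (metis o_bij)
  show "inv (relabel \<pi>) = relabel (inv \<pi>)" using 1 by (metis inv_unique_comp)
qed

sublocale relabelling: finite_linear_group "scl :: 'k \<Rightarrow> ('i \<Rightarrow> nat list \<Rightarrow> 'k) \<Rightarrow> _" relabels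
proof (rule finite_linear_group.intro[OF vector_space_scl finite_linear_group_axioms.intro])
  show fin: "finite relabels" unfolding relabels_def by (simp add: finite_permutations)
  show ne: "relabels \<noteq> {}" unfolding relabels_def using permutes_id by blast
  show "\<rho> \<circ> \<tau> \<in> relabels" if "\<rho> \<in> relabels" "\<tau> \<in> relabels" for \<rho> \<tau>
    using that unfolding relabels_def by (auto simp: relabel_comp permutes_compose)
  show "Vector_Spaces.linear scl scl \<rho>" if "\<rho> \<in> relabels" for \<rho>
    using that vector_space_scl unfolding relabels_def
    by (auto simp: Vector_Spaces.linear_iff relabel_def scl_def fun_eq_iff)
  show "bij \<rho>" "inv \<rho> \<in> relabels" if "\<rho> \<in> relabels" for \<rho>
    using that unfolding relabels_def by (auto simp: relabel_inv permutes_inv)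
  show "of_nat (card relabels) \<noteq> (0 :: 'k)" using fin ne by simp
qed


text \<open>The arrangements of the slots of one member are the permutations of any one of them, so
  the sum defining a pure family is a sum over permutations. Hence the coefficients at any
  \<open>w\<close> lie in every stable space that contains those at \<open>v\<close>.\<close>

lemma coef_expand:
  assumes h: "h \<in> pure_span u v"
  shows "coef w h = (\<Sum>\<pi> | \<pi> permutes {..<e}. scl (\<Prod>a<e. Q (u a) (w (\<pi> a))) (relabel \<pi> (coef v h)))"
proof (intro ext)
  fix i xs
  have hs: "sum g I i xs = (\<Sum>x\<in>I. g x i xs)" for g :: "(nat \<Rightarrow> nat) \<Rightarrow> 'i \<Rightarrow> nat list \<Rightarrow> 'k" and I
    by (induction I rule: infinite_finite_induct) auto
  show "coef w h i xs
    = (\<Sum>\<pi> | \<pi> permutes {..<e}. scl (\<Prod>a<e. Q (u a) (w (\<pi> a))) (relabel \<pi> (coef v h))) i xs"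
  proof (cases "i \<in> A \<and> xs \<in> arr i")
    case True
    then have i: "i \<in> A" and xs: "xs \<in> arr i" by auto
    note X = arrD[OF i xs]
    have nth: "permute_list \<pi> xs ! a = xs ! \<pi> a" "\<pi> a < e" if "\<pi> permutes {..<e}" "a < e" for \<pi> a
      using that X(1) permutes_in_image[of \<pi> "{..<e}" a] by (auto simp: permute_list_nth)
    have inj: "inj_on (\<lambda>\<pi>. permute_list \<pi> xs) {\<pi>. \<pi> permutes {..<e}}"
    proof (rule inj_onI, clarify)
      fix \<pi> \<sigma> assume *: "\<pi> permutes {..<e}" "\<sigma> permutes {..<e}" "permute_list \<pi> xs = permute_list \<sigma> xs"
      show "\<pi> = \<sigma>"
      proof
        fix a show "\<pi> a = \<sigma> a"
        proof (cases "a < e")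
          case True
          then have "xs ! \<pi> a = xs ! \<sigma> a" using nth * by metis
          then show ?thesis using nth(2) * True X by (simp add: nth_eq_iff_index_eq)
        next
          case False
          then show ?thesis using * by (simp add: permutes_not_in)
        qed
      qed
    qed
    have im: "(\<lambda>\<pi>. permute_list \<pi> xs) ` {\<pi>. \<pi> permutes {..<e}} = arr i"
    proof
      show "(\<lambda>\<pi>. permute_list \<pi> xs) ` {\<pi>. \<pi> permutes {..<e}} \<subseteq> arr i"
        using xs by (auto simp: arrangements_def set_permute_list)
      show "arr i \<subseteq> (\<lambda>\<pi>. permute_list \<pi> xs) ` {\<pi>. \<pi> permutes {..<e}}"
      proof
        fix ys assume "ys \<in> arr i"
        then have "mset ys = mset xs" using arrD[OF i] X by (metis set_eq_iff_mset_eq_distinct)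
        then obtain \<pi> where "\<pi> permutes {..<length xs}" "permute_list \<pi> xs = ys"
          by (rule mset_eq_permutation)
        then show "ys \<in> (\<lambda>\<pi>. permute_list \<pi> xs) ` {\<pi>. \<pi> permutes {..<e}}" using X(1) by blast
      qed
    qed
    have "coef w h i xs
      = (\<Sum>ys\<in>arr i. (\<Prod>a<e. Q (u a) (put (\<lambda>_. 0) xs w (ys ! a))) * coef v h i ys)"
      using h True unfolding pure_span_def coef_def[of w] by simp
    also have "\<dots> = (\<Sum>\<pi> | \<pi> permutes {..<e}.
      (\<Prod>a<e. Q (u a) (put (\<lambda>_. 0) xs w (permute_list \<pi> xs ! a))) * coef v h i (permute_list \<pi> xs))"
      unfolding im[symmetric] by (simp add: sum.reindex[OF inj])
    also have "\<dots> = (\<Sum>\<pi> | \<pi> permutes {..<e}. scl (\<Prod>a<e. Q (u a) (w (\<pi> a))) (relabel \<pi> (coef v h)) i xs)"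
    proof (rule sum.cong[OF refl], clarify)
      fix \<pi> assume \<pi>: "\<pi> permutes {..<e}"
      have "(\<Prod>a<e. Q (u a) (put (\<lambda>_. 0) xs w (permute_list \<pi> xs ! a))) = (\<Prod>a<e. Q (u a) (w (\<pi> a)))"
        by (rule prod.cong[OF refl]) (use nth[OF \<pi>] X in simp)
      then show "(\<Prod>a<e. Q (u a) (put (\<lambda>_. 0) xs w (permute_list \<pi> xs ! a))) * coef v h i (permute_list \<pi> xs)
        = scl (\<Prod>a<e. Q (u a) (w (\<pi> a))) (relabel \<pi> (coef v h)) i xs"
        using X by (simp add: scl_def relabel_def)
    qed
    finally show ?thesis unfolding hs .
  next
    case False
    have "relabel \<pi> (coef v h) i xs = 0" if "\<pi> permutes {..<e}" for \<pi>
    proof -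
      have "length xs = e \<and> permute_list \<pi> xs \<in> arr i \<Longrightarrow> xs \<in> arr i"
        using that by (auto simp: arrangements_def)
      then show ?thesis using False by (auto simp: relabel_def coef_def)
    qed
    then have "(\<Sum>\<pi> | \<pi> permutes {..<e}. scl (\<Prod>a<e. Q (u a) (w (\<pi> a))) (relabel \<pi> (coef v h)) i xs) = 0"
      by (intro sum.neutral) (simp add: scl_def)
    moreover have "coef w h i xs = 0" using False by (simp only: coef_def if_False)
    ultimately show ?thesis unfolding hs by simp
  qed
qed

text \<open>Permutations are realised by the Lie algebra: a fresh system \<open>u'\<close> is
  substituted for \<open>u\<close>, and then \<open>u\<close> again, but matched with the
  \<open>v'\<close> in permuted order. The detour is forced, since inserting the \<open>v\<close>
  while pairing with the \<open>u\<close> would violate the orthogonality that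
  \<open>subst_all_pure\<close> asks for.\<close>

lemma relabel_coef:
  assumes hyp: "hyperbolic e u v" and N: "subm N" and h: "h \<in> pure_span u v" "h \<in> N"
    and \<pi>: "\<pi> permutes {..<e}"
  shows "relabel \<pi> (coef v h) \<in> coef v ` (pure_span u v \<inter> N)"
proof -
  let ?F = "u ` {..<e} \<union> v ` {..<e}"
  obtain u' v' where h': "hyperbolic e u' v'" "\<forall>a<e. \<forall>z\<in>?F. Q (u' a) z = 0 \<and> Q (v' a) z = 0"
    using hyperbolic_exists[of ?F] by blast
  have o: "Q (u' a) (u b) = 0" "Q (u' a) (v b) = 0" "Q (v' a) (u b) = 0" "Q (v' a) (v b) = 0"
    "Q (u b) (u' a) = 0" "Q (v b) (u' a) = 0" "Q (u b) (v' a) = 0" "Q (v b) (v' a) = 0"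
    if "a < e" "b < e" for a b
    using h'(2) that symmetric[of "u b"] symmetric[of "v b"] by auto
  let ?h1 = "subst_all u' v e h"
  let ?h2 = "subst_all u (v' \<circ> inv \<pi>) e ?h1"
  have hM: "h \<in> M" using h submD(1)[OF N] by blast
  have h1: "?h1 \<in> pure_span u' v'" "coef v' ?h1 = coef v h"
    using subst_all_pure[OF h'(1) hM, of v] pure_span_kills[OF h(1)] o by auto
  have h1M: "?h1 \<in> M" using h1 unfolding pure_span_def by blast
  have inv: "inv \<pi> a < e" if "a < e" for a
    using permutes_in_image[OF permutes_inv[OF \<pi>], of a] that by simp
  have h2: "?h2 \<in> pure_span u v" "coef v ?h2 = coef (v' \<circ> inv \<pi>) ?h1"
    using subst_all_pure[OF hyp h1M, of "v' \<circ> inv \<pi>"] pure_span_kills[OF h1(1)] o inv by auto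
  have "coef (v' \<circ> inv \<pi>) ?h1 i xs = relabel \<pi> (coef v' ?h1) i xs" for i xs
  proof (cases "i \<in> A \<and> xs \<in> arr i")
    case True
    then have i: "i \<in> A" and xs: "xs \<in> arr i" by auto
    note X = arrD[OF i xs]
    have p: "permute_list \<pi> xs \<in> arr i" using xs \<pi> by (auto simp: arrangements_def set_permute_list)
    have "put (\<lambda>_. 0) (permute_list \<pi> xs) v' = put (\<lambda>_. 0) xs (v' \<circ> inv \<pi>)"
    proof (rule put_eqI)
      show "distinct (permute_list \<pi> xs)" using X \<pi> by simp
      fix a assume a: "a < length (permute_list \<pi> xs)"
      then have "permute_list \<pi> xs ! a = xs ! \<pi> a" "\<pi> a < length xs"
        using \<pi> X permutes_in_image[OF \<pi>, of a] by (auto simp: permute_list_nth)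
      then show "put (\<lambda>_. 0) xs (v' \<circ> inv \<pi>) (permute_list \<pi> xs ! a) = v' a"
        using X permutes_inverses(2)[OF \<pi>] by simp
    next
      fix k assume "k \<notin> set (permute_list \<pi> xs)"
      then show "put (\<lambda>_. 0) xs (v' \<circ> inv \<pi>) k = 0" using \<pi> X by (simp add: set_permute_list)
    qed
    then show ?thesis using True p X by (simp add: coef_def relabel_def)
  next
    case False
    have "length xs = e \<and> permute_list \<pi> xs \<in> arr i \<Longrightarrow> xs \<in> arr i"
      using \<pi> by (auto simp: arrangements_def)
    then show ?thesis using False by (auto simp: relabel_def coef_def)
  qed
  then have "relabel \<pi> (coef v h) = coef v ?h2" using h2(2) h1(2) by (auto simp: fun_eq_iff)
  moreover have "?h2 \<in> N" using subst_all_in[OF N] h(2) by blast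
  ultimately show ?thesis using h2(1) by blast
qed

lemma stable_coef:
  assumes hyp: "hyperbolic e u v" and N: "subm N"
  shows "relabelling.stable (coef v ` (pure_span u v \<inter> N))"
  unfolding relabelling.stable_def
proof
  show "relabelling.subspace (coef v ` (pure_span u v \<inter> N))"
    unfolding relabelling.subspace_def
  proof (intro conjI ballI allI)
    show "0 \<in> coef v ` (pure_span u v \<inter> N)"
      using pure_span_closed(1) submD(2)[OF N] coef_zero by (metis IntI image_eqI)
    fix x y and c :: 'k
    assume x: "x \<in> coef v ` (pure_span u v \<inter> N)"
    then obtain f where f: "f \<in> pure_span u v" "f \<in> N" "x = coef v f" by blast
    then have "scl c x = coef v (scl c f)" by (simp add: coef_scl)
    then show "scl c x \<in> coef v ` (pure_span u v \<inter> N)"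
      using f pure_span_closed(3) submD(4)[OF N] by blast
    assume y: "y \<in> coef v ` (pure_span u v \<inter> N)"
    then obtain h where h: "h \<in> pure_span u v" "h \<in> N" "y = coef v h" by blast
    have "x + y = coef v (f + h)" using f h by (simp add: coef_add)
    then show "x + y \<in> coef v ` (pure_span u v \<inter> N)"
      using f h pure_span_closed(2) submD(3)[OF N] by blast
  qed
  show "\<forall>\<rho>\<in>relabels. \<rho> ` coef v ` (pure_span u v \<inter> N) \<subseteq> coef v ` (pure_span u v \<inter> N)"
    using relabel_coef[OF hyp N] unfolding relabels_def by blast
qed

text \<open>
  The coefficients at all test vectors \<open>w\<close> are considered simultaneously: an element of the Lie algebra
  moves \<open>w\<close> and nothing else, so that these conditions define a submodule.
\<close>

definition isotypic where "isotypic J = {f \<in> T. \<forall>w. coef w f \<in> J}"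

lemma coef_act:
  assumes f: "f \<in> M"
  shows "coef w (slot_act S X f) = - (\<Sum>a<e. coef (w(a := X (w a))) f)"
proof (intro ext)
  fix i xs
  have hs: "sum g I i xs = (\<Sum>x\<in>I. g x i xs)" for g :: "nat \<Rightarrow> 'i \<Rightarrow> nat list \<Rightarrow> 'k" and I
    by (induction I rule: infinite_finite_induct) auto
  show "coef w (slot_act S X f) i xs = (- (\<Sum>a<e. coef (w(a := X (w a))) f)) i xs"
  proof (cases "i \<in> A \<and> xs \<in> arr i")
    case True
    then have i: "i \<in> A" and xs: "xs \<in> arr i" by auto
    note X = arrD[OF i xs]
    let ?W = "put (\<lambda>_. 0) xs w"
    have "bij_betw ((!) xs) {..<e} (S i)" using X bij_betw_nth by blast
    then have "(\<Sum>k\<in>S i. f i (?W(k := X (?W k)))) = (\<Sum>a<e. f i (?W(xs ! a := X (?W (xs ! a)))))"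
      by (rule sum.reindex_bij_betw[symmetric])
    also have "\<dots> = (\<Sum>a<e. coef (w(a := X (w a))) f i xs)"
    proof (rule sum.cong[OF refl])
      fix a assume a: "a \<in> {..<e}"
      have "put (\<lambda>_. 0) xs (w(a := X (w a))) = ?W(xs ! a := X (?W (xs ! a)))"
        by (rule put_eqI) (use X a in \<open>auto simp: nth_eq_iff_index_eq\<close>)
      then show "f i (?W(xs ! a := X (?W (xs ! a)))) = coef (w(a := X (w a))) f i xs"
        using True by (simp add: coef_def)
    qed
    finally show ?thesis using True by (simp add: coef_def[of w] slot_act_def hs)
  next
    case False
    then have "coef w' h i xs = 0" for w' h by (simp only: coef_def if_False)
    then show ?thesis by (simp add: hs)
  qed
qed

lemma subm_isotypic:
  assumes "relabelling.stable J" shows "subm (isotypic J)"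
proof -
  have J: "relabelling.subspace J" using assms unfolding relabelling.stable_def by blast
  have TM: "T \<subseteq> M" by (rule submD(1)[OF T_subm])
  have "coef w (slot_act S X f) \<in> J" if "f \<in> M" "\<forall>w. coef w f \<in> J" for w X f
    unfolding coef_act[OF that(1)] using that(2)
    by (intro relabelling.subspace_neg[OF J] relabelling.subspace_sum[OF J]) auto
  then show ?thesis
    using T_subm TM relabelling.subspace_0[OF J] relabelling.subspace_add[OF J] relabelling.subspace_scale[OF J]
    unfolding submod_def FM_def isotypic_def
    by (auto simp: coef_add coef_scl coef_zero)
qed

lemma coef_stable:
  assumes J: "relabelling.stable J" and h: "h \<in> pure_span u v" "coef v h \<in> J"
  shows "coef w h \<in> J"
proof -
  have s: "relabelling.subspace J" and "\<forall>\<rho>\<in>relabels. \<rho> ` J \<subseteq> J"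
    using J unfolding relabelling.stable_def by auto
  then have r: "relabel \<pi> ` J \<subseteq> J" if "\<pi> permutes {..<e}" for \<pi>
    using that unfolding relabels_def by blast
  show ?thesis
    unfolding coef_expand[OF h(1), of w]
    by (intro relabelling.subspace_sum[OF s] relabelling.subspace_scale[OF s]) (use r h(2) in blast)
qed

text \<open>A nonzero submodule of \<open>isotypic J\<close> contains a nonzero pure family, so its
  pure coefficients form a nonzero stable subspace of \<open>J\<close>, which is all of
  \<open>J\<close>. Pure families are determined by their coefficients and generate, hence the
  submodule is everything.\<close>

lemma simple_isotypic:
  assumes hyp: "hyperbolic e u v" and J: "relabelling.stable J" "J \<noteq> {0}" "J \<subseteq> coef v ` (pure_span u v \<inter> T)"
    and irr: "\<And>J'. relabelling.stable J' \<Longrightarrow> J' \<subseteq> J \<Longrightarrow> J' = {0} \<or> J' = J"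
  shows "simple_submod (so_inf scale Q) FM (isotypic J)"
    and "J \<subseteq> coef v ` (pure_span u v \<inter> isotypic J)"
proof -
  note sI = subm_isotypic[OF J(1)]
  show JI: "J \<subseteq> coef v ` (pure_span u v \<inter> isotypic J)"
  proof
    fix c assume c: "c \<in> J"
    then obtain h where h: "h \<in> pure_span u v" "h \<in> T" "c = coef v h" using J(3) by blast
    then have "h \<in> isotypic J" unfolding isotypic_def using coef_stable[OF J(1) h(1)] c by blast
    then show "c \<in> coef v ` (pure_span u v \<inter> isotypic J)" using h by blast
  qed
  show "simple_submod (so_inf scale Q) FM (isotypic J)"
    unfolding simple_submod_def
  proof (intro conjI allI impI sI)
    have z: "zero FM = 0" by (simp add: FM_def)
    have "0 \<in> J" using J(1) relabelling.subspace_0 unfolding relabelling.stable_def by blast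
    then obtain c where c: "c \<in> J" "c \<noteq> 0" using J(2) by blast
    then obtain h where "h \<in> isotypic J" "c = coef v h" using JI by blast
    then have "h \<noteq> 0" using c coef_zero by metis
    then show "isotypic J \<noteq> {zero FM}" using \<open>h \<in> isotypic J\<close> z by auto
    fix N assume N: "subm N \<and> N \<subseteq> isotypic J"
    let ?C = "coef v ` (pure_span u v \<inter> N)"
    have sN: "subm N" using N by blast
    show "N = {zero FM} \<or> N = isotypic J"
    proof (cases "N = {0}")
      case True then show ?thesis using z by simp
    next
      case False
      then obtain f where f: "f \<in> N" "f \<noteq> 0" using submD(2)[OF sN] by blast
      have fT: "f \<in> T" using f N unfolding isotypic_def by blast
      have "subm {0}"
        unfolding submod_def FM_def using M_zero by (auto simp: scl_def slot_act_def fun_eq_iff)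
      \<comment> \<open>If \<open>N\<close> contained no nonzero pure family, all pure families
        obtained from \<open>f\<close> would be 0, and the zero submodule would contain
        \<open>f\<close>.\<close>
      have "\<exists>h. h \<in> pure_span u v \<and> h \<in> N \<and> h \<noteq> 0"
      proof (rule ccontr)
        assume *: "\<not> ?thesis"
        have "f \<in> {0}"
          by (rule generated_by_pure[OF fT \<open>subm {0}\<close> hyp]) (use * sN f in blast)
        then show False using f by simp
      qed
      then obtain h where h: "h \<in> pure_span u v" "h \<in> N" "h \<noteq> 0" by blast
      then have "coef v h \<noteq> coef v 0" using pure_span_inj pure_span_closed(1) by blast
      then have "?C \<noteq> {0}" using h coef_zero by auto
      moreover have "?C \<subseteq> J" using N unfolding isotypic_def by blast
      ultimately have C: "?C = J" using irr[OF stable_coef[OF hyp sN]] by blast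
      have "isotypic J \<subseteq> N"
      proof
        fix f assume f: "f \<in> isotypic J"
        then have fT: "f \<in> T" unfolding isotypic_def by blast
        show "f \<in> N"
        proof (rule generated_by_pure[OF fT sN hyp])
          fix h assume h: "h \<in> pure_span u v" "\<And>N'. subm N' \<Longrightarrow> f \<in> N' \<Longrightarrow> h \<in> N'"
          have "h \<in> isotypic J" using h(2)[OF sI f] .
          then have "coef v h \<in> ?C" unfolding C isotypic_def by blast
          then obtain h' where "h' \<in> pure_span u v" "h' \<in> N" "coef v h = coef v h'" by blast
          then show "h \<in> N" using pure_span_inj h(1) by blast
        qed
      qed
      then show ?thesis using N by blast
    qed
  qed
qed

text \<open>Maschke's argument compares dimensions and asks for a finite spanning set; the indicator
  functions of a member together with one of its arrangements provide it.\<close>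

lemma coef_finite_span:
  "\<exists>F. finite F \<and> range (coef v) \<subseteq> relabelling.span F"
proof -
  define \<delta> where "\<delta> = (\<lambda>(i :: 'i, xs :: nat list) j ys. if i = j \<and> xs = ys then 1 else 0 :: 'k)"
  let ?Z = "SIGMA i:A. arr i"
  have finZ: "finite ?Z" using finite_A finite_S finite_arrangements by blast
  have "coef v f \<in> relabelling.span (\<delta> ` ?Z)" for f
  proof -
    have "coef v f = (\<Sum>z\<in>?Z. scl (coef v f (fst z) (snd z)) (\<delta> z))"
    proof (intro ext)
      fix i xs
      have hs: "sum g I i xs = (\<Sum>x\<in>I. g x i xs)" for g :: "_ \<Rightarrow> 'i \<Rightarrow> nat list \<Rightarrow> 'k" and I :: "('i \<times> nat list) set"
        by (induction I rule: infinite_finite_induct) auto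
      have "(\<Sum>z\<in>?Z. scl (coef v f (fst z) (snd z)) (\<delta> z)) i xs
        = (\<Sum>z\<in>?Z. if z = (i, xs) then coef v f i xs else 0)"
        unfolding hs by (rule sum.cong[OF refl]) (auto simp: scl_def \<delta>_def split: if_splits)
      also have "\<dots> = (if (i, xs) \<in> ?Z then coef v f i xs else 0)"
        using finZ by (simp add: sum.delta)
      also have "\<dots> = coef v f i xs"
        by (simp add: coef_def)
      finally show "coef v f i xs = (\<Sum>z\<in>?Z. scl (coef v f (fst z) (snd z)) (\<delta> z)) i xs" ..
    qed
    moreover have "(\<Sum>z\<in>?Z. scl (coef v f (fst z) (snd z)) (\<delta> z)) \<in> relabelling.span (\<delta> ` ?Z)"
      by (intro relabelling.span_sum relabelling.span_scale relabelling.span_base) auto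
    ultimately show ?thesis by simp
  qed
  then show ?thesis using finZ by blast
qed

text \<open>If the pure coefficients of \<open>T \<inter> ?soc\<close> did not exhaust those of
  \<open>T\<close>, an irreducible \<open>J\<close> in a complement would give a simple submodule
  \<open>isotypic J\<close> inside \<open>T \<inter> ?soc\<close> with coefficients outside. So the
  pure families of both agree, and they generate \<open>T\<close>.\<close>

lemma T_subset_soc: "T \<subseteq> soc (so_inf scale Q) FM"
proof
  interpret L: lin_rep "so_inf scale Q" FM by (rule FM_lin_rep)
  let ?soc = "soc (so_inf scale Q) FM"
  fix f assume f: "f \<in> T"
  obtain u v where hyp: "hyperbolic e u v" using hyperbolic_exists[of "{}"] by blast
  let ?W = "coef v ` (pure_span u v \<inter> T)"
  define N where "N = T \<inter> ?soc"
  have sN: "subm N"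
    using T_subm L.submod_soc unfolding N_def submod_def by auto
  let ?U = "coef v ` (pure_span u v \<inter> N)"
  have "?U = ?W"
  proof (rule ccontr)
    assume ne: "?U \<noteq> ?W"
    have UW: "?U \<subset> ?W" using ne unfolding N_def by blast
    obtain F where F: "finite F" "range (coef v) \<subseteq> relabelling.span F" using coef_finite_span by blast
    have WF: "?W \<subseteq> relabelling.span F" using F by blast
    obtain J where J: "relabelling.stable J" "J \<subseteq> ?W" "J \<inter> ?U = {0}" "J \<noteq> {0}"
      "\<And>J'. relabelling.stable J' \<Longrightarrow> J' \<subseteq> J \<Longrightarrow> J' = {0} \<or> J' = J"
      using relabelling.maschke[OF stable_coef[OF hyp sN] stable_coef[OF hyp T_subm] UW WF F(1)] by blast
    note simp_J = simple_isotypic[OF hyp J(1,4,2,5)]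
    have "isotypic J \<subseteq> ?soc" by (rule L.simple_subset_soc[OF simp_J(1)])
    then have "isotypic J \<subseteq> N" unfolding N_def isotypic_def by blast
    then have "J \<subseteq> ?U" using simp_J(2) by blast
    then show False using J(3,4) by blast
  qed
  have "f \<in> N"
  proof (rule generated_by_pure[OF f sN hyp])
    fix h assume h: "h \<in> pure_span u v" "\<And>N'. subm N' \<Longrightarrow> f \<in> N' \<Longrightarrow> h \<in> N'"
    have "h \<in> T" using h(2)[OF T_subm f] .
    then have "coef v h \<in> ?U" unfolding \<open>?U = ?W\<close> using h(1) by blast
    then obtain h' where "h' \<in> pure_span u v" "h' \<in> N" "coef v h = coef v h'" by blast
    then show "h \<in> N" using pure_span_inj h(1) by blast
  qed
  then show "f \<in> ?soc" unfolding N_def by blast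
qed

text \<open>A simple submodule lies in \<open>T\<close> as soon as it meets \<open>T\<close> in a
  nonzero element. A nonzero value of \<open>f\<close> survives as a coefficient of the substituted
  family when the \<open>u a\<close> are orthogonal to the entries of \<open>f\<close>, to the test
  vectors and to the finite set from \<open>T_subst\<close>.\<close>

lemma soc_subset_T: "soc (so_inf scale Q) FM \<subseteq> T"
proof -
  interpret L: lin_rep "so_inf scale Q" FM by (rule FM_lin_rep)
  show ?thesis
  proof (rule L.soc_subset[OF T_subm])
    fix N assume N: "simple_submod (so_inf scale Q) FM N"
    then have sN: "subm N" and "N \<noteq> {0}" unfolding simple_submod_def by (auto simp: FM_def)
    then obtain f where f: "f \<in> N" "f \<noteq> 0" using submD(2)[OF sN] by blast
    have fM: "f \<in> M" using f submD(1)[OF sN] by blast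
    obtain i W where fi: "f i W \<noteq> 0" using f(2) by (auto simp: fun_eq_iff)
    have i: "i \<in> A" using M_outside[OF fM, of i W] fi by blast
    define xs where "xs = sorted_list_of_set (S i)"
    have xs: "xs \<in> arr i" unfolding xs_def arrangements_def using finite_S[OF i] card_S[OF i] by simp
    note X = arrD[OF i xs]
    define w where "w a = W (xs ! a)" for a
    have "put (\<lambda>_. 0) xs w k = W k" if "k \<in> S i" for k
      using arr_nth[OF i xs that] X by (metis put_nth w_def)
    then have "f i (put (\<lambda>_. 0) xs w) = f i W" by (rule M_local[OF fM i])
    then have cw: "coef w f i xs \<noteq> 0" using i xs fi by (simp add: coef_def)
    obtain B d where B: "dual_on B d" "\<forall>i\<in>A. \<forall>k\<in>S i. \<forall>W.
      f i W = (\<Sum>x\<in>B. Q x (W k) * f i (W(k := d x)))" using M_adapted[OF fM] by blast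
    have fB: "finite B" using B(1) by (simp add: dual_on_def)
    obtain F where F: "finite F" "\<forall>u w. (\<forall>a<e. \<forall>b<e. Q (u a) (u b) = 0 \<and> Q (u a) (w b) = 0) \<and>
        (\<forall>a<e. \<forall>z\<in>F. Q (u a) z = 0) \<longrightarrow> subst_all u w e f \<in> T"
      using T_subst[OF fM] by (elim exE conjE)
    obtain u v where hyp: "hyperbolic e u v"
      and o: "\<forall>a<e. \<forall>z\<in>F \<union> B \<union> w ` {..<e}. Q (u a) z = 0 \<and> Q (v a) z = 0"
      using hyperbolic_exists[of "F \<union> B \<union> w ` {..<e}" e] F(1) fB by blast
    let ?h = "subst_all u w e f"
    have "kills f (u a)" if "a < e" for a
      by (rule adapted_kills[OF B(2)]) (use that o symmetric[of "u a"] in auto)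
    then have "coef v ?h = coef w f" using o by (intro subst_all_pure(2)[OF hyp fM]) auto
    then have "?h \<noteq> 0" using cw coef_zero by (metis zero_fun_apply)
    moreover have "?h \<in> T"
      by (rule F(2)[THEN spec, THEN spec, THEN mp]) (use hyp o in \<open>simp add: hyperbolic_def\<close>)
    moreover have "?h \<in> N" by (rule subst_all_in[OF sN f(1)])
    moreover have "subm (N \<inter> T)" using sN T_subm unfolding submod_def by auto
    then have "N \<inter> T = {0} \<or> N \<inter> T = N"
      using N unfolding simple_submod_def by (metis Int_lower1 FM_def rep.select_convs(3))
    ultimately show "N \<subseteq> T" by blast
  qed
qed

lemma soc_FM: "soc (so_inf scale Q) FM = T"
  using T_subset_soc soc_subset_T by blast

end

section \<open>Contractions as multilinear functions\<close>

definition ev :: "('a \<Rightarrow> 'k::field) \<Rightarrow> ('a \<Rightarrow>\<^sub>0 'k) \<Rightarrow> 'k" where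
  "ev h p = (\<Sum>a\<in>Poly_Mapping.keys p. Poly_Mapping.lookup p a * h a)"

lemma ev_superset:
  assumes "finite Z" and "Poly_Mapping.keys p \<subseteq> Z"
  shows "ev h p = (\<Sum>a\<in>Z. Poly_Mapping.lookup p a * h a)"
  unfolding ev_def
  by (rule sum.mono_neutral_left) (use assms in \<open>auto simp: in_keys_iff\<close>)

lemma ev_cong: "(\<And>a. a \<in> Poly_Mapping.keys p \<Longrightarrow> h a = h' a) \<Longrightarrow> ev h p = ev h' p"
  unfolding ev_def by (rule sum.cong) auto

lemma ev_add: "ev h (p + q) = ev h p + ev h q"
proof -
  let ?Z = "Poly_Mapping.keys p \<union> Poly_Mapping.keys q"
  have "ev h (p + q) = (\<Sum>a\<in>?Z. Poly_Mapping.lookup (p + q) a * h a)"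
    by (rule ev_superset) (use keys_add[of p q] in auto)
  also have "\<dots> = ev h p + ev h q"
    using ev_superset[of ?Z p h] ev_superset[of ?Z q h]
    by (simp add: lookup_add distrib_right sum.distrib)
  finally show ?thesis .
qed

lemma lookup_fscale: "Poly_Mapping.lookup (fscale c p) a = c * Poly_Mapping.lookup p a"
  by (simp add: fscale_def map.rep_eq when_def)

lemma keys_fscale: "Poly_Mapping.keys (fscale c p) \<subseteq> Poly_Mapping.keys p"
  by (auto simp: in_keys_iff lookup_fscale)

lemma ev_fscale: "ev h (fscale c p) = c * ev h p"
  using ev_superset[OF _ keys_fscale, of p h c]
  by (simp add: ev_def lookup_fscale sum_distrib_left mult.assoc)

lemma ev_gen: "ev h (gen a) = h a"
  by (simp add: ev_def)

lemma ev_zero: "ev h 0 = 0"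
  by (simp add: ev_def)

lemma ev_sum: "ev h (sum f I) = (\<Sum>i\<in>I. ev h (f i))"
  by (induction I rule: infinite_finite_induct) (auto simp: ev_zero ev_add)

lemma ev_diff: "ev h (p - q) = ev h p - ev h q"
  using ev_add[of h "p - q" q] by simp

lemma ev_lin_ext: "ev h (lin_ext f p) = ev (\<lambda>a. ev h (f a)) p"
  by (simp add: lin_ext_def ev_sum ev_fscale ev_def[of _ p])

lemma ev_sum_fun: "ev (\<lambda>a. \<Sum>x\<in>I. c x * h x a) p = (\<Sum>x\<in>I. c x * ev (h x) p)"
proof -
  have "ev (\<lambda>a. \<Sum>x\<in>I. c x * h x a) p
    = (\<Sum>a\<in>Poly_Mapping.keys p. \<Sum>x\<in>I. c x * (Poly_Mapping.lookup p a * h x a))"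
    by (simp add: ev_def sum_distrib_left mult.left_commute)
  also have "\<dots> = (\<Sum>x\<in>I. \<Sum>a\<in>Poly_Mapping.keys p. c x * (Poly_Mapping.lookup p a * h x a))"
    by (rule sum.swap)
  finally show ?thesis by (simp add: ev_def sum_distrib_left)
qed

lemma ev_minus_fun: "ev (\<lambda>a. - h a) p = - ev h p"
  by (simp add: ev_def sum_negf)

lemma ev_mult_fun: "ev (\<lambda>a. c * h a) p = c * ev h p"
  by (simp add: ev_def sum_distrib_left mult.left_commute)

lemma ev_diff_fun: "ev (\<lambda>a. h a - h' a) p = ev h p - ev h' p"
  by (simp add: ev_def sum_subtractf right_diff_distrib)

lemma module_fscale: "module fscale"
  by unfold_locales (auto intro!: poly_mapping_eqI simp: lookup_fscale lookup_add algebra_simps)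

lemma lookup_lin_ext:
  "Poly_Mapping.lookup (lin_ext f p) b = ev (\<lambda>a. Poly_Mapping.lookup (f a) b) p"
  by (simp add: lin_ext_def ev_def lookup_sum lookup_fscale)

lemma lin_ext_add: "lin_ext f (p + q) = lin_ext f p + lin_ext f q"
  by (rule poly_mapping_eqI) (simp add: lookup_lin_ext lookup_add ev_add)

lemma keys_lin_ext:
  assumes "\<And>a. a \<in> Poly_Mapping.keys p \<Longrightarrow> Poly_Mapping.keys (f a) \<subseteq> Z"
  shows "Poly_Mapping.keys (lin_ext f p) \<subseteq> Z"
proof
  fix b assume b: "b \<in> Poly_Mapping.keys (lin_ext f p)"
  show "b \<in> Z"
  proof (rule ccontr)
    assume "b \<notin> Z"
    then have "Poly_Mapping.lookup (f a) b = 0" if "a \<in> Poly_Mapping.keys p" for a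
      using assms[OF that] by (auto simp: in_keys_iff)
    then have "Poly_Mapping.lookup (lin_ext f p) b = 0" by (simp add: lookup_lin_ext ev_def)
    then show False using b by (simp add: in_keys_iff)
  qed
qed

lemma keys_sum_subset:
  assumes "\<And>x. x \<in> I \<Longrightarrow> Poly_Mapping.keys (f x) \<subseteq> Z"
  shows "Poly_Mapping.keys (sum f I) \<subseteq> Z"
  using assms
proof (induction I rule: infinite_finite_induct)
  case (insert x I)
  then show ?case using keys_add[of "f x" "sum f I"] by fastforce
qed auto

section \<open>The free tensor space as a linear representation\<close>

lemma free_power_sel [simp]:
  "add (free_power d) = (+)" "zero (free_power d) = 0" "smult (free_power d) = fscale"
  "act (free_power d) = leibniz" "carr (free_power d) = {p. Poly_Mapping.keys p \<subseteq> {vs. length vs = d}}"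
  by (simp_all add: free_power_def)

lemma leibniz_in: "p \<in> carr (free_power d) \<Longrightarrow> leibniz X p \<in> carr (free_power d)"
proof -
  assume p: "p \<in> carr (free_power d)"
  have "Poly_Mapping.keys (leibniz X p) \<subseteq> {vs. length vs = d}"
    unfolding leibniz_def
    by (rule keys_lin_ext, rule keys_sum_subset) (use p in auto)
  then show ?thesis by simp
qed

lemma free_power_lin_rep: "lin_rep g (free_power d :: ('k::field, 'v \<Rightarrow> 'v, 'v list \<Rightarrow>\<^sub>0 'k) rep)"
proof
  show "x + y \<in> carr (free_power d)" if "x \<in> carr (free_power d)" "y \<in> carr (free_power d)"
    for x y :: "'v list \<Rightarrow>\<^sub>0 'k" using that keys_add[of x y] by auto
  show "smult (free_power d) c x \<in> carr (free_power d)" if "x \<in> carr (free_power d)"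
    for c :: 'k and x :: "'v list \<Rightarrow>\<^sub>0 'k" using that keys_fscale[of c x] by auto
  show "smult (free_power d) c (x + y) = smult (free_power d) c x + smult (free_power d) c y"
    for c :: 'k and x y :: "'v list \<Rightarrow>\<^sub>0 'k"
    by (auto intro!: poly_mapping_eqI simp: lookup_fscale lookup_add algebra_simps)
  show "smult (free_power d) (- 1) x = - x" for x :: "'v list \<Rightarrow>\<^sub>0 'k"
    by (auto intro!: poly_mapping_eqI simp: lookup_fscale)
  show "act (free_power d) X x \<in> carr (free_power d)" if "x \<in> carr (free_power d)"
    for X :: "'v \<Rightarrow> 'v" and x :: "'v list \<Rightarrow>\<^sub>0 'k" using leibniz_in[OF that] by simp
qed (auto simp: leibniz_def lin_ext_add)

text \<open>Pairs are 1-based while lists are indexed from 0, which explains the shift here and in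
  \<open>paired_slots\<close>.\<close>

definition free_slots :: "nat \<Rightarrow> (nat \<times> nat) list \<Rightarrow> nat set" where
  "free_slots d Is = {k. k < d \<and> k + 1 \<notin> fst ` set Is \<union> snd ` set Is}"

definition paired_slots :: "(nat \<times> nat) list \<Rightarrow> nat set" where
  "paired_slots Is = (\<lambda>i. i - 1) ` (fst ` set Is \<union> snd ` set Is)"

lemma finite_free_slots [simp]: "finite (free_slots d Is)"
  unfolding free_slots_def by simp

lemma finite_disjoint_pairs: "finite (disjoint_pairs d r)"
proof (rule finite_subset)
  show "disjoint_pairs d r \<subseteq> {Is. set Is \<subseteq> {..d} \<times> {..d} \<and> length Is = r}"
    unfolding disjoint_pairs_def by fastforce
  show "finite {Is. set Is \<subseteq> {..d} \<times> {..d} \<and> length Is = r}"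
    by (rule finite_lists_length_eq) simp
qed

lemma disjoint_pairsD:
  assumes "Is \<in> disjoint_pairs d r"
  shows "length Is = r" "\<And>i j. (i, j) \<in> set Is \<Longrightarrow> 1 \<le> i \<and> i < j \<and> j \<le> d"
    "distinct (map fst Is @ map snd Is)"
  using assms unfolding disjoint_pairs_def by auto

lemma slots_partition:
  assumes "Is \<in> disjoint_pairs d r"
  shows "paired_slots Is \<union> free_slots d Is = {..<d}" "paired_slots Is \<inter> free_slots d Is = {}"
    "card (paired_slots Is) = 2 * r"
proof -
  note D = disjoint_pairsD[OF assms]
  have ge: "1 \<le> i \<and> i \<le> d" if "i \<in> fst ` set Is \<union> snd ` set Is" for i
    using that D(2) by fastforce
  have mem: "k \<in> paired_slots Is \<longleftrightarrow> k + 1 \<in> fst ` set Is \<union> snd ` set Is" for k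
  proof
    assume "k \<in> paired_slots Is"
    then obtain i where i: "i \<in> fst ` set Is \<union> snd ` set Is" "k = i - 1" unfolding paired_slots_def by blast
    then have "k + 1 = i" using ge[OF i(1)] by simp
    then show "k + 1 \<in> fst ` set Is \<union> snd ` set Is" using i(1) by simp
  next
    assume "k + 1 \<in> fst ` set Is \<union> snd ` set Is"
    then have "(k + 1) - 1 \<in> paired_slots Is" unfolding paired_slots_def by blast
    then show "k \<in> paired_slots Is" by simp
  qed
  show "paired_slots Is \<union> free_slots d Is = {..<d}"
  proof -
    have "k < d" if "k + 1 \<in> fst ` set Is \<union> snd ` set Is" for k using ge[OF that] by simp
    then show ?thesis using mem by (auto simp: free_slots_def)
  qed
  show "paired_slots Is \<inter> free_slots d Is = {}"
    using mem by (auto simp: free_slots_def)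
  have "inj_on (\<lambda>i. i - 1) (fst ` set Is \<union> snd ` set Is)"
  proof (rule inj_onI)
    fix i j assume *: "i \<in> fst ` set Is \<union> snd ` set Is" "j \<in> fst ` set Is \<union> snd ` set Is" "i - 1 = j - 1"
    then show "i = j" using ge[OF *(1)] ge[OF *(2)] by linarith
  qed
  then have "card (paired_slots Is) = card (fst ` set Is \<union> snd ` set Is)"
    unfolding paired_slots_def by (rule card_image)
  also have "\<dots> = card (set (map fst Is @ map snd Is))" by simp
  also have "\<dots> = 2 * r" using distinct_card[OF D(3)] D(1) by simp
  finally show "card (paired_slots Is) = 2 * r" .
qed

lemma card_free_slots:
  assumes "Is \<in> disjoint_pairs d r" shows "card (free_slots d Is) + 2 * r = d"
proof -
  have "card (paired_slots Is \<union> free_slots d Is) = card (paired_slots Is) + card (free_slots d Is)"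
    by (rule card_Un_disjoint) (use slots_partition[OF assms] in \<open>auto simp: paired_slots_def\<close>)
  then show ?thesis using slots_partition[OF assms] by simp
qed

lemma disjoint_pairs_snoc:
  assumes "Is \<in> disjoint_pairs d r" and "k \<in> free_slots d Is" "l \<in> free_slots d Is" "k < l"
  shows "Is @ [(k + 1, l + 1)] \<in> disjoint_pairs d (Suc r)"
  using assms unfolding disjoint_pairs_def free_slots_def
  by (auto simp: image_iff)

lemma disjoint_pairs_snocD:
  assumes "Is @ [(i, j)] \<in> disjoint_pairs d (Suc r)"
  shows "Is \<in> disjoint_pairs d r" "i - 1 \<in> free_slots d Is" "j - 1 \<in> free_slots d Is" "i - 1 \<noteq> j - 1"
    "i = (i - 1) + 1" "j = (j - 1) + 1"
  using assms unfolding disjoint_pairs_def free_slots_def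
  by (auto simp: image_iff)

lemma free_slots_snoc: "free_slots d (Is @ [(k + 1, l + 1)]) = free_slots d Is - {k} - {l}"
  by (auto simp: free_slots_def)

context countable_quadratic_space
begin

definition pair_prod :: "(nat \<times> nat) list \<Rightarrow> (nat \<Rightarrow> 'v) \<Rightarrow> 'k" where
  "pair_prod Is v = (\<Prod>(i, j)\<leftarrow>Is. Q (v (i - 1)) (v (j - 1)))"

text \<open>
  The value at \<open>W\<close> of the contraction of \<open>v\<^sub>0 \<otimes> \<dots> \<otimes> v\<^sub>d\<^sub>-\<^sub>1\<close> along \<open>Is\<close>. The argument \<open>W\<close> is indexed by all slots of
  the original tensor, so that no renumbering is needed; its values at the contracted slots are irrelevant.
\<close>

definition contr_value :: "nat \<Rightarrow> (nat \<times> nat) list \<Rightarrow> (nat \<Rightarrow> 'v) \<Rightarrow> (nat \<Rightarrow> 'v) \<Rightarrow> 'k" where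
  "contr_value d Is v W = pair_prod Is v * (\<Prod>k\<in>free_slots d Is. Q (v k) (W k))"

text \<open>The value 0 at inadmissible \<open>Is\<close> makes \<open>theta d r p = 0\<close>
  equivalent to the vanishing of the genuine contractions, so that a single kernel stands for the
  intersection.\<close>

definition theta :: "nat \<Rightarrow> nat \<Rightarrow> ('v list \<Rightarrow>\<^sub>0 'k) \<Rightarrow> (nat \<times> nat) list \<Rightarrow> (nat \<Rightarrow> 'v) \<Rightarrow> 'k" where
  "theta d r p Is W = (if Is \<in> disjoint_pairs d r then ev (\<lambda>vs. contr_value d Is ((!) vs) W) p else 0)"

definition theta_ker :: "nat \<Rightarrow> nat \<Rightarrow> ('v list \<Rightarrow>\<^sub>0 'k) set" where
  "theta_ker d r = {p \<in> carr (free_power d). theta d r p = 0}"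

lemma theta_add: "theta d r (p + q) = theta d r p + theta d r q"
  and theta_diff: "theta d r (p - q) = theta d r p - theta d r q"
  and theta_fscale: "theta d r (fscale c p) = scl c (theta d r p)"
  and theta_zero: "theta d r 0 = 0"
  by (auto simp: theta_def fun_eq_iff ev_add ev_diff ev_fscale scl_def ev_zero)

lemma pair_prod_cong:
  assumes "\<And>k. k \<in> paired_slots Is \<Longrightarrow> v k = v' k" shows "pair_prod Is v = pair_prod Is v'"
proof -
  have "i - 1 \<in> paired_slots Is \<and> j - 1 \<in> paired_slots Is" if "(i, j) \<in> set Is" for i j
    unfolding paired_slots_def using that by force
  then have "map (\<lambda>(i, j). Q (v (i - 1)) (v (j - 1))) Is = map (\<lambda>(i, j). Q (v' (i - 1)) (v' (j - 1))) Is"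
    using assms by (intro map_cong[OF refl]) (auto split: prod.splits)
  then show ?thesis unfolding pair_prod_def by (rule arg_cong)
qed

text \<open>By the product rule each pair contributes \<open>Q (X u) v + Q u (X v)\<close>, which is
  0, times the remaining factors; distinctness ensures that a slot occurs in one factor
  only.\<close>

lemma pair_prod_derivation:
  assumes X: "\<And>u v. Q (X u) v + Q u (X v) = 0"
    and "distinct (map fst Is @ map snd Is)" and "\<And>i j. (i, j) \<in> set Is \<Longrightarrow> 1 \<le> i \<and> 1 \<le> j"
  shows "(\<Sum>k\<in>paired_slots Is. pair_prod Is (v(k := X (v k)))) = 0"
  using assms(2,3)
proof (induction Is)
  case Nil
  then show ?case by (simp add: paired_slots_def)
next
  case (Cons ij Is)
  obtain i j where ij: "ij = (i, j)" by force
  have one: "1 \<le> m" if "m \<in> fst ` set ((i, j) # Is) \<union> snd ` set ((i, j) # Is)" for m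
    using that Cons.prems(2) ij by fastforce
  have new: "i \<noteq> j" "i \<notin> fst ` set Is \<union> snd ` set Is" "j \<notin> fst ` set Is \<union> snd ` set Is"
    using Cons.prems(1) ij by auto
  have i1: "1 \<le> i" "1 \<le> j" using one by auto
  have notin: "m - 1 \<notin> paired_slots Is" if m: "m \<notin> fst ` set Is \<union> snd ` set Is" "1 \<le> m" for m
  proof
    assume "m - 1 \<in> paired_slots Is"
    then obtain n where n: "n \<in> fst ` set Is \<union> snd ` set Is" "m - 1 = n - 1"
      unfolding paired_slots_def by blast
    then have "1 \<le> n" using one[of n] by auto
    then have "m = n" using n(2) m(2) by simp
    then show False using n(1) m(1) by simp
  qed
  have i': "i - 1 \<noteq> j - 1" "i - 1 \<notin> paired_slots Is" "j - 1 \<notin> paired_slots Is"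
    using new(1) i1 notin new(2,3) by auto
  have P: "paired_slots (ij # Is) = insert (i - 1) (insert (j - 1) (paired_slots Is))"
    unfolding paired_slots_def ij by auto
  have fin: "finite (paired_slots Is)" unfolding paired_slots_def by simp
  have pp: "pair_prod (ij # Is) w = Q (w (i - 1)) (w (j - 1)) * pair_prod Is w" for w
    unfolding pair_prod_def ij by simp
  have c: "pair_prod Is (v(m := z)) = pair_prod Is v" if "m \<notin> paired_slots Is" for m z
    by (rule pair_prod_cong) (use that in auto)
  have IH: "(\<Sum>k\<in>paired_slots Is. pair_prod Is (v(k := X (v k)))) = 0"
    by (rule Cons.IH) (use Cons.prems in auto)
  have "(\<Sum>k\<in>paired_slots Is. pair_prod (ij # Is) (v(k := X (v k))))
    = (\<Sum>k\<in>paired_slots Is. Q (v (i - 1)) (v (j - 1)) * pair_prod Is (v(k := X (v k))))"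
    by (rule sum.cong[OF refl]) (use i' in \<open>auto simp: pp\<close>)
  also have "\<dots> = 0" unfolding sum_distrib_left[symmetric] IH by simp
  finally have "(\<Sum>k\<in>paired_slots (ij # Is). pair_prod (ij # Is) (v(k := X (v k))))
    = (Q (X (v (i - 1))) (v (j - 1)) + Q (v (i - 1)) (X (v (j - 1)))) * pair_prod Is v"
    unfolding P using i' fin by (simp add: pp c distrib_right)
  then show ?case unfolding X mult_zero_left .
qed

lemma contr_value_slot:
  assumes "k \<in> free_slots d Is"
  shows "contr_value d Is v (W(k := z))
    = Q (v k) z * (pair_prod Is v * (\<Prod>m\<in>free_slots d Is - {k}. Q (v m) (W m)))"
proof -
  have "(\<Prod>m\<in>free_slots d Is. Q (v m) ((W(k := z)) m))
    = Q (v k) z * (\<Prod>m\<in>free_slots d Is - {k}. Q (v m) ((W(k := z)) m))"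
    using assms by (subst prod.remove[of _ k]) auto
  also have "(\<Prod>m\<in>free_slots d Is - {k}. Q (v m) ((W(k := z)) m)) = (\<Prod>m\<in>free_slots d Is - {k}. Q (v m) (W m))"
    by (rule prod.cong) auto
  finally show ?thesis unfolding contr_value_def by simp
qed

lemma contr_value_slot':
  assumes "k \<in> free_slots d Is"
  shows "contr_value d Is v W
    = Q (v k) (W k) * (pair_prod Is v * (\<Prod>m\<in>free_slots d Is - {k}. Q (v m) (W m)))"
  using contr_value_slot[OF assms, of v W "W k"] by simp

text \<open>Contributions of the paired slots cancel by invariance of the form, and in a free slot
  skewness moves \<open>X\<close> onto the test vector. This is what makes \<open>theta\<close>
  equivariant.\<close>

lemma contr_value_derivation:
  assumes X: "\<And>u v. Q (X u) v + Q u (X v) = 0" and Is: "Is \<in> disjoint_pairs d r"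
  shows "(\<Sum>k<d. contr_value d Is (v(k := X (v k))) W)
    = - (\<Sum>k\<in>free_slots d Is. contr_value d Is v (W(k := X (W k))))"
proof -
  note sp = slots_partition[OF Is] and D = disjoint_pairsD[OF Is]
  have "(\<Sum>k<d. contr_value d Is (v(k := X (v k))) W)
    = (\<Sum>k\<in>paired_slots Is. contr_value d Is (v(k := X (v k))) W)
      + (\<Sum>k\<in>free_slots d Is. contr_value d Is (v(k := X (v k))) W)"
    unfolding sp(1)[symmetric] by (rule sum.union_disjoint) (use sp in \<open>auto simp: paired_slots_def\<close>)
  also have "(\<Sum>k\<in>paired_slots Is. contr_value d Is (v(k := X (v k))) W)
    = (\<Sum>k\<in>paired_slots Is. pair_prod Is (v(k := X (v k))) * (\<Prod>m\<in>free_slots d Is. Q (v m) (W m)))"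
  proof (rule sum.cong[OF refl])
    fix k assume "k \<in> paired_slots Is"
    then have "(\<Prod>m\<in>free_slots d Is. Q ((v(k := X (v k))) m) (W m)) = (\<Prod>m\<in>free_slots d Is. Q (v m) (W m))"
      using sp(2) by (intro prod.cong) auto
    then show "contr_value d Is (v(k := X (v k))) W
      = pair_prod Is (v(k := X (v k))) * (\<Prod>m\<in>free_slots d Is. Q (v m) (W m))"
      unfolding contr_value_def by simp
  qed
  also have "\<dots> = 0"
  proof -
    have "1 \<le> i \<and> 1 \<le> j" if "(i, j) \<in> set Is" for i j using D(2)[OF that] by simp
    then show ?thesis
      unfolding sum_distrib_right[symmetric] using pair_prod_derivation[OF X D(3)] by simp
  qed
  also have "(\<Sum>k\<in>free_slots d Is. contr_value d Is (v(k := X (v k))) W)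
    = (\<Sum>k\<in>free_slots d Is. - contr_value d Is v (W(k := X (W k))))"
  proof (rule sum.cong[OF refl])
    fix k assume k: "k \<in> free_slots d Is"
    have "pair_prod Is (v(k := X (v k))) = pair_prod Is v"
      by (rule pair_prod_cong) (use k sp(2) in auto)
    moreover have "(\<Prod>m\<in>free_slots d Is - {k}. Q ((v(k := X (v k))) m) (W m))
      = (\<Prod>m\<in>free_slots d Is - {k}. Q (v m) (W m))"
      by (rule prod.cong) auto
    moreover have "Q (X (v k)) (W k) = - Q (v k) (X (W k))"
      using X[of "v k" "W k"] by (simp add: eq_neg_iff_add_eq_0)
    ultimately show "contr_value d Is (v(k := X (v k))) W = - contr_value d Is v (W(k := X (W k)))"
      unfolding contr_value_slot[OF k] contr_value_slot'[OF k] by simp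
  qed
  finally show ?thesis by (simp only: sum_negf add_0_left)
qed

lemma theta_leibniz:
  assumes X: "X \<in> so_inf scale Q" and p: "p \<in> carr (free_power d)"
  shows "theta d r (leibniz X p) = slot_act (free_slots d) X (theta d r p)"
proof (intro ext)
  fix Is W
  show "theta d r (leibniz X p) Is W = slot_act (free_slots d) X (theta d r p) Is W"
  proof (cases "Is \<in> disjoint_pairs d r")
    case True
    have XQ: "Q (X u) v + Q u (X v) = 0" for u v using X unfolding so_inf_def by blast
    have "theta d r (leibniz X p) Is W
      = ev (\<lambda>vs. \<Sum>k<length vs. contr_value d Is ((!) (vs[k := X (vs ! k)])) W) p"
      using True unfolding theta_def leibniz_def by (simp add: ev_lin_ext ev_sum ev_gen)
    also have "\<dots> = ev (\<lambda>vs. - (\<Sum>k\<in>free_slots d Is. 1 * contr_value d Is ((!) vs) (W(k := X (W k))))) p"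
    proof (rule ev_cong)
      fix vs assume "vs \<in> Poly_Mapping.keys p"
      then have len: "length vs = d" using p by auto
      have "(\<Sum>k<length vs. contr_value d Is ((!) (vs[k := X (vs ! k)])) W)
        = (\<Sum>k<d. contr_value d Is (((!) vs)(k := X (vs ! k))) W)"
      proof (rule sum.cong)
        fix k assume "k \<in> {..<d}"
        then have "(!) (vs[k := X (vs ! k)]) = ((!) vs)(k := X (vs ! k))"
          using len by (auto simp: fun_eq_iff nth_list_update)
        then show "contr_value d Is ((!) (vs[k := X (vs ! k)])) W
          = contr_value d Is (((!) vs)(k := X (vs ! k))) W" by simp
      qed (simp add: len)
      then show "(\<Sum>k<length vs. contr_value d Is ((!) (vs[k := X (vs ! k)])) W)
        = - (\<Sum>k\<in>free_slots d Is. 1 * contr_value d Is ((!) vs) (W(k := X (W k))))"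
        using contr_value_derivation[OF XQ True, of "(!) vs" W] by simp
    qed
    also have "\<dots> = slot_act (free_slots d) X (theta d r p) Is W"
      using True unfolding ev_minus_fun ev_sum_fun slot_act_def theta_def by simp
    finally show ?thesis .
  next
    case False
    then show ?thesis by (simp add: theta_def slot_act_def)
  qed
qed

section \<open>Finite expansions and traces of contractions\<close>

definition entries :: "('v list \<Rightarrow>\<^sub>0 'k) \<Rightarrow> 'v set" where
  "entries p = (\<Union>vs\<in>Poly_Mapping.keys p. set vs)"

lemma finite_entries: "finite (entries p)"
  unfolding entries_def by simp

lemma nth_entries: "vs \<in> Poly_Mapping.keys p \<Longrightarrow> k < length vs \<Longrightarrow> vs ! k \<in> entries p"
  unfolding entries_def using nth_mem by blast

lemma entries_dual: "\<exists>B d'. dual_on B d' \<and> entries p \<subseteq> span B"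
  using dual_on_spanning[OF finite_entries] by blast

lemma theta_adapted:
  assumes p: "p \<in> carr (free_power d)" and B: "dual_on B d'" "entries p \<subseteq> span B"
    and Is: "Is \<in> disjoint_pairs d r" and k: "k \<in> free_slots d Is"
  shows "theta d r p Is W = (\<Sum>x\<in>B. Q x (W k) * theta d r p Is (W(k := d' x)))"
proof -
  have "ev (\<lambda>vs. contr_value d Is ((!) vs) W) p
    = ev (\<lambda>vs. \<Sum>x\<in>B. Q x (W k) * contr_value d Is ((!) vs) (W(k := d' x))) p"
  proof (rule ev_cong)
    fix vs assume vs: "vs \<in> Poly_Mapping.keys p"
    then have "k < length vs" using p k by (auto simp: free_slots_def)
    then have "vs ! k \<in> entries p" by (rule nth_entries[OF vs])
    then have e: "vs ! k = (\<Sum>x\<in>B. scale (Q (vs ! k) (d' x)) x)" by (intro dual_expand[OF B(1)]) (use B in blast)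
    have "Q (vs ! k) (W k) = (\<Sum>x\<in>B. Q x (W k) * Q (vs ! k) (d' x))"
      by (subst (1) e) (simp add: Q_sum_left Q_scale_left mult.commute)
    then show "contr_value d Is ((!) vs) W = (\<Sum>x\<in>B. Q x (W k) * contr_value d Is ((!) vs) (W(k := d' x)))"
      unfolding contr_value_slot[OF k] contr_value_slot'[OF k, of _ W]
      by (simp add: sum_distrib_right mult.assoc)
  qed
  then show ?thesis using Is by (simp add: theta_def ev_sum_fun)
qed

text \<open>Expanding the entry of slot \<open>k\<close> in \<open>B\<close> turns the sum over dual
  vectors into \<open>Q\<close> of the two entries, that is, into one more contraction. A pair is
  listed in increasing order while \<open>k\<close> and \<open>l\<close> come in any order, hence
  the choice between two extended lists.\<close>

lemma theta_trace:
  assumes p: "p \<in> carr (free_power d)" and B: "dual_on B d'" "entries p \<subseteq> span B"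
    and Is: "Is \<in> disjoint_pairs d r" and k: "k \<in> free_slots d Is" and l: "l \<in> free_slots d Is"
    and kl: "k \<noteq> l" and ex: "Is @ [(k + 1, l + 1)] \<in> disjoint_pairs d (Suc r) \<or>
      Is @ [(l + 1, k + 1)] \<in> disjoint_pairs d (Suc r)" (is "?A \<in> _ \<or> ?B \<in> _")
  shows "(\<Sum>x\<in>B. theta d r p Is (W(l := x, k := d' x)))
    = theta d (Suc r) p (if ?A \<in> disjoint_pairs d (Suc r) then ?A else ?B) W"
proof -
  have main: "ev (\<lambda>vs. \<Sum>x\<in>B. 1 * contr_value d Is ((!) vs) (W(l := x, k := d' x))) p
    = ev (\<lambda>vs. contr_value d C ((!) vs) W) p" if C: "C = ?A \<or> C = ?B" for C
  proof (rule ev_cong)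
    fix vs assume vs: "vs \<in> Poly_Mapping.keys p"
    then have "k < length vs" using p k by (auto simp: free_slots_def)
    then have "vs ! k \<in> entries p" by (rule nth_entries[OF vs])
    then have e: "vs ! k = (\<Sum>x\<in>B. scale (Q (vs ! k) (d' x)) x)" by (intro dual_expand[OF B(1)]) (use B in blast)
    let ?R = "\<Prod>m\<in>free_slots d Is - {k} - {l}. Q (vs ! m) (W m)"
    have "contr_value d Is ((!) vs) (W(l := x, k := d' x))
      = Q (vs ! k) (d' x) * Q (vs ! l) x * (pair_prod Is ((!) vs) * ?R)" for x
    proof -
      have "(\<Prod>m\<in>free_slots d Is - {k}. Q (vs ! m) ((W(l := x)) m)) = Q (vs ! l) x * ?R"
        using l kl by (subst prod.remove[of _ l]) auto
      then show ?thesis unfolding contr_value_slot[OF k] by simp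
    qed
    then have "(\<Sum>x\<in>B. 1 * contr_value d Is ((!) vs) (W(l := x, k := d' x)))
      = (\<Sum>x\<in>B. Q (vs ! k) (d' x) * Q (vs ! l) x) * (pair_prod Is ((!) vs) * ?R)"
      by (simp add: sum_distrib_right)
    also have "(\<Sum>x\<in>B. Q (vs ! k) (d' x) * Q (vs ! l) x) = Q (vs ! l) (vs ! k)"
      using arg_cong[OF e, of "Q (vs ! l)"] by (simp add: Q_sum_right Q_scale_right)
    also have "Q (vs ! l) (vs ! k) * (pair_prod Is ((!) vs) * ?R) = contr_value d C ((!) vs) W"
    proof -
      have "free_slots d C = free_slots d Is - {k} - {l}"
        using C free_slots_snoc[of d Is k l] free_slots_snoc[of d Is l k] by auto
      moreover have "pair_prod C ((!) vs) = pair_prod Is ((!) vs) * Q (vs ! l) (vs ! k)"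
        using C symmetric[of "vs ! k" "vs ! l"] by (auto simp: pair_prod_def)
      ultimately show ?thesis unfolding contr_value_def by simp
    qed
    finally show "(\<Sum>x\<in>B. 1 * contr_value d Is ((!) vs) (W(l := x, k := d' x))) = contr_value d C ((!) vs) W" .
  qed
  have "(\<Sum>x\<in>B. theta d r p Is (W(l := x, k := d' x)))
    = ev (\<lambda>vs. \<Sum>x\<in>B. 1 * contr_value d Is ((!) vs) (W(l := x, k := d' x))) p"
    using Is unfolding theta_def ev_sum_fun by simp
  then show ?thesis using main[of ?A] main[of ?B] ex by (auto simp: theta_def)
qed

text \<open>Dropping the last pair exhibits every contraction along \<open>r + 1\<close> pairs as a
  trace of one along \<open>r\<close> pairs.\<close>

lemma theta_ker_mono: "theta_ker d r \<subseteq> theta_ker d (Suc r)"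
proof
  fix p assume p: "p \<in> theta_ker d r"
  then have pc: "p \<in> carr (free_power d)" and p0: "theta d r p = 0" unfolding theta_ker_def by auto
  obtain B d' where B: "dual_on B d'" "entries p \<subseteq> span B" using entries_dual by blast
  have "theta d (Suc r) p Is W = 0" for Is W
  proof (cases "Is \<in> disjoint_pairs d (Suc r)")
    case True
    then have "Is \<noteq> []" using disjoint_pairsD(1) by fastforce
    then obtain Is' i j where Is: "Is = Is' @ [(i, j)]" by (metis rev_exhaust surj_pair)
    note D = disjoint_pairs_snocD[OF True[unfolded Is]]
    have "(\<Sum>x\<in>B. theta d r p Is' (W(j - 1 := x, i - 1 := d' x))) = theta d (Suc r) p Is W"
      using theta_trace[OF pc B D(1-4), of W] True D(5,6) unfolding Is by simp
    then show ?thesis using p0 by simp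
  next
    case False
    then show ?thesis by (simp add: theta_def)
  qed
  then show "p \<in> theta_ker d (Suc r)" using pc unfolding theta_ker_def by (auto simp: fun_eq_iff)
qed

lemma submod_theta_ker: "submod (so_inf scale Q) (free_power d) (theta_ker d r)"
proof -
  interpret lin_rep "so_inf scale Q" "free_power d :: ('k, 'v \<Rightarrow> 'v, 'v list \<Rightarrow>\<^sub>0 'k) rep"
    by (rule free_power_lin_rep)
  have z: "scl c (0 :: (nat \<times> nat) list \<Rightarrow> (nat \<Rightarrow> 'v) \<Rightarrow> 'k) = 0"
    "slot_act S X (0 :: (nat \<times> nat) list \<Rightarrow> (nat \<Rightarrow> 'v) \<Rightarrow> 'k) = 0" for c S and X :: "'v \<Rightarrow> 'v"
    by (auto simp: scl_def slot_act_def fun_eq_iff)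
  show ?thesis
    unfolding submod_def theta_ker_def
    using add_in smult_in act_in zero_in
    by (simp del: free_power_sel(5) add: theta_add theta_fscale theta_leibniz theta_zero z subset_iff)
qed

lemma tensor_family_theta:
  "tensor_family scale Q (disjoint_pairs d r) (free_slots d) (theta d r ` carr (free_power d))"
proof unfold_locales
  interpret lin_rep "so_inf scale Q" "free_power d :: ('k, 'v \<Rightarrow> 'v, 'v list \<Rightarrow>\<^sub>0 'k) rep"
    by (rule free_power_lin_rep)
  let ?M = "theta d r ` carr (free_power d)"
  show "finite (disjoint_pairs d r)" by (rule finite_disjoint_pairs)
  show "finite (free_slots d i)" for i by simp
  show "0 \<in> ?M" using zero_in theta_zero by (metis image_eqI)
  show "f + h \<in> ?M" if fh: "f \<in> ?M" "h \<in> ?M" for f h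
  proof -
    obtain p q where "p \<in> carr (free_power d)" "f = theta d r p" "q \<in> carr (free_power d)" "h = theta d r q"
      using fh by blast
    then show ?thesis using add_in theta_add by (metis image_eqI)
  qed
  show "scl c f \<in> ?M" if f: "f \<in> ?M" for c f
  proof -
    obtain p where "p \<in> carr (free_power d)" "f = theta d r p" using f by blast
    then show ?thesis using smult_in[of p c] theta_fscale[of d r c p] by (metis free_power_sel(3) image_eqI)
  qed
  show "slot_act (free_slots d) X f \<in> ?M" if f: "X \<in> so_inf scale Q" "f \<in> ?M" for X f
  proof -
    obtain p where "p \<in> carr (free_power d)" "f = theta d r p" using f by blast
    then show ?thesis using leibniz_in[of p d X] theta_leibniz[OF f(1), of p d r] by (metis image_eqI)
  qed
  show "f i W = 0" if "f \<in> ?M" "i \<notin> disjoint_pairs d r" for f i W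
    using that by (auto simp: theta_def)
  show "f i W = f i W'" if f: "f \<in> ?M" "i \<in> disjoint_pairs d r" "\<And>k. k \<in> free_slots d i \<Longrightarrow> W k = W' k"
    for f i W W'
  proof -
    have "contr_value d i v W = contr_value d i v W'" for v
      unfolding contr_value_def using that(3) by simp
    then show ?thesis using f(1,2) by (auto simp: theta_def)
  qed
  show "f i (W(k := scale a x - scale b y)) = a * f i (W(k := x)) - b * f i (W(k := y))"
    if f: "f \<in> ?M" "i \<in> disjoint_pairs d r" "k \<in> free_slots d i" for f i k W a x b y
  proof -
    obtain p where p: "p \<in> carr (free_power d)" "f = theta d r p" using f by blast
    have "contr_value d i v (W(k := scale a x - scale b y))
      = a * contr_value d i v (W(k := x)) - b * contr_value d i v (W(k := y))" for v
      unfolding contr_value_slot[OF f(3)] by (simp add: Q_simps algebra_simps)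
    then show ?thesis using f(2) by (simp add: p(2) theta_def ev_diff_fun ev_mult_fun)
  qed
  show "\<exists>B d'. dual_on B d' \<and> (\<forall>i\<in>disjoint_pairs d r. \<forall>k\<in>free_slots d i. \<forall>W.
      f i W = (\<Sum>x\<in>B. Q x (W k) * f i (W(k := d' x))))" if f: "f \<in> ?M" for f
  proof -
    obtain p where p: "p \<in> carr (free_power d)" "f = theta d r p" using f by blast
    obtain B d' where B: "dual_on B d'" "entries p \<subseteq> span B" using entries_dual by blast
    show ?thesis using theta_adapted[OF p(1) B] B(1) unfolding p(2) by blast
  qed
qed

text \<open>For the last axiom, the same substitutions are run at level \<open>r\<close> and at
  level \<open>r + 1\<close>. The higher level has two slots fewer than there are substitutions, so
  that its result is 0.\<close>

lemma traceless_family_theta: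
  "traceless_family scale Q (disjoint_pairs d r) (free_slots d) (theta d r ` carr (free_power d))
     (d - 2 * r) (theta d r ` theta_ker d (Suc r))"
proof -
  interpret R: tensor_family scale Q "disjoint_pairs d r" "free_slots d" "theta d r ` carr (free_power d)"
    by (rule tensor_family_theta)
  interpret R': tensor_family scale Q "disjoint_pairs d (Suc r)" "free_slots d"
      "theta d (Suc r) ` carr (free_power d)"
    by (rule tensor_family_theta)
  interpret lin_rep "so_inf scale Q" "free_power d :: ('k, 'v \<Rightarrow> 'v, 'v list \<Rightarrow>\<^sub>0 'k) rep"
    by (rule free_power_lin_rep)
  have epi: "epi (theta d r) R.FM"
    unfolding epi_def R.FM_def
    by (simp del: free_power_sel(5) add: theta_add theta_zero theta_fscale theta_leibniz)
  show ?thesis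
  proof unfold_locales
    show "card (free_slots d i) = d - 2 * r" if "i \<in> disjoint_pairs d r" for i
      using card_free_slots[OF that] by simp
    show "R.subm (theta d r ` theta_ker d (Suc r))"
      by (rule submod_image[OF epi submod_theta_ker])
    show "\<exists>B d'. dual_on B d' \<and> (\<forall>i\<in>disjoint_pairs d r. \<forall>k\<in>free_slots d i. \<forall>W.
        f i W = (\<Sum>x\<in>B. Q x (W k) * f i (W(k := d' x)))) \<and> R.no_trace B (\<lambda>x. x) d' f"
      if f: "f \<in> theta d r ` theta_ker d (Suc r)" for f
    proof -
      obtain p where p: "p \<in> carr (free_power d)" "f = theta d r p" "theta d (Suc r) p = 0"
        using f unfolding theta_ker_def by blast
      obtain B d' where B: "dual_on B d'" "entries p \<subseteq> span B" using entries_dual by blast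
      have "R.no_trace B (\<lambda>x. x) d' f"
        unfolding R.no_trace_def
      proof (intro ballI allI impI)
        fix i k l W assume *: "i \<in> disjoint_pairs d r" "k \<in> free_slots d i" "l \<in> free_slots d i" "k \<noteq> l"
        have "i @ [(k + 1, l + 1)] \<in> disjoint_pairs d (Suc r) \<or> i @ [(l + 1, k + 1)] \<in> disjoint_pairs d (Suc r)"
          using * disjoint_pairs_snoc[of i d r k l] disjoint_pairs_snoc[of i d r l k] by linarith
        from theta_trace[OF p(1) B * this, of W] show "(\<Sum>x\<in>B. f i (W(l := x, k := d' x))) = 0"
          unfolding p by simp
      qed
      then show ?thesis using theta_adapted[OF p(1) B] B(1) unfolding p(2) by blast
    qed
    show "\<exists>F. finite F \<and> (\<forall>u w.
        (\<forall>a<d - 2 * r. \<forall>b<d - 2 * r. Q (u a) (u b) = 0 \<and> Q (u a) (w b) = 0) \<and>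
        (\<forall>a<d - 2 * r. \<forall>z\<in>F. Q (u a) z = 0) \<longrightarrow> R.subst_all u w (d - 2 * r) f \<in> theta d r ` theta_ker d (Suc r))"
      if f: "f \<in> theta d r ` carr (free_power d)" for f
    proof -
      obtain p where p: "p \<in> carr (free_power d)" "f = theta d r p" using f by blast
      let ?e = "d - 2 * r"
      have "R.subst_all u w ?e f \<in> theta d r ` theta_ker d (Suc r)"
        if uw: "\<And>a b. a < ?e \<Longrightarrow> b < ?e \<Longrightarrow> Q (u a) (u b) = 0" "\<And>a b. a < ?e \<Longrightarrow> b < ?e \<Longrightarrow> Q (u a) (w b) = 0"
          and o: "\<And>a z. a < ?e \<Longrightarrow> z \<in> entries p \<Longrightarrow> Q (u a) z = 0" for u w
      proof -
        \<comment> \<open>One tensor \<open>q\<close> has to represent both results: its image at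
          level \<open>r\<close> is the family in question, and its vanishing at level
          \<open>r + 1\<close> puts that family into the traceless ones.\<close>
        have "\<exists>q\<in>carr (free_power d). R.subst_all u w m f = theta d r q
            \<and> R'.subst_all u w m (theta d (Suc r) p) = theta d (Suc r) q" for m
        proof (induction m)
          case 0
          then show ?case using p by auto
        next
          case (Suc m)
          then obtain q where q: "q \<in> carr (free_power d)" "R.subst_all u w m f = theta d r q"
            "R'.subst_all u w m (theta d (Suc r) p) = theta d (Suc r) q" by blast
          show ?case
            using q theta_leibniz[OF wedge_so q(1)] leibniz_in[OF q(1)]
            by (intro bexI[of _ "leibniz (wedge (u m) (w m)) q"]) auto
        qed
        then obtain q where q: "q \<in> carr (free_power d)" "R.subst_all u w ?e f = theta d r q"
            "R'.subst_all u w ?e (theta d (Suc r) p) = theta d (Suc r) q" by blast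
        have k: "R'.kills (theta d (Suc r) p) (u a)" if a: "a < ?e" for a
          unfolding R'.kills_def
        proof (intro ballI allI)
          fix i k W assume *: "i \<in> disjoint_pairs d (Suc r)" "k \<in> free_slots d i"
          have "contr_value d i ((!) vs) (W(k := u a)) = 0" if vs: "vs \<in> Poly_Mapping.keys p" for vs
          proof -
            have "k < length vs" using p vs * by (auto simp: free_slots_def)
            then have "vs ! k \<in> entries p" by (rule nth_entries[OF vs])
            then have "Q (vs ! k) (u a) = 0" using o[OF a] symmetric[of "u a"] by metis
            then show ?thesis unfolding contr_value_slot[OF *(2)] by simp
          qed
          then show "theta d (Suc r) p i (W(k := u a)) = 0" by (simp add: theta_def ev_def)
        qed
        have "theta d (Suc r) q i W = 0" for i W
        proof (cases "i \<in> disjoint_pairs d (Suc r)")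
          case True
          \<comment> \<open>A collection of \<open>r + 1\<close> pairs leaves
            \<open>d - 2 * r - 2\<close> slots for \<open>d - 2 * r\<close> substitutions.\<close>
          have "arrangements (free_slots d i) ?e = {}"
            by (rule arrangements_empty) (use card_free_slots[OF True] in auto)
          then show ?thesis
            unfolding q(3)[symmetric]
            using R'.subst_all_formula[where w = w and W = W, OF _ k uw order_refl True] p(1) by simp
        next
          case False
          then show ?thesis by (simp add: theta_def)
        qed
        then have "q \<in> theta_ker d (Suc r)" using q(1) unfolding theta_ker_def by (auto simp: fun_eq_iff)
        then show ?thesis using q(2) by blast
      qed
      then show ?thesis by (intro exI[of _ "entries p"]) (simp add: finite_entries)
    qed
  qed
qed

text \<open>The inductive step of the filtration. \<open>theta d r\<close> is another presentation
  with the kernel of \<open>\<phi>\<close>, and the socle of its image is known; the preimage of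
  that socle is \<open>theta_ker d (Suc r)\<close> because this kernel contains
  \<open>theta_ker d r\<close>.\<close>

lemma socle_theta:
  assumes epi: "lin_rep.epi (so_inf scale Q) (free_power d) \<phi> M'"
    and ker: "\<And>p. p \<in> carr (free_power d) \<Longrightarrow> \<phi> p = zero M' \<longleftrightarrow> p \<in> theta_ker d r"
    and p: "p \<in> carr (free_power d)"
  shows "\<phi> p \<in> soc (so_inf scale Q) M' \<longleftrightarrow> p \<in> theta_ker d (Suc r)"
proof -
  interpret R: traceless_family scale Q "disjoint_pairs d r" "free_slots d" "theta d r ` carr (free_power d)"
      "d - 2 * r" "theta d r ` theta_ker d (Suc r)"
    by (rule traceless_family_theta)
  interpret lin_rep "so_inf scale Q" "free_power d :: ('k, 'v \<Rightarrow> 'v, 'v list \<Rightarrow>\<^sub>0 'k) rep"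
    by (rule free_power_lin_rep)
  have epi': "epi (theta d r) R.FM"
    unfolding epi_def R.FM_def
    by (simp del: free_power_sel(5) add: theta_add theta_zero theta_fscale theta_leibniz)
  have ker': "\<phi> p = zero M' \<longleftrightarrow> theta d r p = zero R.FM" if "p \<in> carr (free_power d)" for p
    using ker[OF that] that unfolding theta_ker_def R.FM_def by simp
  have "\<phi> p \<in> soc (so_inf scale Q) M' \<longleftrightarrow> theta d r p \<in> soc (so_inf scale Q) R.FM"
    using soc_transfer[OF epi epi' ker' p] soc_transfer[OF epi' epi ker'[symmetric] p] by blast
  also have "\<dots> \<longleftrightarrow> theta d r p \<in> theta d r ` theta_ker d (Suc r)" unfolding R.soc_FM ..
  also have "\<dots> \<longleftrightarrow> p \<in> theta_ker d (Suc r)"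
  proof
    assume "theta d r p \<in> theta d r ` theta_ker d (Suc r)"
    then obtain q where q: "q \<in> theta_ker d (Suc r)" "theta d r p = theta d r q" by blast
    have qc: "q \<in> carr (free_power d)" using q unfolding theta_ker_def by blast
    have "p - q \<in> theta_ker d r"
      using diff_in[OF p qc] q(2) unfolding theta_ker_def by (simp add: theta_diff)
    then have "p - q \<in> theta_ker d (Suc r)" using theta_ker_mono by blast
    then have "theta d (Suc r) (p - q) + theta d (Suc r) q = 0"
      using q(1) unfolding theta_ker_def by simp
    then have "theta d (Suc r) p = 0" by (simp add: theta_diff)
    then show "p \<in> theta_ker d (Suc r)" using p unfolding theta_ker_def by simp
  qed blast
  finally show ?thesis .
qed

end

section \<open>The socle filtration of the tensor power\<close>

context countable_quadratic_space
begin

section \<open>The tensor relations as a kernel\<close>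

lemma disjoint_pairs_0: "disjoint_pairs d 0 = {[]}"
  unfolding disjoint_pairs_def by auto

lemma contr_value_Nil: "contr_value d [] v W = (\<Prod>k<d. Q (v k) (W k))"
proof -
  have "free_slots d [] = {..<d}" unfolding free_slots_def by auto
  then show ?thesis by (simp add: contr_value_def pair_prod_def)
qed

lemma theta_0_eq: "theta d 0 p = 0 \<longleftrightarrow> (\<forall>W. ev (\<lambda>vs. \<Prod>k<d. Q (vs ! k) (W k)) p = 0)"
  by (auto simp: theta_def disjoint_pairs_0 contr_value_Nil fun_eq_iff)

lemma prod_insert_nth:
  assumes "length us + length ws + 1 = d"
  shows "(\<Prod>k<d. Q ((us @ x # ws) ! k) (W k))
    = Q x (W (length us)) * (\<Prod>k\<in>{..<d} - {length us}. Q ((us @ 0 # ws) ! k) (W k))"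
proof -
  have "(\<Prod>k\<in>{..<d} - {length us}. Q ((us @ x # ws) ! k) (W k))
    = (\<Prod>k\<in>{..<d} - {length us}. Q ((us @ 0 # ws) ! k) (W k))"
    by (rule prod.cong) (auto simp: nth_append nth_Cons split: nat.splits)
  then show ?thesis using assms by (subst prod.remove[of _ "length us"]) auto
qed

lemma tensor_rels_subset: "tensor_rels scale d \<subseteq> theta_ker d 0"
proof -
  interpret F: module "fscale :: 'k \<Rightarrow> ('v list \<Rightarrow>\<^sub>0 'k) \<Rightarrow> _" by (rule module_fscale)
  have s: "F.subspace (theta_ker d 0)"
    using submod_theta_ker[of d 0] unfolding submod_def F.subspace_def by simp
  have g: "gen vs \<in> carr (free_power d)" if "length vs = d" for vs :: "'v list" using that by simp
  interpret L: lin_rep "so_inf scale Q" "free_power d :: ('k, 'v \<Rightarrow> 'v, 'v list \<Rightarrow>\<^sub>0 'k) rep"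
    by (rule free_power_lin_rep)
  have sm: "fscale c p \<in> carr (free_power d)" if "p \<in> carr (free_power d)" for c and p :: "'v list \<Rightarrow>\<^sub>0 'k"
    using L.smult_in[OF that] by simp
  have mem: "p \<in> theta_ker d 0"
    if "p \<in> carr (free_power d)" "\<And>W. ev (\<lambda>vs. \<Prod>k<d. Q (vs ! k) (W k)) p = 0" for p
    unfolding theta_ker_def theta_0_eq using that by blast
  have 1: "gen (us @ (v + w) # ws) - gen (us @ v # ws) - gen (us @ w # ws) \<in> theta_ker d 0" (is "?x \<in> _")
    if l: "length us + length ws + 1 = d" for us v w ws
  proof (rule mem)
    show "?x \<in> carr (free_power d)"
      by (intro L.diff_in g) (use l in auto)
  qed (simp only: ev_diff ev_gen prod_insert_nth[OF l] Q_add_left, simp add: algebra_simps)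
  have 2: "gen (us @ scale c v # ws) - fscale c (gen (us @ v # ws)) \<in> theta_ker d 0" (is "?x \<in> _")
    if l: "length us + length ws + 1 = d" for us c v ws
  proof (rule mem)
    show "?x \<in> carr (free_power d)"
      by (intro L.diff_in sm g) (use l in auto)
  qed (simp only: ev_diff ev_fscale ev_gen prod_insert_nth[OF l] Q_scale_left, simp)
  show ?thesis
    unfolding tensor_rels_def by (rule F.span_minimal[OF _ s]) (use 1 2 in blast)
qed

lemma gen_sum_tensor_rels:
  assumes "finite B" and l: "length us + length ws + 1 = d"
  shows "gen (us @ (\<Sum>b\<in>B. scale (c b) b) # ws) - (\<Sum>b\<in>B. fscale (c b) (gen (us @ b # ws))) \<in> tensor_rels scale d"
  using assms(1)
proof (induction B)
  interpret F: module "fscale :: 'k \<Rightarrow> ('v list \<Rightarrow>\<^sub>0 'k) \<Rightarrow> _" by (rule module_fscale)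
  have sc: "gen (us @ scale a v # ws) - fscale a (gen (us @ v # ws)) \<in> tensor_rels scale d" for a v
    unfolding tensor_rels_def by (rule F.span_base) (use l in blast)
  have ad: "gen (us @ (v + w) # ws) - gen (us @ v # ws) - gen (us @ w # ws) \<in> tensor_rels scale d" for v w
    unfolding tensor_rels_def by (rule F.span_base) (use l in blast)
  {
    case empty
    show ?case using sc[of 0 0] by simp
  next
    case (insert b B)
    let ?s = "\<Sum>b\<in>B. scale (c b) b"
    have "gen (us @ (scale (c b) b + ?s) # ws) - (fscale (c b) (gen (us @ b # ws)) + (\<Sum>b\<in>B. fscale (c b) (gen (us @ b # ws))))
      = (gen (us @ (scale (c b) b + ?s) # ws) - gen (us @ scale (c b) b # ws) - gen (us @ ?s # ws))
        + (gen (us @ scale (c b) b # ws) - fscale (c b) (gen (us @ b # ws)))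
        + (gen (us @ ?s # ws) - (\<Sum>b\<in>B. fscale (c b) (gen (us @ b # ws))))" by simp
    also have "\<dots> \<in> tensor_rels scale d"
      using ad sc insert.IH unfolding tensor_rels_def by (intro F.span_add)
    finally show ?case using insert.hyps by simp
  }
qed

text \<open>The prefix \<open>us\<close> collects the basis vectors already chosen, so that the
  induction can run over the remaining entries.\<close>

lemma gen_expand_tensor_rels:
  assumes B: "dual_on B d'" and "set ws \<subseteq> span B" and "length us + length ws = d"
  shows "gen (us @ ws) - (\<Sum>bs | set bs \<subseteq> B \<and> length bs = length ws.
      fscale (\<Prod>k<length ws. Q (ws ! k) (d' (bs ! k))) (gen (us @ bs))) \<in> tensor_rels scale d"
  using assms(2,3)
proof (induction ws arbitrary: us)
  interpret F: module "fscale :: 'k \<Rightarrow> ('v list \<Rightarrow>\<^sub>0 'k) \<Rightarrow> _" by (rule module_fscale)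
  have fB: "finite B" using B by (simp add: dual_on_def)
  {
    case Nil
    have "{bs. set bs \<subseteq> B \<and> length bs = length []} = {[]}" by auto
    then show ?case by (simp add: F.span_zero tensor_rels_def)
  next
    case (Cons v ws)
    let ?C = "\<lambda>bs. \<Prod>k<length ws. Q (ws ! k) (d' (bs ! k))"
    let ?L = "{bs. set bs \<subseteq> B \<and> length bs = length ws}"
    have v: "v = (\<Sum>b\<in>B. scale (Q v (d' b)) b)" by (rule dual_expand[OF B]) (use Cons.prems in simp)
    have 1: "gen (us @ v # ws) - (\<Sum>b\<in>B. fscale (Q v (d' b)) (gen (us @ b # ws))) \<in> tensor_rels scale d"
      using gen_sum_tensor_rels[OF fB, of us ws d "\<lambda>b. Q v (d' b)"] Cons.prems v by simp
    have "gen ((us @ [b]) @ ws) - (\<Sum>bs\<in>?L. fscale (?C bs) (gen ((us @ [b]) @ bs))) \<in> tensor_rels scale d" for b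
      by (rule Cons.IH) (use Cons.prems in auto)
    then have "(\<Sum>b\<in>B. fscale (Q v (d' b))
        (gen ((us @ [b]) @ ws) - (\<Sum>bs\<in>?L. fscale (?C bs) (gen ((us @ [b]) @ bs))))) \<in> tensor_rels scale d"
      unfolding tensor_rels_def by (intro F.span_sum F.span_scale)
    then have 2: "(\<Sum>b\<in>B. fscale (Q v (d' b)) (gen (us @ b # ws)))
        - (\<Sum>b\<in>B. \<Sum>bs\<in>?L. fscale (Q v (d' b) * ?C bs) (gen (us @ b # bs))) \<in> tensor_rels scale d"
      by (simp add: F.scale_right_diff_distrib F.scale_sum_right sum_subtractf)
    have "(\<Sum>b\<in>B. \<Sum>bs\<in>?L. fscale (Q v (d' b) * ?C bs) (gen (us @ b # bs)))
      = (\<Sum>(b, bs)\<in>B \<times> ?L. fscale (\<Prod>k<length (v # ws). Q ((v # ws) ! k) (d' ((b # bs) ! k))) (gen (us @ b # bs)))"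
      by (simp add: sum.cartesian_product prod.lessThan_Suc_shift del: prod.lessThan_Suc)
    also have "\<dots> = (\<Sum>bs\<in>(\<lambda>(b, bs). b # bs) ` (B \<times> ?L).
        fscale (\<Prod>k<length (v # ws). Q ((v # ws) ! k) (d' (bs ! k))) (gen (us @ bs)))"
      by (subst sum.reindex) (auto simp: inj_on_def case_prod_unfold)
    also have "(\<lambda>(b, bs). b # bs) ` (B \<times> ?L) = {bs. set bs \<subseteq> B \<and> length bs = length (v # ws)}"
      by (auto simp: length_Suc_conv image_iff)
    finally have eq: "(\<Sum>b\<in>B. \<Sum>bs\<in>?L. fscale (Q v (d' b) * ?C bs) (gen (us @ b # bs)))
      = (\<Sum>bs | set bs \<subseteq> B \<and> length bs = length (v # ws).
        fscale (\<Prod>k<length (v # ws). Q ((v # ws) ! k) (d' (bs ! k))) (gen (us @ bs)))" .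
    show ?case
      using F.span_add[OF 1[unfolded tensor_rels_def] 2[unfolded tensor_rels_def]]
      unfolding eq tensor_rels_def by simp
  }
qed

text \<open>Modulo the relations a tensor is a combination of lists of basis vectors, and evaluation
  at the dual vectors reads off its coefficients; if all evaluations vanish, so do they.
  Nondegeneracy enters through the existence of dual vectors.\<close>

lemma tensor_rels_eq: "tensor_rels scale d = theta_ker d 0"
proof
  interpret F: module "fscale :: 'k \<Rightarrow> ('v list \<Rightarrow>\<^sub>0 'k) \<Rightarrow> _" by (rule module_fscale)
  show "tensor_rels scale d \<subseteq> theta_ker d 0" by (rule tensor_rels_subset)
  show "theta_ker d 0 \<subseteq> tensor_rels scale d"
  proof
    fix p assume p: "p \<in> theta_ker d 0"
    then have len: "length vs = d" if "vs \<in> Poly_Mapping.keys p" for vs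
      using that unfolding theta_ker_def by auto
    have p0: "ev (\<lambda>vs. \<Prod>k<d. Q (vs ! k) (W k)) p = 0" for W
      using p unfolding theta_ker_def theta_0_eq by blast
    obtain B d' where B: "dual_on B d'" "entries p \<subseteq> span B" using entries_dual by blast
    let ?L = "{bs. set bs \<subseteq> B \<and> length bs = d}"
    let ?C = "\<lambda>vs bs. \<Prod>k<d. Q (vs ! k) (d' (bs ! k))"
    let ?lk = "Poly_Mapping.lookup p"
    have "gen vs - (\<Sum>bs\<in>?L. fscale (?C vs bs) (gen bs)) \<in> tensor_rels scale d"
      if vs: "vs \<in> Poly_Mapping.keys p" for vs
    proof -
      have "set vs \<subseteq> span B" using vs B(2) unfolding entries_def by blast
      then show ?thesis using gen_expand_tensor_rels[OF B(1), of vs "[]" d] len[OF vs] by simp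
    qed
    then have "(\<Sum>vs\<in>Poly_Mapping.keys p. fscale (?lk vs) (gen vs - (\<Sum>bs\<in>?L. fscale (?C vs bs) (gen bs))))
        \<in> tensor_rels scale d"
      unfolding tensor_rels_def by (intro F.span_sum F.span_scale)
    moreover have "(\<Sum>vs\<in>Poly_Mapping.keys p. fscale (?lk vs) (gen vs - (\<Sum>bs\<in>?L. fscale (?C vs bs) (gen bs))))
      = (\<Sum>vs\<in>Poly_Mapping.keys p. fscale (?lk vs) (gen vs))
        - (\<Sum>vs\<in>Poly_Mapping.keys p. \<Sum>bs\<in>?L. fscale (?lk vs * ?C vs bs) (gen bs))"
      by (simp add: F.scale_right_diff_distrib F.scale_sum_right sum_subtractf)
    moreover have "(\<Sum>vs\<in>Poly_Mapping.keys p. fscale (?lk vs) (gen vs)) = p"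
    proof (rule poly_mapping_eqI)
      fix k
      have "Poly_Mapping.lookup (\<Sum>vs\<in>Poly_Mapping.keys p. fscale (?lk vs) (gen vs)) k
        = (\<Sum>vs\<in>Poly_Mapping.keys p. if vs = k then ?lk k else 0)"
        unfolding lookup_sum by (rule sum.cong) (auto simp: lookup_fscale lookup_single)
      then show "Poly_Mapping.lookup (\<Sum>vs\<in>Poly_Mapping.keys p. fscale (?lk vs) (gen vs)) k = ?lk k"
        by (simp add: in_keys_iff)
    qed
    moreover have "(\<Sum>vs\<in>Poly_Mapping.keys p. \<Sum>bs\<in>?L. fscale (?lk vs * ?C vs bs) (gen bs)) = 0"
    proof -
      have "(\<Sum>vs\<in>Poly_Mapping.keys p. \<Sum>bs\<in>?L. fscale (?lk vs * ?C vs bs) (gen bs))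
        = (\<Sum>bs\<in>?L. \<Sum>vs\<in>Poly_Mapping.keys p. fscale (?lk vs * ?C vs bs) (gen bs))" by (rule sum.swap)
      also have "\<dots> = (\<Sum>bs\<in>?L. fscale (ev (\<lambda>vs. ?C vs bs) p) (gen bs))"
        unfolding ev_def F.scale_sum_left ..
      also have "\<dots> = 0" using p0[of "\<lambda>k. d' (_ ! k)"] by simp
      finally show ?thesis .
    qed
    ultimately show "p \<in> tensor_rels scale d" by simp
  qed
qed

section \<open>Contractions on the tensor power\<close>

lemma nths_free_slots:
  assumes "length vs = d"
  shows "nths vs {k. k + 1 \<notin> fst ` set Is \<union> snd ` set Is} = map ((!) vs) (sorted_list_of_set (free_slots d Is))"
proof -
  let ?I = "{k. k + 1 \<notin> fst ` set Is \<union> snd ` set Is}"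
  have z: "zip vs [0..<length vs] = map (\<lambda>i. (vs ! i, i)) [0..<length vs]"
    by (rule nth_equalityI) auto
  have "nths vs ?I = map ((!) vs) (filter (\<lambda>i. i \<in> ?I) [0..<length vs])"
    unfolding nths_def z by (simp add: filter_map o_def)
  moreover have "filter (\<lambda>i. i \<in> ?I) [0..<length vs] = sorted_list_of_set (free_slots d Is)"
  proof (rule sorted_distinct_set_unique)
    show "set (filter (\<lambda>i. i \<in> ?I) [0..<length vs]) = set (sorted_list_of_set (free_slots d Is))"
      using assms by (auto simp: free_slots_def)
  qed (auto intro: sorted_wrt_filter)
  ultimately show ?thesis by simp
qed

lemma free_contraction_in:
  assumes p: "p \<in> carr (free_power d)" and Is: "Is \<in> disjoint_pairs d r"
  shows "free_contraction Q Is p \<in> carr (free_power (d - 2 * r))"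
proof -
  have "Poly_Mapping.keys (free_contraction Q Is p) \<subseteq> {vs. length vs = d - 2 * r}"
    unfolding free_contraction_def
  proof (rule keys_lin_ext)
    fix vs assume "vs \<in> Poly_Mapping.keys p"
    then have l: "length vs = d" using p by auto
    have "length (nths vs {k. k + 1 \<notin> fst ` set Is \<union> snd ` set Is}) = d - 2 * r"
      unfolding nths_free_slots[OF l] using card_free_slots[OF Is] by simp
    then show "Poly_Mapping.keys (fscale (\<Prod>(i, j)\<leftarrow>Is. Q (vs ! (i - 1)) (vs ! (j - 1)))
       (gen (nths vs {k. k + 1 \<notin> fst ` set Is \<union> snd ` set Is}))) \<subseteq> {vs. length vs = d - 2 * r}"
      using keys_fscale by (metis (mono_tags, lifting) empty_subsetI insert_subset keys_single mem_Collect_eq subset_trans)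
  qed
  then show ?thesis by simp
qed

text \<open>The contracted tensor has its slots renumbered from 0, whereas \<open>theta\<close>
  keeps the old numbers; the increasing list \<open>L\<close> of free slots translates between
  them.\<close>

lemma free_contraction_ker:
  assumes p: "p \<in> carr (free_power d)" and Is: "Is \<in> disjoint_pairs d r"
  shows "free_contraction Q Is p \<in> tensor_rels scale (d - 2 * r) \<longleftrightarrow> (\<forall>W. theta d r p Is W = 0)"
proof -
  let ?e = "d - 2 * r"
  define L where "L = sorted_list_of_set (free_slots d Is)"
  have L: "length L = ?e" "distinct L" "set L = free_slots d Is"
    unfolding L_def using card_free_slots[OF Is] by auto
  have main: "ev (\<lambda>vs. \<Prod>k<?e. Q (vs ! k) (W (L ! k))) (free_contraction Q Is p) = theta d r p Is W" for W
  proof -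
    have "ev (\<lambda>vs. \<Prod>k<?e. Q (vs ! k) (W (L ! k))) (free_contraction Q Is p)
      = ev (\<lambda>vs. pair_prod Is ((!) vs) *
          (\<Prod>k<?e. Q (nths vs {k. k + 1 \<notin> fst ` set Is \<union> snd ` set Is} ! k) (W (L ! k)))) p"
      unfolding free_contraction_def by (simp add: ev_lin_ext ev_fscale ev_gen pair_prod_def)
    also have "\<dots> = ev (\<lambda>vs. contr_value d Is ((!) vs) W) p"
    proof (rule ev_cong)
      fix vs assume "vs \<in> Poly_Mapping.keys p"
      then have l: "length vs = d" using p by auto
      have "bij_betw ((!) L) {..<?e} (free_slots d Is)" using bij_betw_nth[OF L(2), of "{..<?e}"] L by simp
      then have "(\<Prod>k\<in>free_slots d Is. Q (vs ! k) (W k)) = (\<Prod>k<?e. Q (vs ! (L ! k)) (W (L ! k)))"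
        by (rule prod.reindex_bij_betw[symmetric])
      moreover have "(\<Prod>k<?e. Q (nths vs {k. k + 1 \<notin> fst ` set Is \<union> snd ` set Is} ! k) (W (L ! k)))
        = (\<Prod>k<?e. Q (vs ! (L ! k)) (W (L ! k)))"
        unfolding nths_free_slots[OF l] L_def[symmetric] by (rule prod.cong) (use L in auto)
      ultimately show "pair_prod Is ((!) vs) *
          (\<Prod>k<?e. Q (nths vs {k. k + 1 \<notin> fst ` set Is \<union> snd ` set Is} ! k) (W (L ! k)))
        = contr_value d Is ((!) vs) W" unfolding contr_value_def by simp
    qed
    finally show ?thesis using Is by (simp add: theta_def)
  qed
  have "free_contraction Q Is p \<in> tensor_rels scale ?e
    \<longleftrightarrow> (\<forall>W. ev (\<lambda>vs. \<Prod>k<?e. Q (vs ! k) (W k)) (free_contraction Q Is p) = 0)"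
    unfolding tensor_rels_eq theta_ker_def theta_0_eq using free_contraction_in[OF p Is] by blast
  also have "\<dots> \<longleftrightarrow> (\<forall>W. theta d r p Is W = 0)"
  proof
    assume "\<forall>W. ev (\<lambda>vs. \<Prod>k<?e. Q (vs ! k) (W k)) (free_contraction Q Is p) = 0"
    then show "\<forall>W. theta d r p Is W = 0" using main by metis
  next
    assume *: "\<forall>W. theta d r p Is W = 0"
    show "\<forall>W. ev (\<lambda>vs. \<Prod>k<?e. Q (vs ! k) (W k)) (free_contraction Q Is p) = 0"
    proof
      fix W :: "nat \<Rightarrow> 'v"
      \<comment> \<open>Test vectors for the contracted tensor are placed into the free slots of the
        original one.\<close>
      have "(\<lambda>vs. \<Prod>k<?e. Q (vs ! k) (W k)) = (\<lambda>vs. \<Prod>k<?e. Q (vs ! k) (put (\<lambda>_. 0) L W (L ! k)))"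
        using L by simp
      then show "ev (\<lambda>vs. \<Prod>k<?e. Q (vs ! k) (W k)) (free_contraction Q Is p) = 0"
        using main[of "put (\<lambda>_. 0) L W"] * by simp
    qed
  qed
  finally show ?thesis .
qed

abbreviation tensor_class :: "nat \<Rightarrow> ('v list \<Rightarrow>\<^sub>0 'k) \<Rightarrow> ('v list \<Rightarrow>\<^sub>0 'k) set" where
  "tensor_class d p \<equiv> coset (free_power d) (tensor_rels scale d) p"

lemma carr_tensor_power: "carr (tensor_power scale d) = tensor_class d ` carr (free_power d)"
  unfolding tensor_power_def quot_def by simp

lemma tensor_rels_subset_ker: "tensor_rels scale d \<subseteq> theta_ker d r"
  unfolding tensor_rels_eq by (induction r) (use theta_ker_mono in auto)

text \<open>A contraction of a class is a union over representatives. Contractions send relations to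
  relations, by \<open>tensor_rels_subset_ker\<close>, so a single representative decides.\<close>

lemma contraction_kernel_iff:
  assumes p: "p \<in> carr (free_power d)" and Is: "Is \<in> disjoint_pairs d r"
  shows "tensor_class d p \<in> contraction_kernel scale Q d Is \<longleftrightarrow> (\<forall>W. theta d r p Is W = 0)"
proof -
  let ?e = "d - 2 * r"
  interpret F: module "fscale :: 'k \<Rightarrow> ('v list \<Rightarrow>\<^sub>0 'k) \<Rightarrow> _" by (rule module_fscale)
  have len: "length Is = r" by (rule disjoint_pairsD(1)[OF Is])
  have z: "zero (tensor_power scale ?e) = tensor_rels scale ?e" by (simp add: tensor_power_def quot_def)
  have c: "tensor_class n q = (+) q ` tensor_rels scale n" for n q by (simp add: coset_def)
  have 0: "0 \<in> tensor_rels scale n" for n unfolding tensor_rels_def by (rule F.span_zero)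
  have ra: "a + b \<in> tensor_rels scale n" if "a \<in> tensor_rels scale n" "b \<in> tensor_rels scale n" for n a b
    using that unfolding tensor_rels_def by (rule F.span_add)
  have cz: "tensor_class n q = tensor_rels scale n" if q: "q \<in> tensor_rels scale n" for n q
  proof -
    have "x \<in> (+) q ` tensor_rels scale n" if "x \<in> tensor_rels scale n" for x
    proof
      show "x - q \<in> tensor_rels scale n" using that q unfolding tensor_rels_def by (rule F.span_diff)
    qed simp
    then show ?thesis
      unfolding c using q ra by blast
  qed
  have "tensor_class d p \<in> contraction_kernel scale Q d Is
    \<longleftrightarrow> (\<Union>a\<in>tensor_class d p. tensor_class ?e (free_contraction Q Is a)) = tensor_rels scale ?e"
    using p unfolding contraction_kernel_def contraction_def len z carr_tensor_power by (auto simp: Let_def)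
  also have "\<dots> \<longleftrightarrow> free_contraction Q Is p \<in> tensor_rels scale ?e"
  proof
    assume *: "(\<Union>a\<in>tensor_class d p. tensor_class ?e (free_contraction Q Is a)) = tensor_rels scale ?e"
    have "p \<in> tensor_class d p" unfolding c using 0[of d] by force
    moreover have "free_contraction Q Is p \<in> tensor_class ?e (free_contraction Q Is p)"
      unfolding c using 0[of ?e] by force
    ultimately show "free_contraction Q Is p \<in> tensor_rels scale ?e" using * by blast
  next
    assume *: "free_contraction Q Is p \<in> tensor_rels scale ?e"
    have "tensor_class ?e (free_contraction Q Is a) = tensor_rels scale ?e" if a: "a \<in> tensor_class d p" for a
    proof (rule cz)
      obtain q where q: "q \<in> tensor_rels scale d" "a = p + q" using a unfolding c by blast
      have "q \<in> theta_ker d r" using tensor_rels_subset_ker q(1) by blast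
      then have qc: "q \<in> carr (free_power d)" and "theta d r q = 0" unfolding theta_ker_def by blast+
      then have "free_contraction Q Is q \<in> tensor_rels scale ?e"
        unfolding free_contraction_ker[OF qc Is] by simp
      moreover have "free_contraction Q Is a = free_contraction Q Is p + free_contraction Q Is q"
        unfolding q(2) free_contraction_def by (rule lin_ext_add)
      ultimately show "free_contraction Q Is a \<in> tensor_rels scale ?e"
        using * ra by simp
    qed
    moreover have "tensor_class d p \<noteq> {}" unfolding c using 0 by blast
    ultimately show "(\<Union>a\<in>tensor_class d p. tensor_class ?e (free_contraction Q Is a)) = tensor_rels scale ?e"
      by auto
  qed
  finally show ?thesis unfolding free_contraction_ker[OF p Is] .
qed

text \<open>\<open>theta_ker d r\<close> contains the relations and is therefore a union of
  classes.\<close>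

lemma tensor_class_ker_iff:
  "tensor_class d p \<in> tensor_class d ` theta_ker d r \<longleftrightarrow> p \<in> theta_ker d r"
proof
  interpret F: module "fscale :: 'k \<Rightarrow> ('v list \<Rightarrow>\<^sub>0 'k) \<Rightarrow> _" by (rule module_fscale)
  assume "tensor_class d p \<in> tensor_class d ` theta_ker d r"
  then obtain q where q: "q \<in> theta_ker d r" "tensor_class d p = tensor_class d q" by blast
  have "0 \<in> tensor_rels scale d" unfolding tensor_rels_def by (rule F.span_zero)
  then have "p \<in> tensor_class d p" unfolding coset_def by force
  then have "p \<in> tensor_class d q" using q(2) by simp
  then obtain s where s: "s \<in> tensor_rels scale d" "p = q + s" unfolding coset_def by auto
  have "s \<in> theta_ker d r" using s(1) tensor_rels_subset_ker by blast
  then show "p \<in> theta_ker d r" using q(1) s(2) submod_theta_ker[of d r] unfolding submod_def by simp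
qed blast

text \<open>The class map followed by the projection modulo stage \<open>r\<close> is a presentation
  of the quotient by \<open>free_power d\<close> with kernel \<open>theta_ker d r\<close>, to which
  \<open>socle_theta\<close> applies.\<close>

lemma soc_filt_tensor_power:
  "soc_filt (so_inf scale Q) (tensor_power scale d) r = tensor_class d ` theta_ker d r"
proof -
  let ?g = "so_inf scale Q" and ?T = "tensor_power scale d"
  interpret lin_rep ?g "free_power d :: ('k, 'v \<Rightarrow> 'v, 'v list \<Rightarrow>\<^sub>0 'k) rep" by (rule free_power_lin_rep)
  have id: "epi (\<lambda>p. p) (free_power d)" unfolding epi_def by simp
  have sub: "submod ?g (free_power d) (tensor_rels scale d)"
    unfolding tensor_rels_eq by (rule submod_theta_ker)
  have e0: "epi (tensor_class d) ?T"
    unfolding tensor_power_def by (rule epi_quot(1)[OF id sub])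
  have k0: "tensor_class d p = zero ?T \<longleftrightarrow> p \<in> theta_ker d 0" if "p \<in> carr (free_power d)" for p
    using epi_quot(2)[OF id sub that] unfolding tensor_power_def tensor_rels_eq .
  have kc: "theta_ker d r \<subseteq> carr (free_power d)" for r unfolding theta_ker_def by blast
  show ?thesis
  proof (induction r)
    case 0
    have "zero ?T = tensor_class d 0" using e0 unfolding epi_def by blast
    moreover have "tensor_class d p = zero ?T" if "p \<in> theta_ker d 0" for p using k0 that kc by blast
    moreover have "0 \<in> theta_ker d 0" using submod_theta_ker[of d 0] unfolding submod_def by simp
    ultimately show ?case by (auto simp: image_iff)
  next
    case (Suc r)
    have sr: "submod ?g ?T (tensor_class d ` theta_ker d r)"
      by (rule submod_image[OF e0 submod_theta_ker])
    let ?\<phi> = "\<lambda>p. coset ?T (tensor_class d ` theta_ker d r) (tensor_class d p)"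
    have e1: "epi ?\<phi> (quot ?T (tensor_class d ` theta_ker d r))" by (rule epi_quot(1)[OF e0 sr])
    have k1: "?\<phi> p = zero (quot ?T (tensor_class d ` theta_ker d r)) \<longleftrightarrow> p \<in> theta_ker d r"
      if "p \<in> carr (free_power d)" for p
      using epi_quot(2)[OF e0 sr that] tensor_class_ker_iff by blast
    have "?\<phi> p \<in> soc ?g (quot ?T (tensor_class d ` theta_ker d r)) \<longleftrightarrow> p \<in> theta_ker d (Suc r)"
      if "p \<in> carr (free_power d)" for p
      by (rule socle_theta[OF e1 k1 that])
    then show ?case
      using kc[of "Suc r"] unfolding soc_filt.simps Suc.IH carr_tensor_power by auto
  qed
qed

text \<open>The pairs (1,2), (3,4), and so on. An admissible collection serves twice: it excludes an
  empty intersection and gives a contraction that does not vanish.\<close>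

lemma disjoint_pairs_nonempty:
  assumes "2 * r \<le> d" shows "map (\<lambda>n. (2 * n + 1, 2 * n + 2)) [0..<r] \<in> disjoint_pairs d r"
proof -
  have "distinct (map (\<lambda>n. 2 * n + 1) [0..<r] @ map (\<lambda>n. 2 * n + 2) [0..<r])"
  proof -
    have "2 * a + 1 \<noteq> 2 * b + (2 :: nat)" for a b by presburger
    then show ?thesis by (auto simp: distinct_map inj_on_def)
  qed
  then show ?thesis using assms unfolding disjoint_pairs_def by (auto simp: o_def)
qed

lemma theta_ker_top:
  assumes "d < 2 * r" shows "theta_ker d r = carr (free_power d)"
proof -
  have "disjoint_pairs d r = {}" using card_free_slots[of _ d r] assms by fastforce
  then show ?thesis unfolding theta_ker_def by (auto simp: theta_def fun_eq_iff)
qed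

text \<open>For the tensor all of whose entries are one \<open>v\<close> with
  \<open>Q v v = 1\<close>, the contraction along consecutive pairs, tested on \<open>v\<close>, has
  value 1.\<close>

lemma theta_ker_proper:
  assumes "2 * r \<le> d" shows "theta_ker d r \<noteq> carr (free_power d)"
proof -
  obtain v where v: "Q v v = 1" using unit_vector[of "{}"] by blast
  let ?p = "gen (replicate d v) :: 'v list \<Rightarrow>\<^sub>0 'k"
  let ?Is = "map (\<lambda>n. (2 * n + 1, 2 * n + 2)) [0..<r]"
  note Is = disjoint_pairs_nonempty[OF assms]
  have "pair_prod ?Is ((!) (replicate d v)) = (\<Prod>n\<leftarrow>[0..<r]. 1)"
    unfolding pair_prod_def map_map
    by (rule arg_cong[where f = prod_list], rule map_cong[OF refl]) (use assms v in auto)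
  also have "\<dots> = 1" by (induction r) auto
  finally have P: "pair_prod ?Is ((!) (replicate d v)) = 1" .
  have "(\<Prod>k\<in>free_slots d ?Is. Q (replicate d v ! k) v) = (\<Prod>k\<in>free_slots d ?Is. 1)"
    by (rule prod.cong) (auto simp: free_slots_def v)
  then have one: "theta d r ?p ?Is (\<lambda>_. v) = 1" using Is P by (simp add: theta_def ev_gen contr_value_def)
  have "theta d r ?p \<noteq> 0"
  proof
    assume "theta d r ?p = 0"
    from one[unfolded this] show False by simp
  qed
  then have "?p \<notin> theta_ker d r" unfolding theta_ker_def by blast
  moreover have "?p \<in> carr (free_power d)" by simp
  ultimately show ?thesis by blast
qed

lemma soc_filt_eq_carr_iff:
  "soc_filt (so_inf scale Q) (tensor_power scale d) r = carr (tensor_power scale d) \<longleftrightarrow> d < 2 * r"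
proof
  assume *: "soc_filt (so_inf scale Q) (tensor_power scale d) r = carr (tensor_power scale d)"
  show "d < 2 * r"
  proof (rule ccontr)
    assume "\<not> d < 2 * r"
    moreover have "theta_ker d r = carr (free_power d)"
    proof
      show "theta_ker d r \<subseteq> carr (free_power d)" unfolding theta_ker_def by blast
      have eq: "tensor_class d ` theta_ker d r = tensor_class d ` carr (free_power d)"
        using * unfolding soc_filt_tensor_power carr_tensor_power .
      show "carr (free_power d) \<subseteq> theta_ker d r"
      proof
        fix p :: "'v list \<Rightarrow>\<^sub>0 'k" assume "p \<in> carr (free_power d)"
        then have "tensor_class d p \<in> tensor_class d ` theta_ker d r" unfolding eq by (rule imageI)
        then show "p \<in> theta_ker d r" unfolding tensor_class_ker_iff .
      qed
    qed
    ultimately show False using theta_ker_proper[of r d] by simp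
  qed
next
  assume "d < 2 * r"
  then show "soc_filt (so_inf scale Q) (tensor_power scale d) r = carr (tensor_power scale d)"
    unfolding soc_filt_tensor_power carr_tensor_power by (simp only: theta_ker_top)
qed

lemma soc_filt_contraction_kernels:
  assumes "2 * r \<le> d"
  shows "soc_filt (so_inf scale Q) (tensor_power scale d) r
    = (\<Inter>Is\<in>disjoint_pairs d r. contraction_kernel scale Q d Is)"
proof -
  have iff: "tensor_class d p \<in> soc_filt (so_inf scale Q) (tensor_power scale d) r
      \<longleftrightarrow> tensor_class d p \<in> (\<Inter>Is\<in>disjoint_pairs d r. contraction_kernel scale Q d Is)"
    if p: "p \<in> carr (free_power d)" for p
  proof -
    have "p \<in> theta_ker d r \<longleftrightarrow> (\<forall>Is\<in>disjoint_pairs d r. \<forall>W. theta d r p Is W = 0)"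
      using p unfolding theta_ker_def by (auto simp: fun_eq_iff theta_def)
    then show ?thesis using contraction_kernel_iff[OF p] unfolding soc_filt_tensor_power tensor_class_ker_iff by blast
  qed
  have "soc_filt (so_inf scale Q) (tensor_power scale d) r \<subseteq> tensor_class d ` carr (free_power d)"
    unfolding soc_filt_tensor_power theta_ker_def by blast
  \<comment> \<open>An intersection over no collections would be the set of all cosets and
    non-cosets alike; \<open>2 * r \<le> d\<close> guarantees that a collection exists.\<close>
  moreover have "(\<Inter>Is\<in>disjoint_pairs d r. contraction_kernel scale Q d Is) \<subseteq> tensor_class d ` carr (free_power d)"
    using disjoint_pairs_nonempty[OF assms] carr_tensor_power unfolding contraction_kernel_def by blast
  ultimately show ?thesis using iff by blast
qed

end

theorem theorem4p2:
  fixes scale :: "'k::{alg_closed_field, field_char_0} \<Rightarrow> 'v::ab_group_add \<Rightarrow> 'v"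
    and Q :: "'v \<Rightarrow> 'v \<Rightarrow> 'k"
    and d :: nat
  assumes "countable_quadratic_space scale Q"
  shows "has_loewy_length (so_inf scale Q) (tensor_power scale d) (d div 2 + 1)
    \<and> (\<forall>r\<in>{1..d div 2}. soc_filt (so_inf scale Q) (tensor_power scale d) r
         = (\<Inter>Is\<in>disjoint_pairs d r. contraction_kernel scale Q d Is))"
proof -
  interpret countable_quadratic_space scale Q by fact
  \<comment> \<open>The least \<open>r\<close> with \<open>d < 2 * r\<close> is
    \<open>d div 2 + 1\<close>, for even and for odd \<open>d\<close>.\<close>
  have "has_loewy_length (so_inf scale Q) (tensor_power scale d) (d div 2 + 1)"
    unfolding has_loewy_length_def soc_filt_eq_carr_iff by auto
  moreover have "2 * r \<le> d" if "r \<in> {1..d div 2}" for r using that by auto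
  ultimately show ?thesis using soc_filt_contraction_kernels by blast
qed

end
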